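(* Consider the random LSV maps $(T_\omega)_{\omega\in\Omega}$ of the context, with $\operatorname{ess\,sup}_{\omega}\beta(\omega)<1$ and $\gamma\in(0,1)$ such that $b_0:=\mathbb P(\beta(\omega)\le\gamma)>0$. Let $g_1,g_2:M\to\mathbb R$ be Lipschitz continuous. There exists $\tilde\varepsilon\in(0,1/2)$ depending only on the random dynamical system such that for any $\varepsilon\in(0,\tilde\varepsilon]$, any integers $0\le s\le i<j$, and for $\mathbb P$-a.e. $\omega\in\Omega$, $$\Big\|\Big[L_{\sigma^i\omega}^{j-i}\big(g_2\,L_{\sigma^s\omega}^{i-s}(g_1)\big)\Big]_{\sigma^j\omega}\Big\|_{L^1(\mu_{\sigma^j\omega})}\le C(1+\|g_1\|_{\mathrm{Lip}})(1+\|g_2\|_{\mathrm{Lip}})\,(1+N_\varepsilon(\sigma^i\omega))^{1\vee(1/\gamma-1)}\,(j-i)^{-1/\gamma+1}.$$ Here $C$ is a positive constant depending only on the random dynamical system.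
   Context: $(\Omega,\mathcal F,\mathbb P)$ is a probability space with an invertible ergodic $\mathbb P$-preserving transformation $\sigma$. $M=[0,1]$, $m$ is Lebesgue measure. For $\beta\in(0,1)$ the LSV map is $T_\beta(x)=x(1+2^\beta x^\beta)$ for $0\le x<1/2$ and $T_\beta(x)=2x-1$ for $1/2\le x\le1$. $\beta:\Omega\to(0,1)$ is measurable, $T_\omega:=T_{\beta(\omega)}$, $T_\omega^n:=T_{\sigma^{n-1}\omega}\circ\cdots\circ T_{\sigma\omega}\circ T_\omega$. $\mathcal L_\omega$ is the transfer operator of $T_\omega$ with respect to $m$: $\mathcal L_\omega\varphi(x)=\sum_{T_\omega(y)=x}\varphi(y)/T_\omega'(y)$; $\mathcal L_\omega^n:=\mathcal L_{\sigma^{n-1}\omega}\circ\cdots\circ\mathcal L_\omega$. The cocycle has a unique random absolutely continuous invariant measure $(\mu_\omega)_{\omega}$: $d\mu_\omega=h_\omega\,dm$, $(T_\omega)_*\mu_\omega=\mu_{\sigma\omega}$ for $\mathbb P$-a.e. $\omega$, with $h_\omega=\lim_{n\to\infty}\mathcal L_{\sigma^{-n}\omega}^n1$ in $L^1(m)$. $L_\omega:L^1(\mu_\omega)\to L^1(\mu_{\sigma\omega})$ is $L_\omega\varphi=\mathcal L_\omega(\varphi h_\omega)/h_{\sigma\omega}$, $L_\omega^n:=L_{\sigma^{n-1}\omega}\circ\cdots\circ L_\omega$, $L_\omega^0=\mathrm{Id}$. $[g]_\omega:=g-\mu_\omega(g)$; $\|\cdot\|_{\mathrm{Lip}}$ is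 the usual Lipschitz norm (supremum norm plus Lipschitz constant); $a\vee b=\max(a,b)$. For $\delta\in\{\sigma,\sigma^{-1}\}$ let $S_n^\delta(\omega)=\sum_{i=0}^{n-1}\psi(\delta^i\omega)$, where $\psi(\omega)=\mathbf 1_{(0,\gamma]}(\beta(\omega))$. For $\varepsilon\in(0,1/2)$, $$N_\varepsilon(\omega)=\max_{\delta\in\{\sigma,\sigma^{-1}\}}\max\Big(\big\{n\ge1:\ n^{-1}S_n^\delta(\omega)\notin[b_0(1-\varepsilon),b_0(1+\varepsilon)]\big\}\cup\{0\}\Big),$$ which is finite for $\mathbb P$-a.e. $\omega$. "Random dynamical system" refers to the data $(\Omega,\mathcal F,\mathbb P,\sigma)$, $\beta(\cdot)$ and $\gamma$. *)

theory Defs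
  imports "HOL-Probability.Probability"
begin

section \<open>The base system\<close>

definition invertible_mpt :: "'a measure \<Rightarrow> ('a \<Rightarrow> 'a) \<Rightarrow> bool" where
  "invertible_mpt P \<sigma> \<longleftrightarrow>
     \<sigma> \<in> P \<rightarrow>\<^sub>M P \<and> bij_betw \<sigma> (space P) (space P) \<and>
     inv_into (space P) \<sigma> \<in> P \<rightarrow>\<^sub>M P \<and> distr P P \<sigma> = P"

definition ergodic :: "'a measure \<Rightarrow> ('a \<Rightarrow> 'a) \<Rightarrow> bool" where
  "ergodic P \<sigma> \<longleftrightarrow>
     (\<forall>A\<in>sets P. \<sigma> -` A \<inter> space P = A \<longrightarrow> measure P A = 0 \<or> measure P A = 1)"


section \<open>LSV maps and transfer operators\<close>

abbreviation leb01 :: "real measure" where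
  "leb01 \<equiv> restrict_space lborel {0..1}"

definition lsv :: "real \<Rightarrow> real \<Rightarrow> real" where
  "lsv b x = (if x < 1/2 then x * (1 + 2 powr b * x powr b) else 2 * x - 1)"

text \<open>
  The derivative of \<^term>\<open>lsv b\<close> on \<open>[0, 1]\<close>; at the discontinuity \<open>1/2\<close> it is the one of the
  right branch (see \<open>lsv_has_derivative\<close> below).
\<close>

definition lsv_deriv :: "real \<Rightarrow> real \<Rightarrow> real" where
  "lsv_deriv b x = (if x < 1/2 then 1 + (1 + b) * 2 powr b * x powr b else 2)"

definition transfer :: "real \<Rightarrow> (real \<Rightarrow> real) \<Rightarrow> real \<Rightarrow> real" where
  "transfer b \<phi> x = (\<Sum>y | y \<in> {0..1} \<and> lsv b y = x. \<phi> y / lsv_deriv b y)"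

fun transfer_cocycle ::
  "('a \<Rightarrow> 'a) \<Rightarrow> ('a \<Rightarrow> real) \<Rightarrow> nat \<Rightarrow> 'a \<Rightarrow> (real \<Rightarrow> real) \<Rightarrow> real \<Rightarrow> real" where
  "transfer_cocycle \<sigma> \<beta> 0 \<omega> \<phi> = \<phi>"
| "transfer_cocycle \<sigma> \<beta> (Suc n) \<omega> \<phi> =
     transfer (\<beta> ((\<sigma> ^^ n) \<omega>)) (transfer_cocycle \<sigma> \<beta> n \<omega> \<phi>)"

text \<open>The \<open>L\<^sup>1\<close> norm takes values in \<^typ>\<open>ennreal\<close>, so it is \<open>\<infinity>\<close> outside of \<open>L\<^sup>1\<close>.\<close>

definition L1_norm :: "real measure \<Rightarrow> (real \<Rightarrow> real) \<Rightarrow> ennreal" where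
  "L1_norm \<mu> f = (\<integral>\<^sup>+x. ennreal \<bar>f x\<bar> \<partial>\<mu>)"


section \<open>The random absolutely continuous invariant measure\<close>

definition fibre_measure :: "('a \<Rightarrow> real \<Rightarrow> real) \<Rightarrow> 'a \<Rightarrow> real measure" where
  "fibre_measure h \<omega> = density leb01 (\<lambda>x. ennreal (h \<omega> x))"

text \<open>
  The last clause determines \<^term>\<open>h \<omega>\<close> as an element of \<open>L\<^sup>1\<close> for almost every \<open>\<omega>\<close>; thus \<^term>\<open>h\<close>
  ranges over the versions of one and the same family of densities.
\<close>

definition random_acim_density ::
  "'a measure \<Rightarrow> ('a \<Rightarrow> 'a) \<Rightarrow> ('a \<Rightarrow> real) \<Rightarrow> ('a \<Rightarrow> real \<Rightarrow> real) \<Rightarrow> bool" where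
  "random_acim_density P \<sigma> \<beta> h \<longleftrightarrow>
     (AE \<omega> in P. h \<omega> \<in> borel_measurable leb01 \<and> (AE x in leb01. 0 \<le> h \<omega> x) \<and>
        prob_space (fibre_measure h \<omega>)) \<and>
     (AE \<omega> in P. distr (fibre_measure h \<omega>) leb01 (lsv (\<beta> \<omega>)) = fibre_measure h (\<sigma> \<omega>)) \<and>
     (AE \<omega> in P. (\<lambda>n. L1_norm leb01 (\<lambda>x.
          transfer_cocycle \<sigma> \<beta> n ((inv_into (space P) \<sigma> ^^ n) \<omega>) (\<lambda>_. 1) x - h \<omega> x))
        \<longlonglongrightarrow> 0)"

definition norm_transfer ::
  "('a \<Rightarrow> 'a) \<Rightarrow> ('a \<Rightarrow> real) \<Rightarrow> ('a \<Rightarrow> real \<Rightarrow> real) \<Rightarrow> 'a \<Rightarrow> (real \<Rightarrow> real) \<Rightarrow> real \<Rightarrow> real" where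
  "norm_transfer \<sigma> \<beta> h \<omega> \<phi> x = transfer (\<beta> \<omega>) (\<lambda>y. \<phi> y * h \<omega> y) x / h (\<sigma> \<omega>) x"

fun norm_transfer_cocycle ::
  "('a \<Rightarrow> 'a) \<Rightarrow> ('a \<Rightarrow> real) \<Rightarrow> ('a \<Rightarrow> real \<Rightarrow> real) \<Rightarrow> nat \<Rightarrow> 'a \<Rightarrow> (real \<Rightarrow> real) \<Rightarrow> real \<Rightarrow> real"
where
  "norm_transfer_cocycle \<sigma> \<beta> h 0 \<omega> \<phi> = \<phi>"
| "norm_transfer_cocycle \<sigma> \<beta> h (Suc n) \<omega> \<phi> =
     norm_transfer \<sigma> \<beta> h ((\<sigma> ^^ n) \<omega>) (norm_transfer_cocycle \<sigma> \<beta> h n \<omega> \<phi>)"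

definition centred :: "real measure \<Rightarrow> (real \<Rightarrow> real) \<Rightarrow> real \<Rightarrow> real" where
  "centred \<mu> g x = g x - integral\<^sup>L \<mu> g"


section \<open>Lipschitz norm on the unit interval\<close>

definition Lip01 :: "(real \<Rightarrow> real) \<Rightarrow> bool" where
  "Lip01 g \<longleftrightarrow> (\<exists>K. K-lipschitz_on {0..1} g)"

definition Lip_norm :: "(real \<Rightarrow> real) \<Rightarrow> real" where
  "Lip_norm g = (SUP x\<in>{0..1}. \<bar>g x\<bar>) + Inf {K. K-lipschitz_on {0..1} g}"


section \<open>Frequency of good parameters\<close>

definition good_prob :: "'a measure \<Rightarrow> ('a \<Rightarrow> real) \<Rightarrow> real \<Rightarrow> real" where
  "good_prob P \<beta> \<gamma> = measure P {\<omega> \<in> space P. \<beta> \<omega> \<le> \<gamma>}"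

definition good_visits :: "('a \<Rightarrow> real) \<Rightarrow> real \<Rightarrow> ('a \<Rightarrow> 'a) \<Rightarrow> nat \<Rightarrow> 'a \<Rightarrow> real" where
  "good_visits \<beta> \<gamma> \<delta> n \<omega> = (\<Sum>i<n. indicator {0<..\<gamma>} (\<beta> ((\<delta> ^^ i) \<omega>)))"

text \<open>
  The set below is finite for almost every \<open>\<omega>\<close> by the ergodic theorem; \<^const>\<open>Max\<close> carries no
  information on the null set where it is infinite.
\<close>

definition last_deviation ::
  "'a measure \<Rightarrow> ('a \<Rightarrow> real) \<Rightarrow> real \<Rightarrow> real \<Rightarrow> ('a \<Rightarrow> 'a) \<Rightarrow> 'a \<Rightarrow> nat" where
  "last_deviation P \<beta> \<gamma> \<epsilon> \<delta> \<omega> =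
     Max ({n. n \<ge> 1 \<and> good_visits \<beta> \<gamma> \<delta> n \<omega> / real n \<notin>
             {good_prob P \<beta> \<gamma> * (1 - \<epsilon>)..good_prob P \<beta> \<gamma> * (1 + \<epsilon>)}} \<union> {0})"

definition N_dev ::
  "'a measure \<Rightarrow> ('a \<Rightarrow> 'a) \<Rightarrow> ('a \<Rightarrow> real) \<Rightarrow> real \<Rightarrow> real \<Rightarrow> 'a \<Rightarrow> nat" where
  "N_dev P \<sigma> \<beta> \<gamma> \<epsilon> \<omega> =
     Max ((\<lambda>\<delta>. last_deviation P \<beta> \<gamma> \<epsilon> \<delta> \<omega>) ` {\<sigma>, inv_into (space P) \<sigma>})"


section \<open>Sanity checks\<close>

lemma lsv_has_derivative:
  assumes "0 < x" "x \<noteq> 1/2"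
  shows "(lsv b has_real_derivative lsv_deriv b x) (at x)"
proof (cases "x < 1/2")
  case True
  have "x * (b * x powr (b - 1)) = b * x powr b"
    using assms by (simp add: powr_diff)
  then have eq: "1 + 2 powr b * x powr b + 2 powr b * (x * (b * x powr (b - 1))) = lsv_deriv b x"
    using True by (simp add: lsv_deriv_def algebra_simps)
  have "((\<lambda>x. x * (1 + 2 powr b * x powr b)) has_real_derivative
      1 * (1 + 2 powr b * x powr b) + (2 powr b * (b * x powr (b - 1))) * x) (at x)"
    using assms
    by (intro DERIV_mult DERIV_ident DERIV_cmult has_real_derivative_powr
        DERIV_add[where D = 0, simplified]) auto
  then have "((\<lambda>x. x * (1 + 2 powr b * x powr b)) has_real_derivative lsv_deriv b x) (at x)"
    by (rule DERIV_cong) (use eq in \<open>simp add: algebra_simps\<close>)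
  moreover have "\<forall>\<^sub>F y in nhds x. y \<in> {..<1/2}"
    using True by (intro eventually_nhds_in_open) auto
  then have "\<forall>\<^sub>F y in nhds x. lsv b y = y * (1 + 2 powr b * y powr b)"
    by eventually_elim (auto simp: lsv_def)
  ultimately show ?thesis
    by (simp add: DERIV_cong_ev[OF refl _ refl])
next
  case False
  with assms have "x > 1/2" by simp
  have "((\<lambda>x. 2 * x - 1) has_real_derivative lsv_deriv b x) (at x)"
    using False by (auto intro!: derivative_eq_intros simp: lsv_deriv_def)
  moreover have "\<forall>\<^sub>F y in nhds x. y \<in> {1/2<..}"
    using \<open>x > 1/2\<close> by (intro eventually_nhds_in_open) auto
  then have "\<forall>\<^sub>F y in nhds x. lsv b y = 2 * y - 1"
    by eventually_elim (auto simp: lsv_def)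
  ultimately show ?thesis
    by (simp add: DERIV_cong_ev[OF refl _ refl])
qed

lemma finite_lsv_preimage:
  assumes "0 < b"
  shows "finite {y. y \<in> {0..1} \<and> lsv b y = x}"
proof -
  let ?A = "{y. y \<in> {0..1} \<and> lsv b y = x}"
  have less: "lsv b y < lsv b z" if "0 \<le> y" "y < z" "z < 1/2" for y z
  proof -
    have "y powr b \<le> z powr b"
      using that assms by (intro powr_mono2) auto
    then have "y * (1 + 2 powr b * y powr b) \<le> y * (1 + 2 powr b * z powr b)"
      using that by (intro mult_left_mono) auto
    also have "\<dots> < z * (1 + 2 powr b * z powr b)"
      using that by (intro mult_strict_right_mono) (auto intro: add_pos_nonneg)
    finally show ?thesis
      using that by (simp add: lsv_def)
  qed
  have "inj_on (lsv b) {0..<1/2}"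
    by (rule linorder_inj_onI) (use less in \<open>force+\<close>)
  then have "finite (lsv b -` {x} \<inter> {0..<1/2})"
    by (intro finite_vimage_IntI) auto
  moreover have "?A \<subseteq> (lsv b -` {x} \<inter> {0..<1/2}) \<union> {(x + 1) / 2}"
    by (auto simp: lsv_def field_simps split: if_splits)
  ultimately show ?thesis
    by (meson finite.emptyI finite.insertI finite_UnI finite_subset)
qed

end

theory Submission
  imports Defs
begin

text \<open>
  Write \<open>f\<close> for the centred product \<open>g\<^sub>2 \<L>(g\<^sub>1 h) - const \<L> h\<close> at time \<open>i\<close>, where \<open>h\<close> is the invariant
  density at time \<open>s\<close> and \<open>\<L>\<close> the transfer operator from time \<open>s\<close> to time \<open>i\<close>.  Multiplying the normalised operators by the
  density of the final time shows that the claim concerns the \<open>L\<^sup>1(m)\<close> norm of the image of \<open>f\<close>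
  under \<open>n = j - i\<close> transfer operators (\<open>L1_norm_centred_eq\<close>).

  Transfer operators of LSV maps preserve nonnegative decreasing functions, and this class is
  the only regularity that the proof uses.  It is stable under multiplication with nonnegative decreasing
  functions, and every Lipschitz function is a difference of two of those.  Hence
  \<open>f = F\<^sub>1 - F\<^sub>2\<close> with decreasing \<open>F\<^sub>1\<close>, \<open>F\<^sub>2\<close> of equal mass, bounded by a multiple of \<open>\<L> h\<close>
  (\<open>centred_product_coupled\<close>).  The class is also stable under subtraction of a
  constant that lies below the function.  A constant subtracted from the images of both \<open>F\<^sub>1\<close> and \<open>F\<^sub>2\<close>
  cancels in the difference, so it remains to produce large constants.

  Mass in the right half of the interval becomes a constant lower bound in one step, because the
  left inverse branch spreads the value at \<open>1/2\<close> over the whole interval, and constants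
  stay bounded below under all further operators since \<open>ess sup \<beta> < 1\<close>
  (\<open>transfers_one_lower_bound\<close>).  Hence
  a block of maps turns a fixed fraction \<open>\<kappa>\<close> of the mass that leaves the left half during the
  block into a constant (\<open>transfers_lower_bound_escaping_mass\<close>).  The mass that does not leave is
  controlled by the frequency of parameters at most \<open>\<gamma>\<close>: a point that stays in the left half while \<open>k\<close> such
  parameters occur is at most of order \<open>k powr (- 1/\<gamma>)\<close>, whatever the other parameters are, and
  summing over the time of injection gives mass of order \<open>\<tau> powr (1 - 1/\<gamma>)\<close> for \<open>\<tau>\<close> steps
  (\<open>mass_on_stay_le_tail_const\<close>).

  Taking for the block the last \<open>\<delta> n\<close> of the first \<open>n\<close> steps, the remaining masses satisfy
  \<open>a(n) \<le> (1 - \<kappa>) a((1 - \<delta>) n) + O(n powr (1 - 1/\<gamma>))\<close>.  For small \<open>\<delta>\<close> this recursion has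
  decay rate \<open>n powr (1 - 1/\<gamma>)\<close> (\<open>coupled_decay\<close>).  It may be used as
  soon as the frequency of good parameters is bounded below on all stretches of length at least
  \<open>\<delta> n / 2\<close> that end at time \<open>n\<close>.  This holds if \<open>\<epsilon>\<close> is small compared with \<open>\<delta>\<close> and \<open>n\<close> is at
  least a multiple of \<open>1 + N\<^sub>\<epsilon>\<close> (\<open>num_good_final_stretch\<close>); the trivial bound for smaller \<open>n\<close>
  costs the factor \<open>(1 + N\<^sub>\<epsilon>) powr (1/\<gamma> - 1)\<close>.  That \<open>N\<^sub>\<epsilon>\<close> has
  its intended meaning almost everywhere is the pointwise ergodic theorem for the set of good parameters.

  All of this is done for the images of Lebesgue measure from a remote past instead of \<open>h\<close>, so that
  the monotonicity holds at every point; the bounds pass to the limit in \<open>L\<^sup>1\<close>.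
\<close>

section \<open>The two branches of an LSV map\<close>

text \<open>
  The absolute value extends the left branch to a differentiable function on a neighbourhood of
  \<open>0\<close>, as the substitution rule for integrals requires.
\<close>

definition left_branch :: "real \<Rightarrow> real \<Rightarrow> real" where
  "left_branch b x = x * (1 + 2 powr b * \<bar>x\<bar> powr b)"

definition left_deriv :: "real \<Rightarrow> real \<Rightarrow> real" where
  "left_deriv b x = 1 + (1 + b) * 2 powr b * \<bar>x\<bar> powr b"

definition left_inv :: "real \<Rightarrow> real \<Rightarrow> real" where
  "left_inv b = the_inv_into {0..1/2} (left_branch b)"

lemma has_derivative_left_branch:
  assumes "0 < b"
  shows "(left_branch b has_real_derivative left_deriv b x) (at x)"
proof -
  show ?thesis
  proof (cases "x = 0")
    case True
    have "((\<lambda>h. 1 + 2 powr b * \<bar>h\<bar> powr b) \<longlongrightarrow> 1 + 2 powr b * \<bar>0::real\<bar> powr b) (at 0)"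
      using assms by (intro tendsto_intros tendsto_powr') auto
    then have "((\<lambda>h. 1 + 2 powr b * \<bar>h\<bar> powr b) \<longlongrightarrow> 1) (at (0::real))"
      by simp
    then have "((\<lambda>h. (left_branch b (0 + h) - left_branch b 0) / h) \<longlongrightarrow> 1) (at 0)"
      by (rule Lim_transform_eventually)
        (auto simp: left_branch_def eventually_at_filter intro!: always_eventually)
    then show ?thesis
      using True by (simp add: DERIV_def left_deriv_def)
  next
    case False
    have "((\<lambda>y. \<bar>y\<bar> powr b) has_real_derivative b * \<bar>x\<bar> powr (b - 1) * sgn x) (at x)"
    proof -
      have "((\<lambda>y. sqrt (y\<^sup>2)) has_real_derivative inverse (sqrt (x\<^sup>2)) / 2 * (2 * x)) (at x)"
        by (rule DERIV_chain2[OF DERIV_real_sqrt]) (use False in \<open>auto intro!: derivative_eq_intros\<close>)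
      moreover have "inverse (sqrt (x\<^sup>2)) / 2 * (2 * x) = sgn x"
        using False by (simp add: sgn_if)
      ultimately show ?thesis using DERIV_fun_powr[of abs "sgn x" x b] False by simp
    qed
    note D = DERIV_mult[OF DERIV_ident DERIV_add[OF DERIV_const[of 1] DERIV_cmult[OF this, of "2 powr b"]]]
    show ?thesis
      unfolding left_branch_def[abs_def]
      by (rule DERIV_cong[OF D]) (use False in \<open>auto simp: left_deriv_def powr_diff sgn_if algebra_simps\<close>)
  qed
qed

lemma continuous_on_left_deriv:
  assumes "0 < b"
  shows "continuous_on A (left_deriv b)"
  unfolding left_deriv_def using assms
  by (intro continuous_intros continuous_on_powr') auto

lemma left_deriv_ge_1: "0 < b \<Longrightarrow> 1 \<le> left_deriv b x"
  by (simp add: left_deriv_def)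

lemma left_branch_strict_mono:
  assumes "0 < b" "x < y"
  shows "left_branch b x < left_branch b y"
  by (rule DERIV_pos_imp_increasing[OF assms(2)])
    (meson assms has_derivative_left_branch left_deriv_ge_1 less_le_trans zero_less_one)

lemma left_branch_0 [simp]: "left_branch b 0 = 0"
  by (simp add: left_branch_def)

lemma left_branch_half [simp]: "left_branch b (1/2) = 1"
  by (simp add: left_branch_def powr_divide)

lemma inj_on_left_branch: "0 < b \<Longrightarrow> inj_on (left_branch b) A"
  by (rule linorder_inj_onI) (use left_branch_strict_mono in \<open>force+\<close>)

lemma continuous_on_left_branch: "0 < b \<Longrightarrow> continuous_on A (left_branch b)"
  by (meson DERIV_continuous_on has_derivative_left_branch has_field_derivative_at_within)

lemma left_branch_less_iff: "0 < b \<Longrightarrow> left_branch b x < left_branch b y \<longleftrightarrow> x < y"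
  by (metis left_branch_strict_mono linorder_neqE order_less_asym order_less_irrefl)

lemma left_branch_image:
  assumes "0 < b"
  shows "left_branch b ` {0..1/2} = {0..1}"
proof
  show "left_branch b ` {0..1/2} \<subseteq> {0..1}"
  proof safe
    fix x :: real assume "x \<in> {0..1/2}"
    then have "\<not> left_branch b x < left_branch b 0" "\<not> left_branch b (1/2) < left_branch b x"
      using assms by (simp_all only: left_branch_less_iff) auto
    then show "left_branch b x \<in> {0..1}" by simp
  qed
  show "{0..1} \<subseteq> left_branch b ` {0..1/2}"
  proof
    fix x :: real assume "x \<in> {0..1}"
    then have "\<exists>y. 0 \<le> y \<and> y \<le> 1/2 \<and> left_branch b y = x"
      by (intro IVT' continuous_on_left_branch assms) auto
    then show "x \<in> left_branch b ` {0..1/2}" by auto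
  qed
qed

lemma
  assumes "0 < b" "0 \<le> x" "x \<le> 1"
  shows left_inv_mem: "left_inv b x \<in> {0..1/2}"
    and left_branch_left_inv: "left_branch b (left_inv b x) = x"
proof -
  have "x \<in> left_branch b ` {0..1/2}"
    using assms left_branch_image by simp
  then show "left_inv b x \<in> {0..1/2}" "left_branch b (left_inv b x) = x"
    unfolding left_inv_def
    by (rule the_inv_into_into[OF inj_on_left_branch[OF assms(1)] _ subset_refl],
        rule f_the_inv_into_f[OF inj_on_left_branch[OF assms(1)]])
qed

lemma left_inv_left_branch:
  "0 < b \<Longrightarrow> 0 \<le> y \<Longrightarrow> y \<le> 1/2 \<Longrightarrow> left_inv b (left_branch b y) = y"
  by (simp add: left_inv_def the_inv_into_f_f inj_on_left_branch)

lemma left_inv_mono: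
  assumes "0 < b" "0 \<le> x" "x \<le> y" "y \<le> 1"
  shows "left_inv b x \<le> left_inv b y"
  using left_branch_left_inv[of b x] left_branch_left_inv[of b y] assms
    left_branch_less_iff[of b "left_inv b y" "left_inv b x"] by linarith

lemma left_inv_bounds:
  assumes "0 < b" "0 < x" "x < 1"
  shows "0 < left_inv b x" "left_inv b x < 1/2"
proof -
  have "left_branch b (left_inv b x) = x" "left_inv b x \<in> {0..1/2}"
    using assms by (auto simp: left_inv_mem left_branch_left_inv simp del: atLeastAtMost_iff)
  moreover from this have "left_inv b x \<noteq> 0" "left_inv b x \<noteq> 1/2"
    using assms left_branch_half[of b] by (metis left_branch_0 order_less_irrefl, metis order_less_irrefl)
  ultimately show "0 < left_inv b x" "left_inv b x < 1/2" by auto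
qed

lemma lsv_left: "0 \<le> x \<Longrightarrow> x < 1/2 \<Longrightarrow> lsv b x = left_branch b x"
  by (simp add: lsv_def left_branch_def)

lemma lsv_deriv_left: "0 \<le> x \<Longrightarrow> x < 1/2 \<Longrightarrow> lsv_deriv b x = left_deriv b x"
  by (simp add: lsv_deriv_def left_deriv_def)

lemma left_deriv_mono: "0 < b \<Longrightarrow> 0 \<le> x \<Longrightarrow> x \<le> y \<Longrightarrow> left_deriv b x \<le> left_deriv b y"
  by (auto simp: left_deriv_def intro!: mult_left_mono powr_mono2)

lemma left_deriv_le_3:
  assumes "0 < b" "b < 1" "0 \<le> x" "x \<le> 1/2"
  shows "left_deriv b x \<le> 3"
proof -
  have "left_deriv b x \<le> left_deriv b (1/2)"
    using assms by (intro left_deriv_mono) auto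
  also have "\<dots> = 2 + b"
    by (simp add: left_deriv_def powr_divide)
  finally show ?thesis using assms by simp
qed

lemma transfer_eq_left_inv:
  assumes "0 < b" "0 \<le> x" "x < 1"
  shows "transfer b \<phi> x = \<phi> (left_inv b x) / left_deriv b (left_inv b x) + \<phi> ((x + 1) / 2) / 2"
proof -
  have *: "left_inv b x \<in> {0..1/2}" "left_branch b (left_inv b x) = x"
    using assms by (auto simp: left_inv_mem left_branch_left_inv simp del: atLeastAtMost_iff)
  then have "left_inv b x \<noteq> 1/2" using assms left_branch_half[of b] by (metis order_less_irrefl)
  with * have lt: "left_inv b x < 1/2" "left_inv b x \<ge> 0" by auto
  have "{y. y \<in> {0..1} \<and> lsv b y = x} = {left_inv b x, (x + 1) / 2}"
  proof (rule set_eqI, rule iffI)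
    fix y assume y: "y \<in> {y. y \<in> {0..1} \<and> lsv b y = x}"
    show "y \<in> {left_inv b x, (x + 1) / 2}"
    proof (cases "y < 1/2")
      case True
      then show ?thesis using y lsv_left[of y b] left_inv_left_branch[of b y] assms by auto
    next
      case False
      then show ?thesis using y by (auto simp: lsv_def)
    qed
  next
    fix y assume "y \<in> {left_inv b x, (x + 1) / 2}"
    then show "y \<in> {y. y \<in> {0..1} \<and> lsv b y = x}"
    proof
      assume "y = left_inv b x"
      then show ?thesis using lt * lsv_left[of y b] by auto
    next
      assume "y \<in> {(x + 1) / 2}"
      then show ?thesis using assms by (auto simp: lsv_def field_simps)
    qed
  qed
  moreover have "left_inv b x \<noteq> (x + 1) / 2" "\<not> (x + 1) / 2 < 1/2"
    using lt assms by auto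
  ultimately show ?thesis
    using lt lsv_deriv_left[of "left_inv b x" b]
    by (simp add: transfer_def lsv_deriv_def[of b "(x + 1) / 2"])
qed

lemma transfer_at_1:
  assumes "0 < b"
  shows "transfer b \<phi> 1 = \<phi> 1 / 2"
proof -
  have "{y. y \<in> {0..1} \<and> lsv b y = 1} = {1}"
  proof (rule set_eqI, rule iffI)
    fix y assume y: "y \<in> {y. y \<in> {0..1} \<and> lsv b y = 1}"
    have "\<not> y < 1/2"
    proof
      assume "y < 1/2"
      then have "left_branch b y < left_branch b (1/2)" "lsv b y = left_branch b y"
        using assms left_branch_strict_mono[of b y "1/2"] y lsv_left[of y b] by simp_all
      then show False using y left_branch_half[of b] by simp
    qed
    then show "y \<in> {1}" using y by (auto simp: lsv_def)
  qed (auto simp: lsv_def)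
  then show ?thesis by (simp add: transfer_def lsv_deriv_def)
qed

section \<open>Transfer operators on the unit interval\<close>

lemma space_leb01 [simp]: "space leb01 = {0..1}"
  by (simp add: space_restrict_space)

lemma AE_leb01_interior: "AE x in leb01. x \<in> {0<..<1}"
proof -
  have "AE x in lborel. x \<noteq> (0::real)" "AE x in lborel. x \<noteq> (1::real)"
    by (rule AE_lborel_singleton)+
  then have "AE x in lborel. x \<in> {0..1::real} \<longrightarrow> x \<in> {0<..<1}"
    by eventually_elim auto
  then show ?thesis
    by (subst AE_restrict_space_iff) auto
qed

lemma prob_space_leb01: "prob_space leb01"
  by (rule prob_spaceI) (simp add: emeasure_restrict_space)

lemma measurable_leb01_selfI:
  assumes "f \<in> borel_measurable leb01" "\<And>x. x \<in> {0..1} \<Longrightarrow> f x \<in> {0..1}"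
  shows "f \<in> leb01 \<rightarrow>\<^sub>M leb01"
  by (rule measurable_restrict_space2) (use assms in \<open>auto simp: measurable_lborel1\<close>)

lemma continuous_leb01_measurable:
  "continuous_on {0..1} f \<Longrightarrow> f \<in> borel_measurable leb01" for f :: "real \<Rightarrow> real"
  by (metis borel_measurable_continuous_on_restrict measurable_cong_sets restrict_space_sets_cong sets_lborel)

lemma left_inv_measurable [measurable]:
  assumes "0 < b"
  shows "left_inv b \<in> leb01 \<rightarrow>\<^sub>M leb01"
proof (rule measurable_leb01_selfI)
  show "left_inv b \<in> borel_measurable leb01"
    unfolding left_inv_def
    by (intro continuous_leb01_measurable)
      (metis assms compact_Icc continuous_on_inv_into continuous_on_left_branch inj_on_left_branch
        left_branch_image)
qed (use left_inv_mem[OF assms] in force)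

lemma lsv_range:
  assumes "0 < b" "x \<in> {0..1}"
  shows "lsv b x \<in> {0..1}"
proof (cases "x < 1/2")
  case True
  then show ?thesis
    using assms left_branch_image[OF assms(1)] by (subst lsv_left) auto
qed (use assms in \<open>auto simp: lsv_def\<close>)

lemma lsv_measurable:
  assumes "0 < b"
  shows "lsv b \<in> leb01 \<rightarrow>\<^sub>M leb01"
proof (rule measurable_leb01_selfI)
  have "lsv b \<in> borel_measurable borel"
    unfolding lsv_def by measurable
  then show "lsv b \<in> borel_measurable leb01"
    by (simp add: measurable_restrict_space1)
qed (use lsv_range[OF assms] in blast)

lemma right_inv_measurable: "(\<lambda>x. (x + 1) / 2) \<in> leb01 \<rightarrow>\<^sub>M leb01"
  by (rule measurable_leb01_selfI) (auto intro!: continuous_leb01_measurable continuous_intros)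

lemma transfer_measurable:
  assumes "0 < b" "\<phi> \<in> borel_measurable leb01"
  shows "transfer b \<phi> \<in> borel_measurable leb01"
proof -
  have "left_deriv b \<in> borel_measurable leb01"
    by (intro continuous_leb01_measurable continuous_on_left_deriv assms)
  then have 1: "(\<lambda>x. \<phi> (left_inv b x) / left_deriv b (left_inv b x) + \<phi> ((x + 1) / 2) / 2)
      \<in> borel_measurable leb01"
    using measurable_compose[OF left_inv_measurable assms(2)]
      measurable_compose[OF left_inv_measurable, of b "left_deriv b"]
      measurable_compose[OF right_inv_measurable assms(2)] assms(1) by measurable
  have "(\<lambda>x. if x = 1 then \<phi> 1 / 2 else
      \<phi> (left_inv b x) / left_deriv b (left_inv b x) + \<phi> ((x + 1) / 2) / 2) \<in> borel_measurable leb01"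
  proof (intro measurable_If 1)
    have "{x \<in> space leb01. x = 1} = {1::real}" by auto
    then show "{x \<in> space leb01. x = 1} \<in> sets leb01"
      by (simp add: sets_restrict_space_iff)
  qed auto
  then show ?thesis
    by (rule measurable_cong[THEN iffD1, rotated])
      (use transfer_at_1 transfer_eq_left_inv assms in auto)
qed

text \<open>
  Substituting each of the two branches shows that \<^const>\<open>transfer\<close> maps the density of a
  measure to the density of its image.
\<close>

lemma nn_integral_transfer:
  assumes b: "0 < b" and \<phi>: "\<phi> \<in> borel_measurable leb01" and nonneg: "\<And>x. x \<in> {0<..<1} \<Longrightarrow> 0 \<le> \<phi> x"
    and G: "G \<in> borel_measurable leb01"
  shows "(\<integral>\<^sup>+x. G x * ennreal (transfer b \<phi> x) \<partial>leb01) = (\<integral>\<^sup>+y. G (lsv b y) * ennreal (\<phi> y) \<partial>leb01)"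
proof -
  define L where "L = (\<lambda>x. G x * ennreal (\<phi> (left_inv b x) / left_deriv b (left_inv b x)) * indicator {0..1} x)"
  define R where "R = (\<lambda>x. G x * ennreal (\<phi> ((x + 1) / 2) / 2) * indicator {0..1} x)"
  have meas_ext: "(\<lambda>x. F x * indicator {0..1} x) \<in> borel_measurable borel"
    if "F \<in> borel_measurable leb01" for F :: "real \<Rightarrow> ennreal"
    using that borel_measurable_restrict_space_iff_ennreal[of "{0..1}" lborel F] by simp
  have ld: "left_deriv b \<in> borel_measurable leb01"
    by (intro continuous_leb01_measurable continuous_on_left_deriv b)
  have mL: "(\<lambda>x. ennreal (\<phi> (left_inv b x) / left_deriv b (left_inv b x))) \<in> borel_measurable leb01"
    using measurable_compose[OF left_inv_measurable \<phi>] measurable_compose[OF left_inv_measurable ld] b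
    by measurable
  have mR: "(\<lambda>x. ennreal (\<phi> ((x + 1) / 2) / 2)) \<in> borel_measurable leb01"
    using measurable_compose[OF right_inv_measurable \<phi>] by measurable
  have L: "L \<in> borel_measurable borel" unfolding L_def
    by (rule meas_ext) (use mL G in measurable)
  have R: "R \<in> borel_measurable borel" unfolding R_def
    by (rule meas_ext) (use mR G in measurable)
  have "(\<integral>\<^sup>+x. G x * ennreal (transfer b \<phi> x) \<partial>leb01) = (\<integral>\<^sup>+x. L x + R x \<partial>leb01)"
  proof (rule nn_integral_cong_AE)
    show "AE x in leb01. G x * ennreal (transfer b \<phi> x) = L x + R x"
      using AE_leb01_interior
    proof eventually_elim
      case (elim x)
      then have "left_inv b x \<in> {0<..<1}" "left_deriv b (left_inv b x) \<ge> 1" "(x + 1) / 2 \<in> {0<..<1}"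
        using left_inv_bounds[of b x] left_deriv_ge_1 b by auto
      then show ?case
        using elim nonneg[of "left_inv b x"] nonneg[of "(x + 1) / 2"] b
        by (simp add: transfer_eq_left_inv L_def R_def ennreal_plus[symmetric] distrib_left[symmetric] del: ennreal_plus)
    qed
  qed
  also have "\<dots> = (\<integral>\<^sup>+x. L x * indicator {0..1} x \<partial>lborel) + (\<integral>\<^sup>+x. R x * indicator {0..1} x \<partial>lborel)"
    using L R by (subst nn_integral_restrict_space) (auto simp: distrib_right nn_integral_add)
  also have "(\<integral>\<^sup>+x. L x * indicator {0..1} x \<partial>lborel)
      = (\<integral>\<^sup>+x. L x * indicator {left_branch b 0..left_branch b (1/2)} x \<partial>lborel)"
    by (simp only: left_branch_0 left_branch_half)
  also have "\<dots> = (\<integral>\<^sup>+y. L (left_branch b y) * left_deriv b y * indicator {0..1/2} y \<partial>lborel)"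
  proof (rule nn_integral_substitution_aux[OF L _ has_derivative_left_branch[OF b] continuous_on_left_deriv[OF b]])
    show "0 \<le> left_deriv b x" for x
      using left_deriv_ge_1[OF b, of x] by linarith
  qed simp_all
  also have "\<dots> = (\<integral>\<^sup>+y. G (lsv b y) * ennreal (\<phi> y) * indicator {0..<1/2} y \<partial>lborel)"
  proof (rule nn_integral_cong_AE)
    have "AE x in lborel. x \<noteq> (0::real)" "AE x in lborel. x \<noteq> (1/2::real)"
      by (rule AE_lborel_singleton)+
    then show "AE y in lborel. L (left_branch b y) * left_deriv b y * indicator {0..1/2} y
        = G (lsv b y) * ennreal (\<phi> y) * indicator {0..<1/2} y"
    proof eventually_elim
      case (elim y)
      show ?case
      proof (cases "y \<in> {0<..<1/2}")
        case True
        then have "left_branch b y \<in> {0..1}" using left_branch_image[OF b] by auto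
        moreover have "ennreal (\<phi> y / left_deriv b y) * left_deriv b y = ennreal (\<phi> y)"
          using left_deriv_ge_1[OF b, of y] nonneg[of y] True
          by (subst ennreal_mult[symmetric]) auto
        ultimately show ?thesis
          using True b by (simp add: L_def left_inv_left_branch lsv_left mult.assoc)
      qed (use elim in \<open>auto simp: indicator_def\<close>)
    qed
  qed
  also have "(\<integral>\<^sup>+x. R x * indicator {0..1} x \<partial>lborel)
      = (\<integral>\<^sup>+y. R (2 * y - 1) * ennreal 2 * indicator {1/2..1} y \<partial>lborel)"
  proof -
    have "((\<lambda>y. 2 * y - 1) has_real_derivative 2) (at x)" for x :: real
      by (auto intro!: derivative_eq_intros)
    from nn_integral_substitution_aux[OF R _ this, of "1/2" 1] show ?thesis by simp
  qed
  also have "\<dots> = (\<integral>\<^sup>+y. G (lsv b y) * ennreal (\<phi> y) * indicator {1/2..1} y \<partial>lborel)"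
  proof (rule nn_integral_cong_AE)
    have "AE x in lborel. x \<noteq> (1::real)"
      by (rule AE_lborel_singleton)
    then show "AE y in lborel. R (2 * y - 1) * ennreal 2 * indicator {1/2..1} y
        = G (lsv b y) * ennreal (\<phi> y) * indicator {1/2..1} y"
    proof eventually_elim
      case (elim y)
      show ?case
      proof (cases "y \<in> {1/2..<1}")
        case True
        moreover have "ennreal (\<phi> y / 2) * ennreal 2 = ennreal (\<phi> y)"
          using nonneg[of y] True by (subst ennreal_mult[symmetric]) auto
        ultimately show ?thesis
          using True by (simp add: R_def lsv_def mult.assoc)
      qed (use elim in \<open>auto simp: indicator_def\<close>)
    qed
  qed
  also have "(\<integral>\<^sup>+y. G (lsv b y) * ennreal (\<phi> y) * indicator {0..<1/2} y \<partial>lborel)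
      + (\<integral>\<^sup>+y. G (lsv b y) * ennreal (\<phi> y) * indicator {1/2..1} y \<partial>lborel)
      = (\<integral>\<^sup>+y. G (lsv b y) * ennreal (\<phi> y) * indicator {0..1} y \<partial>lborel)"
  proof -
    define K where "K = (\<lambda>y. G (lsv b y) * ennreal (\<phi> y) * indicator {0..1} y)"
    have "K \<in> borel_measurable borel" unfolding K_def
      by (rule meas_ext) (use measurable_compose[OF lsv_measurable[OF b] G] \<phi> in measurable)
    then have "(\<integral>\<^sup>+y. K y * indicator {0..<1/2} y \<partial>lborel) + (\<integral>\<^sup>+y. K y * indicator {1/2..1} y \<partial>lborel)
        = (\<integral>\<^sup>+y. K y * indicator {0..<1/2} y + K y * indicator {1/2..1} y \<partial>lborel)"
      by (subst nn_integral_add) auto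
    also have "\<dots> = (\<integral>\<^sup>+y. K y \<partial>lborel)"
      by (intro nn_integral_cong) (auto simp: K_def indicator_def)
    also have "(\<integral>\<^sup>+y. K y * indicator {0..<1/2} y \<partial>lborel)
        = (\<integral>\<^sup>+y. G (lsv b y) * ennreal (\<phi> y) * indicator {0..<1/2} y \<partial>lborel)"
      by (intro nn_integral_cong) (auto simp: K_def indicator_def)
    also have "(\<integral>\<^sup>+y. K y * indicator {1/2..1} y \<partial>lborel)
        = (\<integral>\<^sup>+y. G (lsv b y) * ennreal (\<phi> y) * indicator {1/2..1} y \<partial>lborel)"
      by (intro nn_integral_cong) (auto simp: K_def indicator_def)
    finally show ?thesis
      by (simp only: K_def)
  qed
  also have "\<dots> = (\<integral>\<^sup>+y. G (lsv b y) * ennreal (\<phi> y) \<partial>leb01)"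
    by (subst nn_integral_restrict_space) auto
  finally show ?thesis .
qed


lemma transfer_add: "transfer b (\<lambda>x. f x + g x) = (\<lambda>x. transfer b f x + transfer b g x)"
  by (simp add: transfer_def add_divide_distrib sum.distrib fun_eq_iff)

lemma transfer_diff: "transfer b (\<lambda>x. f x - g x) = (\<lambda>x. transfer b f x - transfer b g x)"
  by (simp add: transfer_def diff_divide_distrib sum_subtractf fun_eq_iff)

lemma transfer_cmult: "transfer b (\<lambda>x. c * f x) = (\<lambda>x. c * transfer b f x)"
  by (simp add: transfer_def sum_distrib_left fun_eq_iff)

lemma transfer_mono:
  assumes "0 < b" "\<And>y. y \<in> {0<..<1} \<Longrightarrow> f y \<le> g y" "x \<in> {0<..<1}"
  shows "transfer b f x \<le> transfer b g x"
proof -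
  have "left_inv b x \<in> {0<..<1}" "1 \<le> left_deriv b (left_inv b x)" "(x + 1) / 2 \<in> {0<..<1}"
    using left_inv_bounds[of b x] left_deriv_ge_1 assms by auto
  then show ?thesis
    using assms by (auto simp: transfer_eq_left_inv intro!: add_mono divide_right_mono)
qed

lemma transfer_nonneg:
  assumes "0 < b" "\<And>y. y \<in> {0<..<1} \<Longrightarrow> 0 \<le> f y" "x \<in> {0<..<1}"
  shows "0 \<le> transfer b f x"
  using transfer_mono[of b "\<lambda>_. 0" f x] assms by (simp add: transfer_def)

lemma lsv_deriv_pos: "0 < b \<Longrightarrow> 0 \<le> y \<Longrightarrow> 0 < lsv_deriv b y"
  by (auto simp: lsv_deriv_def intro!: add_pos_nonneg)

lemma transfer_abs_le:
  assumes "0 < b"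
  shows "\<bar>transfer b f x\<bar> \<le> transfer b (\<lambda>y. \<bar>f y\<bar>) x"
proof -
  have "\<bar>f y / lsv_deriv b y\<bar> = \<bar>f y\<bar> / lsv_deriv b y" if "y \<in> {0..1}" for y
    using lsv_deriv_pos[of b y] assms that by simp
  then show ?thesis
    unfolding transfer_def by (intro order_trans[OF sum_abs] sum_mono) force
qed

lemma nn_integral_transfer_abs_le:
  assumes "0 < b" "f \<in> borel_measurable leb01"
  shows "(\<integral>\<^sup>+x. ennreal \<bar>transfer b f x\<bar> \<partial>leb01) \<le> (\<integral>\<^sup>+x. ennreal \<bar>f x\<bar> \<partial>leb01)"
proof -
  have "(\<integral>\<^sup>+x. ennreal \<bar>transfer b f x\<bar> \<partial>leb01) \<le> (\<integral>\<^sup>+x. 1 * ennreal (transfer b (\<lambda>y. \<bar>f y\<bar>) x) \<partial>leb01)"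
    using transfer_abs_le assms by (intro nn_integral_mono) (auto intro!: ennreal_leI)
  also have "\<dots> = (\<integral>\<^sup>+x. 1 * ennreal \<bar>f x\<bar> \<partial>leb01)"
    using assms by (intro nn_integral_transfer) auto
  finally show ?thesis by simp
qed

lemma transfer_AE_cong:
  assumes "0 < b" "f \<in> borel_measurable leb01" "g \<in> borel_measurable leb01"
    and "AE x in leb01. f x = g x"
  shows "AE x in leb01. transfer b f x = transfer b g x"
proof -
  have m: "(\<lambda>x. f x - g x) \<in> borel_measurable leb01" using assms by measurable
  have "(\<integral>\<^sup>+x. ennreal \<bar>transfer b (\<lambda>x. f x - g x) x\<bar> \<partial>leb01) \<le> (\<integral>\<^sup>+x. ennreal \<bar>f x - g x\<bar> \<partial>leb01)"
    by (rule nn_integral_transfer_abs_le) (use assms m in auto)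
  also have "\<dots> = (\<integral>\<^sup>+x. 0 \<partial>leb01)"
    by (rule nn_integral_cong_AE) (use assms(4) in eventually_elim, simp)
  finally have "(\<integral>\<^sup>+x. ennreal \<bar>transfer b (\<lambda>x. f x - g x) x\<bar> \<partial>leb01) = 0" by simp
  moreover have "(\<lambda>x. ennreal \<bar>transfer b (\<lambda>x. f x - g x) x\<bar>) \<in> borel_measurable leb01"
    using transfer_measurable[OF assms(1) m] by measurable
  ultimately have "AE x in leb01. ennreal \<bar>transfer b (\<lambda>x. f x - g x) x\<bar> = 0"
    by (simp add: nn_integral_0_iff_AE)
  then show ?thesis
    by eventually_elim (simp add: transfer_diff)
qed

lemma integrable_transfer:
  assumes "0 < b" "integrable leb01 f"
  shows "integrable leb01 (transfer b f)"
proof (rule integrableI_bounded)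
  show "transfer b f \<in> borel_measurable leb01"
    using assms by (intro transfer_measurable) auto
  have "(\<integral>\<^sup>+x. ennreal \<bar>transfer b f x\<bar> \<partial>leb01) \<le> (\<integral>\<^sup>+x. ennreal \<bar>f x\<bar> \<partial>leb01)"
    using assms by (intro nn_integral_transfer_abs_le) auto
  also have "\<dots> < \<infinity>" using assms(2) by (simp add: integrable_iff_bounded)
  finally show "(\<integral>\<^sup>+x. ennreal (norm (transfer b f x)) \<partial>leb01) < \<infinity>" by simp
qed

lemma integral_transfer_indicator:
  assumes b: "0 < b" and f: "integrable leb01 f" and nn: "\<And>x. x \<in> {0<..<1} \<Longrightarrow> 0 \<le> f x"
    and S: "S \<in> sets borel"
  shows "(\<integral>x. transfer b f x * indicator S x \<partial>leb01) = (\<integral>y. f y * indicator S (lsv b y) \<partial>leb01)"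
proof -
  have S': "(indicator S :: real \<Rightarrow> real) \<in> borel_measurable leb01"
    using S by (intro measurable_restrict_space1) auto
  have S'': "(indicator S :: real \<Rightarrow> ennreal) \<in> borel_measurable leb01"
    using S by (intro measurable_restrict_space1) auto
  have fm: "f \<in> borel_measurable leb01" using f by auto
  note tm = transfer_measurable[OF b fm]
  note cm = measurable_compose[OF lsv_measurable[OF b] S']
  have "(\<integral>x. transfer b f x * indicator S x \<partial>leb01)
      = enn2real (\<integral>\<^sup>+x. ennreal (transfer b f x * indicator S x) \<partial>leb01)"
  proof (rule integral_eq_nn_integral)
    show "AE x in leb01. 0 \<le> transfer b f x * indicator S x"
      using AE_leb01_interior by eventually_elim (use transfer_nonneg[OF b nn] in auto)
  qed (use tm S' in measurable)
  also have "(\<integral>\<^sup>+x. ennreal (transfer b f x * indicator S x) \<partial>leb01)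
      = (\<integral>\<^sup>+x. indicator S x * ennreal (transfer b f x) \<partial>leb01)"
    by (intro nn_integral_cong) (auto simp: indicator_def)
  also have "\<dots> = (\<integral>\<^sup>+y. indicator S (lsv b y) * ennreal (f y) \<partial>leb01)"
    by (rule nn_integral_transfer) (use b fm nn S'' in auto)
  also have "\<dots> = (\<integral>\<^sup>+y. ennreal (f y * indicator S (lsv b y)) \<partial>leb01)"
    by (intro nn_integral_cong) (auto simp: indicator_def)
  also have "enn2real \<dots> = (\<integral>y. f y * indicator S (lsv b y) \<partial>leb01)"
  proof (rule integral_eq_nn_integral[symmetric])
    show "AE x in leb01. 0 \<le> f x * indicator S (lsv b x)"
      using AE_leb01_interior by eventually_elim (use nn in auto)
  qed (use fm cm in measurable)
  finally show ?thesis .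
qed

lemma integral_transfer:
  assumes b: "0 < b" and f: "integrable leb01 f"
  shows "(\<integral>x. transfer b f x \<partial>leb01) = (\<integral>y. f y \<partial>leb01)"
proof -
  have *: "(\<integral>x. transfer b g x \<partial>leb01) = (\<integral>y. g y \<partial>leb01)"
    if "integrable leb01 g" "\<And>x. 0 \<le> g x" for g
    using integral_transfer_indicator[OF b that(1), of UNIV] that(2) by simp
  define p where "p = (\<lambda>x. max 0 (f x))"
  define n where "n = (\<lambda>x. max 0 (- f x))"
  have int: "integrable leb01 p" "integrable leb01 n"
    unfolding p_def n_def using f by auto
  have f_eq: "f = (\<lambda>x. p x - n x)" by (auto simp: p_def n_def fun_eq_iff)
  have "(\<integral>x. transfer b f x \<partial>leb01) = (\<integral>x. transfer b p x - transfer b n x \<partial>leb01)"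
    by (subst f_eq) (simp add: transfer_diff)
  also have "\<dots> = (\<integral>x. p x - n x \<partial>leb01)"
    using int *[OF int(1)] *[OF int(2)] integrable_transfer[OF b]
    by (simp add: p_def n_def)
  finally show ?thesis by (simp add: f_eq[symmetric])
qed


section \<open>Decreasing densities\<close>

text \<open>
  The conditions refer to the open interval, which the inverse branches map into itself; at the
  endpoints the number of preimages is exceptional.  The mass is left free because constants are
  going to be subtracted.
\<close>

definition decreasing :: "(real \<Rightarrow> real) set" where
  "decreasing = {F. integrable leb01 F \<and> (\<forall>x\<in>{0<..<1}. 0 \<le> F x) \<and>
     (\<forall>x y. 0 < x \<longrightarrow> x \<le> y \<longrightarrow> y < 1 \<longrightarrow> F y \<le> F x)}"

abbreviation mass :: "(real \<Rightarrow> real) \<Rightarrow> real" where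
  "mass F \<equiv> \<integral>x. F x \<partial>leb01"

abbreviation mass_on :: "(real \<Rightarrow> real) \<Rightarrow> real set \<Rightarrow> real" where
  "mass_on F S \<equiv> \<integral>x. F x * indicator S x \<partial>leb01"

lemma decreasingI:
  assumes "integrable leb01 F" "\<And>x. 0 < x \<Longrightarrow> x < 1 \<Longrightarrow> 0 \<le> F x"
    "\<And>x y. 0 < x \<Longrightarrow> x \<le> y \<Longrightarrow> y < 1 \<Longrightarrow> F y \<le> F x"
  shows "F \<in> decreasing"
  using assms by (auto simp: decreasing_def)

lemma decreasingD:
  assumes "F \<in> decreasing"
  shows "integrable leb01 F" "F \<in> borel_measurable leb01" "\<And>x. 0 < x \<Longrightarrow> x < 1 \<Longrightarrow> 0 \<le> F x"
    "\<And>x y. 0 < x \<Longrightarrow> x \<le> y \<Longrightarrow> y < 1 \<Longrightarrow> F y \<le> F x"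
  using assms by (auto simp: decreasing_def)

lemma integrable_indicator_mult:
  fixes F :: "real \<Rightarrow> real"
  assumes "integrable leb01 F" "S \<in> sets borel"
  shows "integrable leb01 (\<lambda>x. F x * indicator S x)"
proof (rule Bochner_Integration.integrable_bound)
  show "integrable leb01 F" by fact
  have "(indicator S :: real \<Rightarrow> real) \<in> borel_measurable leb01"
    using assms(2) by (intro measurable_restrict_space1) auto
  then show "(\<lambda>x. F x * indicator S x) \<in> borel_measurable leb01"
    using borel_measurable_integrable[OF assms(1)] by measurable
qed (auto simp: indicator_def)

lemma integral_mono_interior:
  assumes "integrable leb01 F" "integrable leb01 G" "\<And>x. 0 < x \<Longrightarrow> x < 1 \<Longrightarrow> F x \<le> G x"
  shows "mass F \<le> mass G"
  by (rule integral_mono_AE[OF assms(1,2)]) (use AE_leb01_interior in eventually_elim, use assms(3) in auto)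

lemma integral_cong_interior:
  assumes "F \<in> borel_measurable leb01" "G \<in> borel_measurable leb01" "\<And>x. 0 < x \<Longrightarrow> x < 1 \<Longrightarrow> F x = G x"
  shows "mass F = mass G"
  by (rule integral_cong_AE[OF assms(1,2)]) (use AE_leb01_interior in eventually_elim, use assms(3) in auto)

lemma mass_const [simp]: "mass (\<lambda>_. c) = c"
  using prob_space.prob_space[OF prob_space_leb01] by simp

lemma integrable_leb01_const: "integrable leb01 (\<lambda>_. c::real)"
  by (rule finite_measure.integrable_const[OF prob_space.finite_measure[OF prob_space_leb01]])

lemma const_decreasing: "0 \<le> c \<Longrightarrow> (\<lambda>_. c) \<in> decreasing"
  by (intro decreasingI integrable_leb01_const) auto

lemma add_decreasing:
  "F \<in> decreasing \<Longrightarrow> G \<in> decreasing \<Longrightarrow> (\<lambda>x. F x + G x) \<in> decreasing"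
  by (rule decreasingI) (auto dest: decreasingD intro: add_mono add_nonneg_nonneg)

lemma diff_const_decreasing:
  assumes "F \<in> decreasing" "\<And>x. 0 < x \<Longrightarrow> x < 1 \<Longrightarrow> c \<le> F x"
  shows "(\<lambda>x. F x - c) \<in> decreasing"
  using assms decreasingD[OF assms(1)]
  by (intro decreasingI Bochner_Integration.integrable_diff integrable_leb01_const) auto

lemma mult_decreasing:
  assumes "F \<in> decreasing" "u \<in> borel_measurable leb01"
    "\<And>x. x \<in> {0..1} \<Longrightarrow> 0 \<le> u x" "\<And>x. x \<in> {0..1} \<Longrightarrow> u x \<le> B"
    "\<And>x y. 0 < x \<Longrightarrow> x \<le> y \<Longrightarrow> y < 1 \<Longrightarrow> u y \<le> u x"
  shows "(\<lambda>x. u x * F x) \<in> decreasing"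
proof (rule decreasingI)
  note F = decreasingD[OF assms(1)]
  show "integrable leb01 (\<lambda>x. u x * F x)"
  proof (rule Bochner_Integration.integrable_bound)
    show "integrable leb01 (\<lambda>x. B * F x)" using F(1) by simp
    show "AE x in leb01. norm (u x * F x) \<le> norm (B * F x)"
    proof (rule AE_I2)
      fix x assume "x \<in> space leb01"
      then have "\<bar>u x\<bar> \<le> \<bar>B\<bar>" using assms(3)[of x] assms(4)[of x] by simp
      then show "norm (u x * F x) \<le> norm (B * F x)"
        by (simp add: abs_mult mult_right_mono)
    qed
  qed (use assms(2) F(2) in measurable)
qed (use assms decreasingD[OF assms(1)] in \<open>auto intro!: mult_mono mult_nonneg_nonneg\<close>)

lemma mult_indicator_left_half_decreasing:
  assumes "F \<in> decreasing"
  shows "(\<lambda>x. F x * indicator {0<..<1/2} x) \<in> decreasing"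
  using decreasingD[OF assms]
  by (intro decreasingI integrable_indicator_mult) (auto simp: indicator_def)

text \<open>
  Both inverse branches are increasing, and so is the derivative along the left branch, while it is
  constant along the right one.  Hence each branch contributes a decreasing function.
\<close>

lemma transfer_decreasing:
  assumes "0 < b" "F \<in> decreasing"
  shows "transfer b F \<in> decreasing"
proof (rule decreasingI)
  note F = decreasingD[OF assms(2)]
  show "integrable leb01 (transfer b F)" by (rule integrable_transfer[OF assms(1) F(1)])
  show "0 \<le> transfer b F x" if "0 < x" "x < 1" for x
    using transfer_nonneg[OF assms(1), of F x] F(3) that by auto
  fix x y :: real assume xy: "0 < x" "x \<le> y" "y < 1"
  have le: "left_inv b x \<le> left_inv b y" using left_inv_mono xy assms by auto
  have b: "0 < left_inv b x" "left_inv b y < 1/2"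
    using left_inv_bounds(1)[of b x] left_inv_bounds(2)[of b y] assms xy by auto
  have "F (left_inv b y) / left_deriv b (left_inv b y) \<le> F (left_inv b x) / left_deriv b (left_inv b x)"
  proof (rule frac_le)
    show "0 < left_deriv b (left_inv b x)" using left_deriv_ge_1[OF assms(1)] by (rule less_le_trans[rotated]) simp
    show "left_deriv b (left_inv b x) \<le> left_deriv b (left_inv b y)"
      using left_deriv_mono le b assms by auto
  qed (use F(3) F(4) le b in auto)
  moreover have "F ((y + 1) / 2) / 2 \<le> F ((x + 1) / 2) / 2"
    using F(4) xy by simp
  ultimately show "transfer b F y \<le> transfer b F x"
    using xy assms by (simp add: transfer_eq_left_inv)
qed

text \<open>
  The preimage of \<open>x\<close> in the left half alone contributes a third of \<^term>\<open>F (1/2)\<close>, uniformly in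
  \<open>x\<close>, since the derivative is at most \<open>3\<close>.  So mass in the right half, which is at most
  \<^term>\<open>F (1/2) / 2\<close>, turns into a constant lower bound in one step.
\<close>

lemma transfer_lower_bound:
  assumes "0 < b" "b < 1" "F \<in> decreasing" "0 < x" "x < 1"
  shows "F (1/2) / 3 \<le> transfer b F x"
proof -
  note F = decreasingD[OF assms(3)]
  have b: "0 < left_inv b x" "left_inv b x < 1/2"
    using left_inv_bounds assms by auto
  have d: "1 \<le> left_deriv b (left_inv b x)" "left_deriv b (left_inv b x) \<le> 3"
    using left_deriv_ge_1 left_deriv_le_3 assms b by auto
  have "F (1/2) / 3 \<le> F (left_inv b x) / left_deriv b (left_inv b x)"
    by (rule frac_le) (use d F b in auto)
  moreover have "0 \<le> F ((x + 1) / 2) / 2" using F(3) assms by simp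
  ultimately show ?thesis
    using assms by (simp add: transfer_eq_left_inv)
qed

lemma half_value_le_mass:
  assumes "F \<in> decreasing"
  shows "F (1/2) / 2 \<le> mass F"
proof -
  note F = decreasingD[OF assms]
  have "(\<integral>x. F (1/2) * indicator {0<..<1/2} x \<partial>leb01) \<le> mass F"
  proof (rule integral_mono_interior)
    show "integrable leb01 (\<lambda>x. F (1/2) * indicator {0<..<1/2} x)"
      by (intro integrable_indicator_mult integrable_leb01_const) simp
  qed (use F in \<open>auto simp: indicator_def\<close>)
  moreover have "(\<integral>x. F (1/2) * indicator {0<..<1/2::real} x \<partial>leb01) = F (1/2) / 2"
  proof -
    have "measure leb01 ({0<..<1/2} \<inter> {0..1}) = 1/2"
    proof -
      have "{0<..<1/2::real} \<inter> {0..1} = {0<..<1/2}" by auto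
      then show ?thesis by (subst measure_restrict_space) auto
    qed
    then show ?thesis by simp
  qed
  ultimately show ?thesis by linarith
qed


section \<open>Products of transfer operators\<close>

abbreviation transfers :: "real list \<Rightarrow> (real \<Rightarrow> real) \<Rightarrow> real \<Rightarrow> real" where
  "transfers bs F \<equiv> fold transfer bs F"

lemma transfers_add: "transfers bs (\<lambda>x. f x + g x) = (\<lambda>x. transfers bs f x + transfers bs g x)"
  by (induction bs arbitrary: f g) (simp_all add: transfer_add)

lemma transfers_diff: "transfers bs (\<lambda>x. f x - g x) = (\<lambda>x. transfers bs f x - transfers bs g x)"
  by (induction bs arbitrary: f g) (simp_all add: transfer_diff)

lemma transfers_cmult: "transfers bs (\<lambda>x. c * f x) = (\<lambda>x. c * transfers bs f x)"
  by (induction bs arbitrary: f) (simp_all add: transfer_cmult)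

lemma transfers_mono:
  assumes "set bs \<subseteq> {0<..}" "\<And>y. y \<in> {0<..<1} \<Longrightarrow> f y \<le> g y" "x \<in> {0<..<1}"
  shows "transfers bs f x \<le> transfers bs g x"
  using assms
proof (induction bs arbitrary: f g)
  case (Cons b bs)
  have "transfers bs (transfer b f) x \<le> transfers bs (transfer b g) x"
    by (rule Cons.IH) (use Cons.prems in \<open>auto intro!: transfer_mono\<close>)
  then show ?case by simp
qed simp

lemma transfers_cong:
  assumes "set bs \<subseteq> {0<..}" "\<And>y. y \<in> {0<..<1} \<Longrightarrow> f y = g y" "x \<in> {0<..<1}"
  shows "transfers bs f x = transfers bs g x"
  by (intro antisym transfers_mono) (use assms in auto)

lemma transfers_decreasing:
  "set bs \<subseteq> {0<..} \<Longrightarrow> F \<in> decreasing \<Longrightarrow> transfers bs F \<in> decreasing"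
  by (induction bs arbitrary: F) (auto simp: transfer_decreasing)

lemma transfers_measurable:
  "set bs \<subseteq> {0<..} \<Longrightarrow> f \<in> borel_measurable leb01 \<Longrightarrow> transfers bs f \<in> borel_measurable leb01"
  by (induction bs arbitrary: f) (auto simp: transfer_measurable)

lemma integrable_transfers:
  "set bs \<subseteq> {0<..} \<Longrightarrow> integrable leb01 f \<Longrightarrow> integrable leb01 (transfers bs f)"
  by (induction bs arbitrary: f) (auto simp: integrable_transfer)

lemma mass_transfers:
  "set bs \<subseteq> {0<..} \<Longrightarrow> integrable leb01 f \<Longrightarrow> mass (transfers bs f) = mass f"
  by (induction bs arbitrary: f) (auto simp: integrable_transfer integral_transfer)

lemma nn_integral_transfers_abs_le:
  assumes "set bs \<subseteq> {0<..}" "f \<in> borel_measurable leb01"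
  shows "(\<integral>\<^sup>+x. ennreal \<bar>transfers bs f x\<bar> \<partial>leb01) \<le> (\<integral>\<^sup>+x. ennreal \<bar>f x\<bar> \<partial>leb01)"
  using assms
proof (induction bs arbitrary: f)
  case (Cons b bs)
  have "(\<integral>\<^sup>+x. ennreal \<bar>transfers bs (transfer b f) x\<bar> \<partial>leb01) \<le> (\<integral>\<^sup>+x. ennreal \<bar>transfer b f x\<bar> \<partial>leb01)"
    by (rule Cons.IH) (use Cons.prems in \<open>auto intro!: transfer_measurable\<close>)
  also have "\<dots> \<le> (\<integral>\<^sup>+x. ennreal \<bar>f x\<bar> \<partial>leb01)"
    by (rule nn_integral_transfer_abs_le) (use Cons.prems in auto)
  finally show ?case by simp
qed simp

lemma transfers_AE_cong:
  assumes "set bs \<subseteq> {0<..}" "f \<in> borel_measurable leb01" "g \<in> borel_measurable leb01"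
    and "AE x in leb01. f x = g x"
  shows "AE x in leb01. transfers bs f x = transfers bs g x"
  using assms
proof (induction bs arbitrary: f g)
  case (Cons b bs)
  have b: "0 < b" "set bs \<subseteq> {0<..}" using Cons.prems by auto
  have "AE x in leb01. transfers bs (transfer b f) x = transfers bs (transfer b g) x"
    by (rule Cons.IH[OF b(2) transfer_measurable[OF b(1) Cons.prems(2)]
        transfer_measurable[OF b(1) Cons.prems(3)] transfer_AE_cong[OF b(1) Cons.prems(2-4)]])
  then show ?case by simp
qed simp

lemma transfers_lower_bound:
  assumes "set bs \<subseteq> {0<..<1}" "F \<in> decreasing" "\<And>x. 0 < x \<Longrightarrow> x < 1 \<Longrightarrow> c \<le> F x"
    "0 < x" "x < 1"
  shows "c / 3 ^ length bs \<le> transfers bs F x"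
  using assms
proof (induction bs arbitrary: F c)
  case (Cons b bs)
  have "(c / 3) / 3 ^ length bs \<le> transfers bs (transfer b F) x"
  proof (rule Cons.IH)
    fix x :: real assume "0 < x" "x < 1"
    then have "F (1/2) / 3 \<le> transfer b F x"
      using Cons.prems by (intro transfer_lower_bound) auto
    moreover have "c \<le> F (1/2)" using Cons.prems by auto
    ultimately show "c / 3 \<le> transfer b F x" by simp
  qed (use Cons.prems transfer_decreasing in auto)
  then show ?case by simp
qed simp


section \<open>Points that have not yet left the neutral fixed point\<close>

primrec stay :: "real list \<Rightarrow> real set" where
  "stay [] = {0<..<1}"
| "stay (b # bs) = {x \<in> {0<..<1/2}. lsv b x \<in> stay bs}"

abbreviation num_good :: "real \<Rightarrow> real list \<Rightarrow> nat" where
  "num_good \<gamma> bs \<equiv> length (filter (\<lambda>b. b \<le> \<gamma>) bs)"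

lemma stay_sets [measurable]: "stay bs \<in> sets borel"
proof (induction bs)
  case (Cons b bs)
  have "lsv b \<in> borel_measurable borel"
    unfolding lsv_def by measurable
  then have "lsv b -` stay bs \<inter> space borel \<in> sets borel"
    using Cons by (rule measurable_sets)
  then have "{0<..<1/2} \<inter> (lsv b -` stay bs) \<in> sets borel"
    by auto
  moreover have "stay (b # bs) = {0<..<1/2} \<inter> (lsv b -` stay bs)" by auto
  ultimately show ?case by simp
qed simp

lemma stay_subset: "stay bs \<subseteq> {0<..<1}"
  by (cases bs) auto

lemma stay_leb01: "stay bs \<in> sets leb01" "stay bs \<inter> {0..1} = stay bs"
  using stay_subset[of bs] stay_sets[of bs]
  by (auto simp: sets_restrict_space_iff)

lemma measure_stay_le_1: "measure leb01 (stay bs) \<le> 1"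
  by (rule prob_space.prob_le_1[OF prob_space_leb01])

lemma mass_on_const_stay: "mass_on (\<lambda>_. c) (stay bs) = c * measure leb01 (stay bs)"
  by (simp add: stay_leb01)

lemma mass_on_interior: "integrable leb01 F \<Longrightarrow> mass_on F {0<..<1} = mass F"
  by (rule integral_cong_interior) (auto intro: integrable_indicator_mult[THEN borel_measurable_integrable])

text \<open>
  Mass that is about to stay near \<open>0\<close> either was already there and stays one step longer, or has
  just been injected from the right half, where the density is at most \<^term>\<open>F (1/2)\<close>.
\<close>

lemma mass_on_stay_transfer_le:
  assumes b: "0 < b" and F: "F \<in> decreasing"
  shows "mass_on (transfer b F) (stay bs)
    \<le> mass_on F (stay (b # bs)) + F (1/2) / 2 * measure leb01 (stay bs)"
proof -
  define F0 where "F0 = (\<lambda>x. F x * indicator {0<..<1/2} x)"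
  note dF = decreasingD[OF F]
  have F0: "F0 \<in> decreasing"
    unfolding F0_def by (rule mult_indicator_left_half_decreasing[OF F])
  note dF0 = decreasingD[OF F0]
  have int: "integrable leb01 (\<lambda>x. transfer b G x * indicator (stay bs) x)" if "integrable leb01 G" for G
    using b that by (intro integrable_indicator_mult integrable_transfer) auto
  have intc: "integrable leb01 (\<lambda>x. F (1/2) / 2 * indicator (stay bs) x)"
    by (intro integrable_indicator_mult integrable_leb01_const stay_sets)
  have "mass_on (transfer b F) (stay bs)
      \<le> mass (\<lambda>x. transfer b F0 x * indicator (stay bs) x + F (1/2) / 2 * indicator (stay bs) x)"
  proof (rule integral_mono_interior)
    fix x :: real assume x: "0 < x" "x < 1"
    then have l: "0 < left_inv b x" "left_inv b x < 1/2" using b left_inv_bounds by auto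
    have "F ((x + 1) / 2) \<le> F (1/2)" using dF(4) x by simp
    then have "transfer b F x \<le> transfer b F0 x + F (1/2) / 2"
      using x l b by (simp add: transfer_eq_left_inv F0_def)
    then show "transfer b F x * indicator (stay bs) x
        \<le> transfer b F0 x * indicator (stay bs) x + F (1/2) / 2 * indicator (stay bs) x"
      by (simp add: indicator_def)
  qed (use int dF(1) dF0(1) intc in auto)
  also have "\<dots> = mass_on (transfer b F0) (stay bs) + F (1/2) / 2 * measure leb01 (stay bs)"
    using int[OF dF0(1)] intc mass_on_const_stay[of "F (1/2) / 2" bs]
    by (subst Bochner_Integration.integral_add) auto
  also have "mass_on (transfer b F0) (stay bs) = (\<integral>y. F0 y * indicator (stay bs) (lsv b y) \<partial>leb01)"
    by (rule integral_transfer_indicator[OF b dF0(1)]) (use dF0(3) in auto)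
  also have "\<dots> = mass_on F (stay (b # bs))"
    by (intro Bochner_Integration.integral_cong) (auto simp: F0_def indicator_def)
  finally show ?thesis by simp
qed

lemma mass_on_stay_transfers_le:
  assumes "set as \<subseteq> {0<..}" "F \<in> decreasing"
  shows "mass_on (transfers as F) (stay bs)
    \<le> mass_on F (stay (as @ bs)) + mass F * (\<Sum>k<length as. measure leb01 (stay (drop (Suc k) as @ bs)))"
  using assms
proof (induction as arbitrary: F)
  case (Cons a as)
  then have a: "0 < a" "set as \<subseteq> {0<..}" by auto
  note tF = transfer_decreasing[OF a(1) Cons.prems(2)]
  note F = decreasingD[OF Cons.prems(2)]
  have "mass_on (transfers as (transfer a F)) (stay bs)
     \<le> mass_on (transfer a F) (stay (as @ bs))
       + mass F * (\<Sum>k<length as. measure leb01 (stay (drop (Suc k) as @ bs)))"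
    using Cons.IH[OF a(2) tF] integral_transfer[OF a(1) F(1)] by simp
  moreover have "mass_on (transfer a F) (stay (as @ bs))
      \<le> mass_on F (stay (a # as @ bs)) + F (1/2) / 2 * measure leb01 (stay (as @ bs))"
    by (rule mass_on_stay_transfer_le[OF a(1) Cons.prems(2)])
  moreover have "F (1/2) / 2 * measure leb01 (stay (as @ bs)) \<le> mass F * measure leb01 (stay (as @ bs))"
    by (intro mult_right_mono half_value_le_mass Cons.prems) auto
  ultimately show ?case
    by (simp add: sum.lessThan_Suc_shift distrib_left del: sum.lessThan_Suc)
qed simp

lemma powr_minus_one_plus_le:
  assumes "0 < \<gamma>" "\<gamma> \<le> 1" "0 \<le> u" "u \<le> (1::real)"
  shows "(1 + u) powr (- \<gamma>) \<le> 1 - \<gamma> / 4 * u"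
proof -
  define t where "t = \<gamma> * u / 2"
  have "\<gamma> * u \<le> 1 * 1" using assms by (intro mult_mono) auto
  then have t: "0 \<le> t" "t \<le> 1" using assms by (auto simp: t_def)
  have "u / 2 \<le> u / (1 + u)"
    using assms by (intro divide_left_mono) auto
  also have "\<dots> = 1 - 1 / (1 + u)" using assms by (simp add: field_simps)
  also have "\<dots> \<le> ln (1 + u)"
    using ln_le_minus_one[of "1 / (1 + u)"] assms by (simp add: ln_div)
  finally have "t \<le> \<gamma> * ln (1 + u)"
    using assms mult_left_mono[of "u / 2" "ln (1 + u)" \<gamma>] by (simp add: t_def)
  then have "(1 + u) powr (- \<gamma>) \<le> exp (- t)"
    using assms by (simp add: powr_def)
  also have "\<dots> \<le> 1 / (1 + t)"
    using exp_ge_add_one_self[of t] t by (simp add: exp_minus field_simps)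
  also have "\<dots> \<le> 1 - t / 2"
  proof -
    have "t * t \<le> 1 * t" using t by (intro mult_right_mono) auto
    then show ?thesis using t by (simp add: field_simps)
  qed
  finally show ?thesis by (simp add: t_def)
qed

text \<open>
  Along an orbit near \<open>0\<close> the quantity \<open>x\<^sup>-\<^sup>\<gamma>\<close> never increases, and each step with a parameter at
  most \<open>\<gamma>\<close> decreases it by a fixed amount, whatever the other parameters do.
\<close>

lemma stay_powr_lower_bound:
  assumes "set bs \<subseteq> {0<..}" "0 < \<gamma>" "\<gamma> \<le> 1" "x \<in> stay bs"
  shows "\<gamma> / 4 * num_good \<gamma> bs \<le> x powr (- \<gamma>)"
  using assms(1,4)
proof (induction bs arbitrary: x)
  case (Cons b bs)
  then have x: "0 < x" "x < 1/2" "lsv b x \<in> stay bs" by auto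
  define u where "u = (2 * x) powr b"
  have u: "0 \<le> u" by (simp add: u_def)
  have lsv: "lsv b x = x * (1 + u)"
    using x by (simp add: lsv_def u_def powr_mult)
  have IH: "\<gamma> / 4 * num_good \<gamma> bs \<le> (x * (1 + u)) powr (- \<gamma>)"
    using Cons.IH[OF _ x(3)] Cons.prems lsv by simp
  show ?case
  proof (cases "b \<le> \<gamma>")
    case False
    have "(x * (1 + u)) powr (- \<gamma>) \<le> x powr (- \<gamma>)"
      using x u assms by (intro powr_mono2') auto
    then show ?thesis using False IH by simp
  next
    case True
    define v where "v = (2 * x) powr \<gamma>"
    have v: "0 \<le> v" "v \<le> 1" "v \<le> u"
      using x assms True by (auto simp: v_def u_def powr_le1 intro!: powr_mono')
    have "(x * (1 + u)) powr (- \<gamma>) \<le> (x * (1 + v)) powr (- \<gamma>)"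
      using x u v assms by (intro powr_mono2') auto
    also have "\<dots> = x powr (- \<gamma>) * (1 + v) powr (- \<gamma>)"
      using x v by (simp add: powr_mult)
    also have "\<dots> \<le> x powr (- \<gamma>) * (1 - \<gamma> / 4 * v)"
      using assms v by (intro mult_left_mono powr_minus_one_plus_le) auto
    also have "\<dots> = x powr (- \<gamma>) - \<gamma> / 4 * 2 powr \<gamma>"
      using x by (simp add: v_def powr_mult powr_minus field_simps)
    also have "\<dots> \<le> x powr (- \<gamma>) - \<gamma> / 4 * 1"
      using assms by (intro diff_mono mult_left_mono) (auto intro: ge_one_powr_ge_zero)
    finally have "(x * (1 + u)) powr (- \<gamma>) \<le> x powr (- \<gamma>) - \<gamma> / 4" by simp
    then show ?thesis using True IH by (simp add: algebra_simps add_divide_distrib)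
  qed
qed simp

lemma measure_stay_le:
  fixes \<eta> l :: real
  assumes "set bs \<subseteq> {0<..}" "0 < \<gamma>" "\<gamma> \<le> 1" "0 < \<eta>" "0 < l" "\<eta> * l \<le> num_good \<gamma> bs"
  shows "measure leb01 (stay bs) \<le> (\<gamma> * \<eta> / 4) powr (- 1/\<gamma>) * l powr (- 1/\<gamma>)"
proof -
  define z where "z = (\<gamma> * \<eta> / 4 * l) powr (- 1/\<gamma>)"
  have "stay bs \<subseteq> {0..z}"
  proof
    fix x assume x: "x \<in> stay bs"
    then have x0: "0 < x" using stay_subset[of bs] by auto
    have "\<gamma> * \<eta> / 4 * l \<le> \<gamma> / 4 * num_good \<gamma> bs"
    proof -
      have "\<gamma> / 4 * (\<eta> * l) \<le> \<gamma> / 4 * num_good \<gamma> bs"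
        by (rule mult_left_mono) (use assms in auto)
      then show ?thesis by (simp only: times_divide_eq_left mult.assoc)
    qed
    also have "\<dots> \<le> x powr (- \<gamma>)"
      by (rule stay_powr_lower_bound) (use assms x in auto)
    finally have "(x powr (- \<gamma>)) powr (- 1/\<gamma>) \<le> z"
      unfolding z_def using assms by (intro powr_mono2') auto
    then show "x \<in> {0..z}" using x0 assms by (simp add: powr_powr)
  qed
  then have "measure lborel (stay bs) \<le> measure lborel {0..z}"
    by (intro measure_mono_fmeasurable) (auto simp: fmeasurable_def emeasure_lborel_Icc_eq)
  also have "\<dots> = z" by (simp add: z_def measure_def)
  also have "\<dots> = (\<gamma> * \<eta> / 4) powr (- 1/\<gamma>) * l powr (- 1/\<gamma>)"
    unfolding z_def by (rule powr_mult)
  finally show ?thesis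
    using stay_leb01 stay_subset[of bs] by (subst measure_restrict_space) auto
qed

lemma powr_Suc_le_diff:
  assumes "1 < p" "1 \<le> l"
  shows "real (Suc l) powr (- p) \<le> (real l powr (1 - p) - real (Suc l) powr (1 - p)) / (p - 1)"
proof -
  have "\<exists>z>real l. z < real (Suc l) \<and>
      real (Suc l) powr (1 - p) - real l powr (1 - p)
        = (real (Suc l) - real l) * ((1 - p) * z powr (- p))"
  proof (rule MVT2)
    show "real l < real (Suc l)" by simp
    fix z assume "real l \<le> z" "z \<le> real (Suc l)"
    then have "0 < z" using assms by simp
    then show "((\<lambda>z. z powr (1 - p)) has_real_derivative (1 - p) * z powr (- p)) (at z)"
      using has_real_derivative_powr[of z "1 - p"] by (simp add: algebra_simps)
  qed
  then obtain z where z: "real l < z" "z < real (Suc l)"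
    "real (Suc l) powr (1 - p) - real l powr (1 - p)
      = (real (Suc l) - real l) * ((1 - p) * z powr (- p))"
    by blast
  have "real (Suc l) powr (- p) \<le> z powr (- p)"
    using z assms by (intro powr_mono2') auto
  also have "\<dots> = (real l powr (1 - p) - real (Suc l) powr (1 - p)) / (p - 1)"
  proof -
    define w where "w = z powr (- p)"
    have "real (Suc l) - real l = 1" by simp
    with z(3) have "real (Suc l) powr (1 - p) - real l powr (1 - p) = (1 - p) * w"
      by (simp only: w_def mult_1_left)
    then have "w * (p - 1) = real l powr (1 - p) - real (Suc l) powr (1 - p)"
      by (simp only: left_diff_distrib mult_1_left right_diff_distrib mult_1_right mult.commute)
    then show ?thesis
      using assms(1) by (simp only: w_def[symmetric] eq_divide_eq) simp
  qed
  finally show ?thesis .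
qed

lemma sum_powr_tail_le:
  assumes "1 < p" "1 \<le> k" "k \<le> n"
  shows "(\<Sum>l=k..n. real l powr (- p)) \<le> p / (p - 1) * real k powr (1 - p)"
proof -
  have "(\<Sum>l=k..n. real l powr (- p))
      \<le> real k powr (- p) + (real k powr (1 - p) - real n powr (1 - p)) / (p - 1)"
    using assms(3)
  proof (induction n rule: dec_induct)
    case (step n)
    then show ?case
      using powr_Suc_le_diff[of p n] assms by (simp add: diff_divide_distrib)
  qed simp
  also have "\<dots> \<le> real k powr (1 - p) + real k powr (1 - p) / (p - 1)"
    using assms by (intro add_mono divide_right_mono powr_mono) auto
  also have "\<dots> = p / (p - 1) * real k powr (1 - p)"
    using assms by (simp add: field_simps)
  finally show ?thesis .
qed

text \<open>
  The first factor comes from \<open>measure_stay_le\<close>, the second one from \<open>sum_powr_tail_le\<close> with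
  \<open>p = 1/\<gamma>\<close>.
\<close>

definition tail_const :: "real \<Rightarrow> real \<Rightarrow> real" where
  "tail_const \<gamma> \<eta> = (\<gamma> * \<eta> / 4) powr (- 1/\<gamma>) * (1 / \<gamma> / (1 / \<gamma> - 1))"

lemma tail_const_nonneg: "0 < \<gamma> \<Longrightarrow> \<gamma> < 1 \<Longrightarrow> 0 \<le> tail_const \<gamma> \<eta>"
  by (auto simp: tail_const_def)

text \<open>
  Let \<open>\<tau>\<close> be the length of \<open>bs\<close>.  Mass that stays during \<open>bs\<close> was injected \<open>l - \<tau>\<close> steps earlier
  for some \<open>l \<ge> \<tau>\<close>, into the set of points that stay for the last \<open>l\<close> parameters; by the
  assumption on these its size is \<open>O(l powr (- 1/\<gamma>))\<close>.  Summing over the injection time loses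
  one power of \<open>\<tau>\<close>.
\<close>

lemma mass_on_stay_le_tail_const:
  fixes \<eta> :: real
  assumes "set as \<subseteq> {0<..}" "set bs \<subseteq> {0<..}" "0 < \<gamma>" "\<gamma> < 1" "0 < \<eta>" "bs \<noteq> []"
    and good: "\<And>l. length bs \<le> l \<Longrightarrow> l \<le> length (as @ bs) \<Longrightarrow>
      \<eta> * l \<le> num_good \<gamma> (drop (length (as @ bs) - l) (as @ bs))"
  shows "mass_on (transfers as (\<lambda>_. 1)) (stay bs)
    \<le> tail_const \<gamma> \<eta> * real (length bs) powr (1 - 1/\<gamma>)"
proof -
  define n where "n = length (as @ bs)"
  have "mass_on (transfers as (\<lambda>_. 1)) (stay bs) \<le> mass_on (\<lambda>_. 1) (stay (as @ bs))
      + mass (\<lambda>_. 1) * (\<Sum>k<length as. measure leb01 (stay (drop (Suc k) as @ bs)))"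
    by (rule mass_on_stay_transfers_le) (use assms const_decreasing in auto)
  also have "\<dots> = measure leb01 (stay (drop 0 (as @ bs)))
      + (\<Sum>k<length as. measure leb01 (stay (drop (Suc k) (as @ bs))))"
    unfolding mass_const mass_on_const_stay by simp
  also have "\<dots> = (\<Sum>k\<le>length as. measure leb01 (stay (drop k (as @ bs))))"
    by (subst sum.atMost_shift) simp
  also have "\<dots> = (\<Sum>l=length bs..n. measure leb01 (stay (drop (n - l) (as @ bs))))"
    by (rule sum.reindex_bij_witness[of _ "\<lambda>l. n - l" "\<lambda>k. n - k"]) (auto simp: n_def)
  also have "\<dots> \<le> (\<Sum>l=length bs..n. (\<gamma> * \<eta> / 4) powr (- 1/\<gamma>) * real l powr (- (1/\<gamma>)))"
  proof (rule sum_mono)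
    fix l assume l: "l \<in> {length bs..n}"
    then have "0 < l" using assms by (cases l) auto
    moreover have "set (drop (n - l) (as @ bs)) \<subseteq> {0<..}"
      using assms(1,2) set_drop_subset[of "n - l" "as @ bs"] by auto
    ultimately show "measure leb01 (stay (drop (n - l) (as @ bs)))
        \<le> (\<gamma> * \<eta> / 4) powr (- 1/\<gamma>) * real l powr (- (1/\<gamma>))"
      using measure_stay_le[of "drop (n - l) (as @ bs)" \<gamma> \<eta> l] good[of l] assms l by (auto simp: n_def)
  qed
  also have "\<dots> = (\<gamma> * \<eta> / 4) powr (- 1/\<gamma>) * (\<Sum>l=length bs..n. real l powr (- (1/\<gamma>)))"
    by (simp add: sum_distrib_left)
  also have "\<dots> \<le> (\<gamma> * \<eta> / 4) powr (- 1/\<gamma>) * (1/\<gamma> / (1/\<gamma> - 1) * real (length bs) powr (1 - 1/\<gamma>))"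
    using assms by (intro mult_left_mono sum_powr_tail_le) (auto simp: n_def Suc_le_eq)
  finally show ?thesis by (simp add: tail_const_def mult.assoc)
qed


section \<open>Uniform lower bounds\<close>

text \<open>
  Of the mass that leaves the left half during \<open>b # bs\<close>, the part already in the right half is at
  most \<^term>\<open>F (1/2) / 2\<close>; the rest still has to leave after one step.
\<close>

lemma escaping_mass_transfer_ge:
  assumes "0 < b" "F \<in> decreasing"
  shows "mass F - mass_on F (stay (b # bs)) - F (1/2) / 2
    \<le> mass (transfer b F) - mass_on (transfer b F) (stay bs)"
proof -
  have "F (1/2) / 2 * measure leb01 (stay bs) \<le> F (1/2) / 2 * 1"
    using decreasingD(3)[OF assms(2)] by (intro mult_left_mono measure_stay_le_1) auto
  then show ?thesis
    using mass_on_stay_transfer_le[OF assms, of bs] integral_transfer[OF assms(1)]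
      decreasingD(1)[OF assms(2)] by simp
qed

text \<open>
  Either \<^term>\<open>F (1/2)\<close> is comparable with the escaping mass, and one step makes it a lower bound
  everywhere, or most of the mass escapes later.  A factor \<open>3\<close> is lost in each step, so this
  serves for a bounded number of steps only.
\<close>

lemma transfers_lower_bound_exponential:
  assumes "set bs \<subseteq> {0<..<1}" "F \<in> decreasing" "0 < x" "x < 1"
  shows "(mass F - mass_on F (stay bs)) / 3 ^ length bs \<le> transfers bs F x"
  using assms
proof (induction bs arbitrary: F)
  case Nil
  then show ?case
    using mass_on_interior decreasingD[OF Nil(2)] by simp
next
  case (Cons b bs)
  then have b: "0 < b" "b < 1" "set bs \<subseteq> {0<..<1}" by auto
  define G where "G = transfer b F"
  define E where "E = mass F - mass_on F (stay (b # bs))"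
  define u where "u = F (1/2)"
  have u: "0 \<le> u" using decreasingD(3)[OF Cons.prems(2)] by (simp add: u_def)
  have G: "G \<in> decreasing"
    unfolding G_def by (rule transfer_decreasing[OF b(1) Cons.prems(2)])
  have 1: "(E - u / 2) / 3 ^ length bs \<le> transfers bs G x"
  proof -
    have "E - u / 2 \<le> mass G - mass_on G (stay bs)"
      using escaping_mass_transfer_ge[OF b(1) Cons.prems(2), of bs] by (simp only: G_def E_def u_def)
    then have "(E - u / 2) / 3 ^ length bs \<le> (mass G - mass_on G (stay bs)) / 3 ^ length bs"
      by (intro divide_right_mono) auto
    also have "\<dots> \<le> transfers bs G x"
      by (rule Cons.IH) (use b G Cons.prems in auto)
    finally show ?thesis .
  qed
  have 2: "u / 3 / 3 ^ length bs \<le> transfers bs G x"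
    by (rule transfers_lower_bound[OF b(3) G])
       (use transfer_lower_bound[OF b(1,2) Cons.prems(2)] Cons.prems in \<open>auto simp: G_def u_def\<close>)
  have "E / 3 \<le> max (E - u / 2) (u / 3)"
    using u by (simp add: max_def)
  then have "E / 3 / 3 ^ length bs \<le> max (E - u / 2) (u / 3) / 3 ^ length bs"
    by (intro divide_right_mono) auto
  also have "\<dots> \<le> transfers bs G x"
    using 1 2 by (auto simp: max_def)
  finally have "E / (3 * 3 ^ length bs) \<le> transfers bs G x" by simp
  then show ?case by (simp add: G_def E_def)
qed

lemma num_good_all: "set bs \<subseteq> {0<..\<alpha>} \<Longrightarrow> num_good \<alpha> bs = length bs"
  by (subst filter_True) auto

text \<open>
  All parameters are at most \<open>\<alpha> < 1\<close>, so for a suitable fixed number of steps half of the mass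
  of any \<open>transfers as 1\<close> escapes within these steps; the bound of the previous lemma with
  this fixed exponent then applies.
\<close>

lemma transfers_one_lower_bound:
  assumes "0 < \<alpha>" "\<alpha> < 1"
  obtains c where "0 < c" "c \<le> 1"
    "\<And>as x. set as \<subseteq> {0<..\<alpha>} \<Longrightarrow> 0 < x \<Longrightarrow> x < 1 \<Longrightarrow> c \<le> transfers as (\<lambda>_. 1) x"
proof -
  have "((\<lambda>n. tail_const \<alpha> 1 * real n powr (1 - 1/\<alpha>)) \<longlongrightarrow> tail_const \<alpha> 1 * 0) sequentially"
    using assms by (intro tendsto_mult tendsto_const tendsto_neg_powr filterlim_real_sequentially) auto
  then have "\<forall>\<^sub>F n in sequentially. tail_const \<alpha> 1 * real n powr (1 - 1/\<alpha>) < 1/2"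
    by (rule order_tendstoD) simp
  then obtain K where K: "\<And>n. n \<ge> K \<Longrightarrow> tail_const \<alpha> 1 * real n powr (1 - 1/\<alpha>) < 1/2"
    by (auto simp: eventually_sequentially)
  define L where "L = max K 1"
  have L: "L \<ge> 1" "tail_const \<alpha> 1 * real L powr (1 - 1/\<alpha>) < 1/2"
    using K[of L] by (auto simp: L_def)
  have "1/2 / 3 ^ L \<le> transfers as (\<lambda>_. 1) x" if as: "set as \<subseteq> {0<..\<alpha>}" and x: "0 < x" "x < 1" for as x
  proof (cases "length as < L")
    case True
    have "1/2 / 3 ^ L \<le> 1 / (3::real) ^ length as"
      using True by (intro frac_le power_increasing) auto
    also have "\<dots> \<le> transfers as (\<lambda>_. 1) x"
      by (rule transfers_lower_bound) (use as x assms const_decreasing in auto)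
    finally show ?thesis .
  next
    case False
    define as1 where "as1 = take (length as - L) as"
    define as2 where "as2 = drop (length as - L) as"
    have sp: "as = as1 @ as2" "length as2 = L" using False by (auto simp: as1_def as2_def)
    then have s: "set as1 \<subseteq> {0<..\<alpha>}" "set as2 \<subseteq> {0<..\<alpha>}" using as by auto
    define G where "G = transfers as1 (\<lambda>_. 1)"
    have d: "G \<in> decreasing"
      unfolding G_def by (intro transfers_decreasing const_decreasing) (use s in auto)
    have "mass_on G (stay as2) \<le> tail_const \<alpha> 1 * real (length as2) powr (1 - 1/\<alpha>)"
      unfolding G_def
    proof (rule mass_on_stay_le_tail_const)
      fix l assume "length as2 \<le> l" "l \<le> length (as1 @ as2)"
      moreover have "set (drop (length (as1 @ as2) - l) (as1 @ as2)) \<subseteq> {0<..\<alpha>}"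
        using s set_drop_subset[of "length (as1 @ as2) - l" "as1 @ as2"] by auto
      then have "num_good \<alpha> (drop (length (as1 @ as2) - l) (as1 @ as2))
          = length (drop (length (as1 @ as2) - l) (as1 @ as2))"
        by (rule num_good_all)
      ultimately show "1 * real l \<le> num_good \<alpha> (drop (length (as1 @ as2) - l) (as1 @ as2))"
        by (simp del: drop_append filter_append)
    qed (use s assms L sp in auto)
    moreover have "mass G = 1"
    proof -
      have "mass G = mass (\<lambda>_. 1)" unfolding G_def
        using s by (intro mass_transfers integrable_leb01_const) auto
      then show ?thesis unfolding mass_const .
    qed
    ultimately have "1/2 \<le> mass G - mass_on G (stay as2)"
      using L(2) sp(2) by simp
    then have "1/2 / 3 ^ L \<le> (mass G - mass_on G (stay as2)) / 3 ^ length as2"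
      unfolding sp(2) by (intro divide_right_mono) auto
    also have "\<dots> \<le> transfers as2 G x"
      by (rule transfers_lower_bound_exponential) (use s assms d x in auto)
    finally show ?thesis by (simp add: sp(1) G_def)
  qed
  note lower = this
  have "1/2 / (3::real) ^ L \<le> 1/2 / 1"
    by (intro divide_left_mono) auto
  then have "1/2 / (3::real) ^ L \<le> 1" by linarith
  from that[OF _ this lower] show thesis by simp
qed

text \<open>
  In each step the constant \<open>u / 3\<close> with \<open>u = F (1/2)\<close> is split off.  Its later images stay
  above \<open>c * u / 3\<close>, and what is left is again a decreasing density, whose escaping mass is smaller by
  at most \<open>u / 2 + u / 3\<close>.  The factor \<open>2/5\<close> balances this loss against the gain \<open>c * u / 3\<close>.
\<close>

lemma transfers_lower_bound_escaping_mass: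
  assumes c: "0 < c" "\<And>as x. set as \<subseteq> {0<..\<alpha>} \<Longrightarrow> 0 < x \<Longrightarrow> x < 1 \<Longrightarrow> c \<le> transfers as (\<lambda>_. 1) x"
    and "\<alpha> < 1" "set bs \<subseteq> {0<..\<alpha>}" "F \<in> decreasing" "0 < x" "x < 1"
  shows "2/5 * c * (mass F - mass_on F (stay bs)) \<le> transfers bs F x"
  using assms(4-)
proof (induction bs arbitrary: F)
  case Nil
  then show ?case
    using mass_on_interior decreasingD[OF Nil(2)] by simp
next
  case (Cons b bs)
  then have b: "0 < b" "b < 1" "set bs \<subseteq> {0<..\<alpha>}" using \<open>\<alpha> < 1\<close> by auto
  define u where "u = F (1/2)"
  define G where "G = transfer b F"
  define G' where "G' = (\<lambda>x. G x - u / 3)"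
  have u: "0 \<le> u" using decreasingD(3)[OF Cons.prems(2)] by (simp add: u_def)
  have G: "G \<in> decreasing"
    unfolding G_def by (rule transfer_decreasing[OF b(1) Cons.prems(2)])
  have G': "G' \<in> decreasing"
    unfolding G'_def by (rule diff_const_decreasing[OF G])
      (use transfer_lower_bound[OF b(1,2) Cons.prems(2)] in \<open>auto simp: G_def u_def\<close>)
  have "mass G' = mass G - u / 3"
  proof -
    have "mass G' = mass G - mass (\<lambda>_. u / 3)" unfolding G'_def
      by (rule Bochner_Integration.integral_diff) (use integrable_leb01_const decreasingD(1)[OF G] in auto)
    then show ?thesis unfolding mass_const .
  qed
  moreover have "mass_on G' (stay bs) \<le> mass_on G (stay bs)"
  proof (rule integral_mono_interior)
    show "G' x * indicator (stay bs) x \<le> G x * indicator (stay bs) x" for x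
      using u by (auto simp: G'_def indicator_def)
  qed (intro integrable_indicator_mult stay_sets decreasingD(1) G G')+
  moreover have "mass F - mass_on F (stay (b # bs)) - u / 2 \<le> mass G - mass_on G (stay bs)"
    unfolding G_def u_def by (rule escaping_mass_transfer_ge[OF b(1) Cons.prems(2)])
  ultimately have "mass F - mass_on F (stay (b # bs)) - 5/6 * u \<le> mass G' - mass_on G' (stay bs)"
    by linarith
  then have "2/5 * c * (mass F - mass_on F (stay (b # bs)) - 5/6 * u)
      \<le> 2/5 * c * (mass G' - mass_on G' (stay bs))"
    using c(1) by (intro mult_left_mono) auto
  also have "\<dots> \<le> transfers bs G' x"
    by (rule Cons.IH) (use b G' Cons.prems in auto)
  finally have 1: "2/5 * c * (mass F - mass_on F (stay (b # bs)) - 5/6 * u) \<le> transfers bs G' x" .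
  have "u / 3 * c \<le> u / 3 * transfers bs (\<lambda>_. 1) x"
    using u c(2)[OF b(3)] Cons.prems by (intro mult_left_mono) auto
  moreover have "transfers (b # bs) F x = transfers bs G' x + u / 3 * transfers bs (\<lambda>_. 1) x"
  proof -
    have "transfers (b # bs) F x = transfers bs (\<lambda>x. G' x + u / 3 * 1) x"
      by (simp add: G'_def G_def)
    then show ?thesis by (simp only: transfers_add transfers_cmult)
  qed
  moreover have "2/5 * c * (mass F - mass_on F (stay (b # bs)) - 5/6 * u)
      = 2/5 * c * (mass F - mass_on F (stay (b # bs))) - u / 3 * c"
    by (simp only: right_diff_distrib) simp
  ultimately show ?case using 1 by linarith
qed


section \<open>Loss of memory along a fixed sequence of parameters\<close>

text \<open>
  Two densities of the same mass, dominated by a multiple of the image of Lebesgue measure under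
  the past \<open>as\<close>.  The domination survives all later operators, and through it the tail estimate for the
  image of Lebesgue measure applies to both densities.
\<close>

definition coupled :: "real list \<Rightarrow> real \<Rightarrow> real \<Rightarrow> (real \<Rightarrow> real) \<Rightarrow> (real \<Rightarrow> real) \<Rightarrow> bool" where
  "coupled as \<Gamma> A F1 F2 \<longleftrightarrow> (\<forall>F\<in>{F1, F2}. F \<in> decreasing \<and> mass F = A \<and>
     (\<forall>x\<in>{0<..<1}. F x \<le> \<Gamma> * transfers as (\<lambda>_. 1) x))"

lemma coupled_transfers_minus_const:
  assumes "coupled as \<Gamma> A F1 F2" "set as \<subseteq> {0<..}" "set bs \<subseteq> {0<..}" "0 \<le> k"
    and k: "\<And>F x. F \<in> {F1, F2} \<Longrightarrow> 0 < x \<Longrightarrow> x < 1 \<Longrightarrow> k \<le> transfers bs F x"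
  shows "coupled (as @ bs) \<Gamma> (A - k) (\<lambda>x. transfers bs F1 x - k) (\<lambda>x. transfers bs F2 x - k)"
proof -
  have "(\<lambda>x. transfers bs F x - k) \<in> decreasing \<and> mass (\<lambda>x. transfers bs F x - k) = A - k \<and>
     (\<forall>x\<in>{0<..<1}. transfers bs F x - k \<le> \<Gamma> * transfers (as @ bs) (\<lambda>_. 1) x)"
    if F: "F \<in> {F1, F2}" for F
  proof (intro conjI ballI)
    have d: "F \<in> decreasing" "mass F = A" "\<And>x. x \<in> {0<..<1} \<Longrightarrow> F x \<le> \<Gamma> * transfers as (\<lambda>_. 1) x"
      using assms(1) F by (auto simp: coupled_def)
    have tF: "transfers bs F \<in> decreasing"
      by (rule transfers_decreasing[OF assms(3) d(1)])
    show "(\<lambda>x. transfers bs F x - k) \<in> decreasing"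
      by (rule diff_const_decreasing[OF tF]) (use k[OF F] in auto)
    have "mass (\<lambda>x. transfers bs F x - k) = mass (transfers bs F) - mass (\<lambda>_. k)"
      by (rule Bochner_Integration.integral_diff)
        (use decreasingD(1)[OF tF] integrable_leb01_const in auto)
    also have "mass (transfers bs F) = A"
      using mass_transfers[OF assms(3)] decreasingD(1)[OF d(1)] d(2) by simp
    finally show "mass (\<lambda>x. transfers bs F x - k) = A - k" unfolding mass_const .
    fix x :: real assume x: "x \<in> {0<..<1}"
    have "transfers bs F x \<le> transfers bs (\<lambda>x. \<Gamma> * transfers as (\<lambda>_. 1) x) x"
      by (rule transfers_mono[OF assms(3) d(3) x])
    then show "transfers bs F x - k \<le> \<Gamma> * transfers (as @ bs) (\<lambda>_. 1) x"
      using assms(4) by (simp add: transfers_cmult)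
  qed
  then show ?thesis by (simp add: coupled_def)
qed

text \<open>
  During one block of maps both densities acquire a common constant, proportional to the mass that
  escapes; it cancels in their difference.
\<close>

lemma coupled_contraction:
  assumes c: "0 < c" "c \<le> 1" "\<And>as x. set as \<subseteq> {0<..\<alpha>} \<Longrightarrow> 0 < x \<Longrightarrow> x < 1 \<Longrightarrow> c \<le> transfers as (\<lambda>_. 1) x"
    and "\<alpha> < 1" "set as \<subseteq> {0<..\<alpha>}" "set bs \<subseteq> {0<..\<alpha>}" "0 \<le> \<Gamma>"
    and F: "coupled as \<Gamma> A F1 F2"
    and tail: "mass_on (transfers as (\<lambda>_. 1)) (stay bs) \<le> \<rho>"
  obtains F1' F2' A' where "coupled (as @ bs) \<Gamma> A' F1' F2'"
    "A' \<le> (1 - 2/5 * c) * A + 2/5 * c * (\<Gamma> * \<rho>)"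
    "\<And>x. transfers bs F1 x - transfers bs F2 x = F1' x - F2' x"
proof -
  define k where "k = max 0 (2/5 * c * (A - \<Gamma> * \<rho>))"
  have pos: "set as \<subseteq> {0<..}" "set bs \<subseteq> {0<..}" using assms by auto
  have "k \<le> transfers bs F x" if F': "F \<in> {F1, F2}" and x: "0 < x" "x < 1" for F x
  proof -
    have d: "F \<in> decreasing" "mass F = A" "\<And>x. x \<in> {0<..<1} \<Longrightarrow> F x \<le> \<Gamma> * transfers as (\<lambda>_. 1) x"
      using F F' by (auto simp: coupled_def)
    have i1: "integrable leb01 (transfers as (\<lambda>_. 1))"
      by (intro integrable_transfers pos integrable_leb01_const)
    have "mass_on F (stay bs) \<le> mass (\<lambda>x. \<Gamma> * (transfers as (\<lambda>_. 1) x * indicator (stay bs) x))"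
    proof (rule integral_mono_interior)
      show "integrable leb01 (\<lambda>x. F x * indicator (stay bs) x)"
        by (intro integrable_indicator_mult decreasingD(1)[OF d(1)]) auto
      show "integrable leb01 (\<lambda>x. \<Gamma> * (transfers as (\<lambda>_. 1) x * indicator (stay bs) x))"
        by (intro integrable_mult_right integrable_indicator_mult i1) auto
    qed (use d in \<open>auto simp: indicator_def\<close>)
    also have "\<dots> = \<Gamma> * mass_on (transfers as (\<lambda>_. 1)) (stay bs)" by simp
    also have "\<dots> \<le> \<Gamma> * \<rho>" by (intro mult_left_mono tail assms)
    finally have "2/5 * c * (A - \<Gamma> * \<rho>) \<le> 2/5 * c * (mass F - mass_on F (stay bs))"
      using c(1) d(2) by (intro mult_left_mono) auto
    also have "\<dots> \<le> transfers bs F x"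
      by (rule transfers_lower_bound_escaping_mass[OF c(1,3)]) (use assms d x in auto)
    finally show ?thesis
      using decreasingD(3)[OF transfers_decreasing[OF pos(2) d(1)]] x by (simp add: k_def)
  qed
  then have "coupled (as @ bs) \<Gamma> (A - k) (\<lambda>x. transfers bs F1 x - k) (\<lambda>x. transfers bs F2 x - k)"
    by (intro coupled_transfers_minus_const[OF F pos]) (auto simp: k_def)
  moreover have "A - k \<le> (1 - 2/5 * c) * A + 2/5 * c * (\<Gamma> * \<rho>)"
  proof -
    have "2/5 * c * (A - \<Gamma> * \<rho>) \<le> k" by (simp add: k_def)
    then show ?thesis by (simp add: left_diff_distrib right_diff_distrib)
  qed
  ultimately show thesis by (rule that) simp
qed

text \<open>
  The assumption that links \<open>\<delta>\<close> to \<open>c\<close> says that contracting a block of relative length \<open>\<delta>\<close>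
  outweighs the variation of the rate \<open>n powr (1 - 1/\<gamma>)\<close> over it.
\<close>

locale contraction_constants =
  fixes c \<alpha> \<gamma> \<delta> :: real
  assumes c: "0 < c" "c \<le> 1" "\<And>as x. set as \<subseteq> {0<..\<alpha>} \<Longrightarrow> 0 < x \<Longrightarrow> x < 1 \<Longrightarrow> c \<le> transfers as (\<lambda>_. 1) x"
    and \<alpha>: "\<alpha> < 1" and \<gamma>: "0 < \<gamma>" "\<gamma> < 1"
    and \<delta>: "0 < \<delta>" "\<delta> < 1" "(1 - 2/5 * c) * (1 - \<delta>) powr (1 - 1/\<gamma>) \<le> 1 - 1/5 * c"

text \<open>
  The last fraction \<open>\<delta>\<close> of the \<open>n\<close> steps forms one block; its tail is \<open>O(n powr (1 - 1/\<gamma>))\<close>.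
  As \<open>\<delta>\<close> is small, the contraction factor of the block beats the growth of
  \<open>n powr (1 - 1/\<gamma>)\<close> from \<open>n\<close> to \<open>(1 - \<delta>) n\<close>.
\<close>

lemma (in contraction_constants) coupled_decay:
  fixes d :: "nat \<Rightarrow> real" and \<eta> n0 :: real
  assumes d: "\<And>k. d k \<in> {0<..\<alpha>}" and \<eta>: "0 < \<eta>"
    and \<Gamma>: "A \<le> \<Gamma>" "0 \<le> \<Gamma>"
    and F: "coupled (map d [0..<M]) \<Gamma> A F1 F2"
    and n0: "1 \<le> \<delta> * n0"
    and good: "\<And>n l. n0 \<le> real n \<Longrightarrow> \<delta> * n / 2 \<le> real l \<Longrightarrow> l \<le> M + n \<Longrightarrow>
      \<eta> * real l \<le> num_good \<gamma> (map d [M + n - l..<M + n])"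
    and B: "n0 powr (1/\<gamma> - 1) \<le> B" "2 * tail_const \<gamma> \<eta> * (2 / \<delta>) powr (1/\<gamma> - 1) \<le> B"
    and n: "1 \<le> n"
  shows "\<exists>F1' F2' A'. coupled (map d [0..<M + n]) \<Gamma> A' F1' F2' \<and> A' \<le> \<Gamma> * B * real n powr (1 - 1/\<gamma>) \<and>
    (\<forall>x\<in>{0<..<1}. transfers (map d [M..<M + n]) F1 x - transfers (map d [M..<M + n]) F2 x = F1' x - F2' x)"
  using n
proof (induction n rule: less_induct)
  case (less n)
  define q where "q = 1/\<gamma> - 1"
  have q: "0 < q" "1 - 1/\<gamma> = - q" using \<gamma> by (auto simp: q_def)
  have sd: "set (map d xs) \<subseteq> {0<..\<alpha>}" "set (map d xs) \<subseteq> {0<..}" for xs using d by auto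
  have spl: "map d [a..<b] @ map d [b..<e] = map d [a..<e]" if "a \<le> b" "b \<le> e" for a b e
    using upt_add_eq_append[of a b "e - b"] that by (simp flip: map_append)
  show ?case
  proof (cases "n0 \<le> real n")
    case False
    let ?F = "\<lambda>F. transfers (map d [M..<M + n]) F"
    have "coupled (map d [0..<M] @ map d [M..<M + n]) \<Gamma> (A - 0) (\<lambda>x. ?F F1 x - 0) (\<lambda>x. ?F F2 x - 0)"
    proof (rule coupled_transfers_minus_const[OF F sd(2) sd(2)])
      fix F and x :: real assume *: "F \<in> {F1, F2}" "0 < x" "x < 1"
      then have "?F F \<in> decreasing"
        by (intro transfers_decreasing[OF sd(2)]) (use F in \<open>auto simp: coupled_def\<close>)
      then show "0 \<le> ?F F x" using * decreasingD(3) by auto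
    qed simp
    then have "coupled (map d [0..<M + n]) \<Gamma> A (?F F1) (?F F2)"
      using spl[of 0 M "M + n"] by simp
    moreover have "A \<le> \<Gamma> * B * real n powr (1 - 1/\<gamma>)"
    proof -
      have "1 = real n powr q * real n powr (- q)"
        using less.prems by (simp add: powr_minus)
      also have "\<dots> \<le> B * real n powr (- q)"
      proof (rule mult_right_mono)
        have "real n powr q \<le> n0 powr q"
          using False q by (intro powr_mono2) auto
        then show "real n powr q \<le> B" using B(1) by (simp add: q_def)
      qed simp
      finally have "\<Gamma> * 1 \<le> \<Gamma> * (B * real n powr (- q))"
        using \<Gamma> by (intro mult_left_mono) auto
      then show ?thesis using \<Gamma> q by (simp add: mult.assoc)
    qed
    ultimately show ?thesis by blast
  next
    case True
    define \<tau> where "\<tau> = nat \<lfloor>\<delta> * n\<rfloor>"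
    have "\<delta> * n0 \<le> \<delta> * n" using True \<delta>(1) by (intro mult_left_mono) auto
    then have "1 \<le> \<delta> * n" using n0 by linarith
    moreover from this have fl: "1 \<le> \<lfloor>\<delta> * n\<rfloor>" by simp
    then have "real \<tau> = real_of_int \<lfloor>\<delta> * n\<rfloor>" by (simp add: \<tau>_def)
    ultimately have \<tau>: "1 \<le> \<tau>" "real \<tau> \<le> \<delta> * n" "\<delta> * n / 2 \<le> \<tau>"
      using fl by linarith+
    have "\<delta> * real n < 1 * real n" using \<delta> less.prems by (intro mult_strict_right_mono) auto
    then have \<tau>n: "\<tau> < n" using \<tau> by linarith
    define t where "t = n - \<tau>"
    have t: "t < n" "1 \<le> t" "(1 - \<delta>) * n \<le> t" "n = t + \<tau>"
      using \<tau> \<tau>n by (auto simp: t_def of_nat_diff algebra_simps)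
    obtain F1' F2' A' where IH: "coupled (map d [0..<M + t]) \<Gamma> A' F1' F2'"
      "A' \<le> \<Gamma> * B * real t powr (1 - 1/\<gamma>)"
      "\<And>x. x \<in> {0<..<1} \<Longrightarrow>
        transfers (map d [M..<M + t]) F1 x - transfers (map d [M..<M + t]) F2 x = F1' x - F2' x"
      using less.IH[OF t(1,2)] by blast
    let ?bs = "map d [M + t..<M + n]"
    have app: "map d [0..<M + t] @ ?bs = map d [0..<M + n]" "map d [M..<M + t] @ ?bs = map d [M..<M + n]"
      using spl[of 0 "M + t" "M + n"] spl[of M "M + t" "M + n"] t by auto
    have len: "length ?bs = \<tau>" using t(4) by simp
    have tail: "mass_on (transfers (map d [0..<M + t]) (\<lambda>_. 1)) (stay ?bs)
        \<le> tail_const \<gamma> \<eta> * real (length ?bs) powr (1 - 1/\<gamma>)"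
    proof (rule mass_on_stay_le_tail_const)
      fix l assume l: "length ?bs \<le> l" "l \<le> length (map d [0..<M + t] @ ?bs)"
      have "\<delta> * n / 2 \<le> real l" using l(1) \<tau>(3) unfolding len by linarith
      then have "\<eta> * real l \<le> num_good \<gamma> (map d [M + n - l..<M + n])"
        using l(2) t by (intro good True) auto
      then show "\<eta> * real l \<le> num_good \<gamma> (drop (length (map d [0..<M + t] @ ?bs) - l) (map d [0..<M + t] @ ?bs))"
        unfolding app by (simp add: drop_map)
    next
      show "?bs \<noteq> []" using \<tau>(1) len by auto
    qed (rule sd(2) \<gamma> \<eta>)+
    obtain G1 G2 A'' where G: "coupled (map d [0..<M + t] @ ?bs) \<Gamma> A'' G1 G2"
      "A'' \<le> (1 - 2/5 * c) * A' + 2/5 * c * (\<Gamma> * (tail_const \<gamma> \<eta> * real (length ?bs) powr (1 - 1/\<gamma>)))"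
      "\<And>x. transfers ?bs F1' x - transfers ?bs F2' x = G1 x - G2 x"
      by (rule coupled_contraction[OF c \<alpha> sd(1) sd(1) \<Gamma>(2) IH(1) tail]) (assumption | rule that)+
    have B0: "0 \<le> B" using B(1) powr_ge_zero order_trans by blast
    have diff: "transfers (map d [M..<M + n]) F1 x - transfers (map d [M..<M + n]) F2 x = G1 x - G2 x"
      if x: "x \<in> {0<..<1}" for x
    proof -
      have "transfers (map d [M..<M + n]) F1 x - transfers (map d [M..<M + n]) F2 x
          = transfers ?bs (\<lambda>x. transfers (map d [M..<M + t]) F1 x - transfers (map d [M..<M + t]) F2 x) x"
        unfolding app(2)[symmetric] fold_append comp_def transfers_diff by simp
      also have "\<dots> = transfers ?bs (\<lambda>x. F1' x - F2' x) x"
        by (rule transfers_cong[OF sd(2) IH(3) x])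
      finally show ?thesis using G(3) by (simp only: transfers_diff)
    qed
    have tt: "real t powr (- q) \<le> (1 - \<delta>) powr (- q) * real n powr (- q)"
    proof -
      have "real t powr (- q) \<le> ((1 - \<delta>) * n) powr (- q)"
        using t(3) \<delta> q less.prems by (intro powr_mono2') auto
      then show ?thesis using \<delta> by (simp add: powr_mult)
    qed
    have t\<tau>: "real \<tau> powr (- q) \<le> (2 / \<delta>) powr q * real n powr (- q)"
    proof -
      have "real \<tau> powr (- q) \<le> (\<delta> / 2 * n) powr (- q)"
        using \<tau>(3) \<delta> q less.prems by (intro powr_mono2') auto
      also have "\<dots> = (\<delta> / 2) powr (- q) * real n powr (- q)" by (rule powr_mult)
      also have "(\<delta> / 2) powr (- q) = inverse ((\<delta> / 2) powr q)" by (rule powr_minus)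
      also have "\<dots> = (2 / \<delta>) powr q" using \<delta> by (simp add: powr_divide)
      finally show ?thesis .
    qed
    define Z where "Z = \<Gamma> * B * real n powr (- q)"
    have Z: "0 \<le> Z" unfolding Z_def using \<Gamma> B0 by (intro mult_nonneg_nonneg) auto
    have "A' \<le> \<Gamma> * B * real t powr (- q)" using IH(2) q by simp
    also have "\<dots> \<le> \<Gamma> * B * ((1 - \<delta>) powr (- q) * real n powr (- q))"
      using \<Gamma> B0 tt by (intro mult_left_mono) auto
    also have "\<dots> = (1 - \<delta>) powr (- q) * Z" by (simp add: Z_def)
    finally have "(1 - 2/5 * c) * A' \<le> (1 - 2/5 * c) * ((1 - \<delta>) powr (- q) * Z)"
      using c by (intro mult_left_mono) auto
    also have "\<dots> = ((1 - 2/5 * c) * (1 - \<delta>) powr (- q)) * Z" by simp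
    also have "\<dots> \<le> (1 - 1/5 * c) * Z"
      using \<delta>(3) q(2) Z by (intro mult_right_mono) auto
    finally have 1: "(1 - 2/5 * c) * A' \<le> (1 - 1/5 * c) * Z" .
    have "2 * (tail_const \<gamma> \<eta> * real \<tau> powr (- q)) \<le> 2 * (tail_const \<gamma> \<eta> * ((2 / \<delta>) powr q * real n powr (- q)))"
      using tail_const_nonneg[OF \<gamma>, of \<eta>] t\<tau> by (intro mult_left_mono) auto
    also have "\<dots> = (2 * tail_const \<gamma> \<eta> * (2 / \<delta>) powr q) * real n powr (- q)" by simp
    also have "\<dots> \<le> B * real n powr (- q)"
      using B(2) by (intro mult_right_mono) (auto simp: q_def)
    finally have "\<Gamma> * (2 * (tail_const \<gamma> \<eta> * real \<tau> powr (- q))) \<le> \<Gamma> * (B * real n powr (- q))"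
      using \<Gamma> by (intro mult_left_mono) auto
    then have "1/5 * c * (\<Gamma> * (2 * (tail_const \<gamma> \<eta> * real \<tau> powr (- q)))) \<le> 1/5 * c * Z"
      using c unfolding Z_def by (intro mult_left_mono) auto
    then have 2: "2/5 * c * (\<Gamma> * (tail_const \<gamma> \<eta> * real \<tau> powr (- q))) \<le> 1/5 * c * Z"
      by simp
    have "(1 - 1/5 * c) * Z + 1/5 * c * Z = Z" by (simp add: left_diff_distrib)
    then have "A'' \<le> Z"
      using G(2) 1 2 unfolding len q(2) by linarith
    then have "A'' \<le> \<Gamma> * B * real n powr (1 - 1/\<gamma>)" by (simp only: Z_def q(2))
    then show ?thesis using G(1) diff unfolding app(1) by blast
  qed
qed


section \<open>Lipschitz observables\<close>

text \<open>
  Subtracting a steep linear function makes a Lipschitz function decreasing, so a product with a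
  decreasing density becomes a difference of two decreasing densities.
\<close>

lemma Lip01_decomposition:
  assumes "Lip01 g"
  obtains u1 u2 where "u1 \<in> borel_measurable leb01" "u2 \<in> borel_measurable leb01"
    "\<And>x. x \<in> {0..1} \<Longrightarrow> g x = u1 x - u2 x"
    "\<And>u x. u \<in> {u1, u2} \<Longrightarrow> x \<in> {0..1} \<Longrightarrow> 0 \<le> u x \<and> u x \<le> 2 * (1 + Lip_norm g)"
    "\<And>u x y. u \<in> {u1, u2} \<Longrightarrow> 0 < x \<Longrightarrow> x \<le> y \<Longrightarrow> y < 1 \<Longrightarrow> u y \<le> u x"
    "\<And>x. x \<in> {0..1} \<Longrightarrow> \<bar>g x\<bar> \<le> 1 + Lip_norm g" "g \<in> borel_measurable leb01" "0 \<le> Lip_norm g"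
proof -
  let ?L = "{K. K-lipschitz_on {0..1} g}"
  have ne: "?L \<noteq> {}" using assms by (auto simp: Lip01_def)
  \<comment> \<open>A Lipschitz constant within \<open>1\<close> of the infimum, which is why \<open>1\<close> is added to the norm.\<close>
  have "Inf ?L < Inf ?L + 1" by simp
  then obtain K where K: "K-lipschitz_on {0..1} g" "K < Inf ?L + 1"
    using cInf_lessD[OF ne] by blast
  have Inf0: "0 \<le> Inf ?L"
    by (rule cInf_greatest[OF ne]) (auto dest: lipschitz_on_nonneg)
  have K0: "0 \<le> K" using K(1) by (rule lipschitz_on_nonneg)
  have cont: "continuous_on {0..1} g" by (rule lipschitz_on_continuous_on[OF K(1)])
  then have gm: "g \<in> borel_measurable leb01" by (rule continuous_leb01_measurable)
  define s where "s = (SUP x\<in>{0..1}. \<bar>g x\<bar>)"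
  have "compact ((\<lambda>x. \<bar>g x\<bar>) ` {0..1})"
    by (intro compact_continuous_image continuous_intros cont) auto
  then have bdd: "bdd_above ((\<lambda>x. \<bar>g x\<bar>) ` {0..1})"
    by (intro bounded_imp_bdd_above compact_imp_bounded)
  have s: "\<bar>g x\<bar> \<le> s" if "x \<in> {0..1}" for x
    unfolding s_def using bdd that by (intro cSUP_upper) auto
  have s0: "0 \<le> s" using s[of 0] by simp
  define B where "B = 1 + Lip_norm g"
  have B: "s + K \<le> B" "s \<le> B" "0 \<le> Lip_norm g"
    using K(2) Inf0 s0 by (auto simp: B_def Lip_norm_def s_def)
  have Kx: "0 \<le> K * x" "K * x \<le> K" if "x \<in> {0..1}" for x
    using K0 that by (auto simp: mult_left_le)
  define u1 where "u1 = (\<lambda>x. B - K * x)"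
  define u2 where "u2 = (\<lambda>x. B - K * x - g x)"
  have um: "u1 \<in> borel_measurable leb01" "u2 \<in> borel_measurable leb01"
    unfolding u1_def u2_def by (intro continuous_leb01_measurable continuous_intros cont)+
  have ub: "0 \<le> u x \<and> u x \<le> 2 * B" if "u \<in> {u1, u2}" "x \<in> {0..1}" for u x
    using that(1) Kx[OF that(2)] s[OF that(2)] B(1,2) s0 K0
    unfolding u1_def u2_def by (elim insertE emptyE; simp; linarith)
  have udec: "u y \<le> u x" if u: "u \<in> {u1, u2}" and xy: "0 < x" "x \<le> y" "y < 1" for u x y
  proof -
    have "dist (g x) (g y) \<le> K * dist x y"
      using xy by (intro lipschitz_onD[OF K(1)]) auto
    then have "\<bar>g x - g y\<bar> \<le> K * (y - x)" using xy by (simp add: dist_real_def)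
    then have "\<bar>g x - g y\<bar> \<le> K * y - K * x" by (simp only: right_diff_distrib)
    moreover have "K * x \<le> K * y" using K0 xy by (intro mult_left_mono) auto
    ultimately show ?thesis using u unfolding u1_def u2_def by (elim insertE emptyE; simp; linarith)
  qed
  have gb: "\<bar>g x\<bar> \<le> B" if "x \<in> {0..1}" for x using s[OF that] B(2) by linarith
  show thesis
    by (rule that[OF um _ _ _ _ gm B(3)])
       (use ub udec gb in \<open>auto simp: u1_def u2_def B_def[symmetric]\<close>)
qed

text \<open>
  For \<open>u\<close> the invariant density at an earlier time, this is the signed density whose image
  is to be estimated.
\<close>

definition centred_product ::
  "(real \<Rightarrow> real) \<Rightarrow> (real \<Rightarrow> real) \<Rightarrow> real list \<Rightarrow> (real \<Rightarrow> real) \<Rightarrow> real \<Rightarrow> real" where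
  "centred_product g1 g2 ms u x =
     g2 x * transfers ms (\<lambda>y. g1 y * u y) x
     - mass (\<lambda>x. g2 x * transfers ms (\<lambda>y. g1 y * u y) x) * transfers ms u x"

lemma integrable_bounded_mult:
  fixes g u :: "real \<Rightarrow> real"
  assumes "g \<in> borel_measurable leb01" "\<And>x. x \<in> {0..1} \<Longrightarrow> \<bar>g x\<bar> \<le> B" "integrable leb01 u"
  shows "integrable leb01 (\<lambda>x. g x * u x)"
proof (rule Bochner_Integration.integrable_bound)
  show "integrable leb01 (\<lambda>x. B * u x)" using assms(3) by simp
  show "(\<lambda>x. g x * u x) \<in> borel_measurable leb01"
    using assms(1) borel_measurable_integrable[OF assms(3)] by measurable
  show "AE x in leb01. norm (g x * u x) \<le> norm (B * u x)"
  proof (rule AE_I2)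
    fix x assume "x \<in> space leb01"
    then have "\<bar>g x\<bar> \<le> \<bar>B\<bar>" using assms(2)[of x] by simp
    then show "norm (g x * u x) \<le> norm (B * u x)" by (simp add: abs_mult mult_right_mono)
  qed
qed

text \<open>
  Both observables are split into decreasing functions, and the centring term goes to one side
  or the other according to its sign.  That the two sides have the same mass is the centring.
\<close>

lemma centred_product_coupled:
  assumes g: "Lip01 g1" "Lip01 g2" and pos: "set as \<subseteq> {0<..}" "set ms \<subseteq> {0<..}"
    and \<Gamma>: "\<Gamma> = 9 * (1 + Lip_norm g1) * (1 + Lip_norm g2)"
  obtains F1 F2 A where "coupled (as @ ms) \<Gamma> A F1 F2" "A \<le> \<Gamma>"
    "\<And>x. x \<in> {0<..<1} \<Longrightarrow> centred_product g1 g2 ms (transfers as (\<lambda>_. 1)) x = F1 x - F2 x"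
proof -
  define B1 where "B1 = 1 + Lip_norm g1"
  define B2 where "B2 = 1 + Lip_norm g2"
  obtain u1 u2 where u: "u1 \<in> borel_measurable leb01" "u2 \<in> borel_measurable leb01"
    "\<And>x. x \<in> {0..1} \<Longrightarrow> g1 x = u1 x - u2 x"
    "\<And>u x. u \<in> {u1, u2} \<Longrightarrow> x \<in> {0..1} \<Longrightarrow> 0 \<le> u x \<and> u x \<le> 2 * B1"
    "\<And>u x y. u \<in> {u1, u2} \<Longrightarrow> 0 < x \<Longrightarrow> x \<le> y \<Longrightarrow> y < 1 \<Longrightarrow> u y \<le> u x"
    "\<And>x. x \<in> {0..1} \<Longrightarrow> \<bar>g1 x\<bar> \<le> B1" "g1 \<in> borel_measurable leb01" "0 \<le> Lip_norm g1"
    unfolding B1_def by (rule Lip01_decomposition[OF g(1)]) blast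
  obtain v1 v2 where v: "v1 \<in> borel_measurable leb01" "v2 \<in> borel_measurable leb01"
    "\<And>x. x \<in> {0..1} \<Longrightarrow> g2 x = v1 x - v2 x"
    "\<And>u x. u \<in> {v1, v2} \<Longrightarrow> x \<in> {0..1} \<Longrightarrow> 0 \<le> u x \<and> u x \<le> 2 * B2"
    "\<And>u x y. u \<in> {v1, v2} \<Longrightarrow> 0 < x \<Longrightarrow> x \<le> y \<Longrightarrow> y < 1 \<Longrightarrow> u y \<le> u x"
    "\<And>x. x \<in> {0..1} \<Longrightarrow> \<bar>g2 x\<bar> \<le> B2" "g2 \<in> borel_measurable leb01" "0 \<le> Lip_norm g2"
    unfolding B2_def by (rule Lip01_decomposition[OF g(2)]) blast
  have B: "1 \<le> B1" "1 \<le> B2" using u(8) v(8) by (auto simp: B1_def B2_def)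
  define H where "H = transfers as (\<lambda>_. 1)"
  have H: "H \<in> decreasing"
    unfolding H_def by (intro transfers_decreasing pos const_decreasing) simp
  note iH = decreasingD(1)[OF H] and H0 = decreasingD(3)[OF H]
  define LH where "LH = transfers ms H"
  have LH: "LH \<in> decreasing"
    unfolding LH_def by (intro transfers_decreasing pos H)
  note iLH = decreasingD(1)[OF LH] and LH0 = decreasingD(3)[OF LH]
  have mLH: "mass LH = 1"
  proof -
    have "mass LH = mass H" unfolding LH_def by (rule mass_transfers[OF pos(2) iH])
    also have "\<dots> = mass (\<lambda>_. 1)" unfolding H_def
      by (intro mass_transfers pos integrable_leb01_const)
    finally show ?thesis unfolding mass_const .
  qed
  define c where "c = mass (\<lambda>x. g2 x * transfers ms (\<lambda>y. g1 y * H y) x)"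
  define G where "G = (\<lambda>u. transfers ms (\<lambda>y. u y * H y))"
  have uH: "(\<lambda>y. u y * H y) \<in> decreasing" if "u \<in> {u1, u2}" for u
    by (rule mult_decreasing[OF H, where B = "2 * B1"]) (use u(1,2,4,5) that in \<open>auto\<close>)
  have G: "G u \<in> decreasing" if "u \<in> {u1, u2}" for u
    unfolding G_def by (intro transfers_decreasing pos uH that)
  have G_le: "G u x \<le> 2 * B1 * LH x" if "u \<in> {u1, u2}" "x \<in> {0<..<1}" for u x
  proof -
    have "G u x \<le> transfers ms (\<lambda>y. 2 * B1 * H y) x" unfolding G_def
      by (rule transfers_mono[OF pos(2) _ that(2)]) (use u(4)[OF that(1)] H0 in \<open>auto intro!: mult_right_mono\<close>)
    then show ?thesis by (simp add: transfers_cmult LH_def)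
  qed
  have VG: "(\<lambda>x. v x * G u x) \<in> decreasing" if "u \<in> {u1, u2}" "v \<in> {v1, v2}" for u v
    by (rule mult_decreasing[OF G[OF that(1)], where B = "2 * B2"]) (use v(1,2,4,5) that in \<open>auto\<close>)
  have VG_le: "v x * G u x \<le> 4 * B1 * B2 * LH x" if "u \<in> {u1, u2}" "v \<in> {v1, v2}" "x \<in> {0<..<1}" for u v x
  proof -
    have "v x * G u x \<le> (2 * B2) * (2 * B1 * LH x)"
      using v(4)[OF that(2), of x] G_le[OF that(1,3)] decreasingD(3)[OF G[OF that(1)], of x] that(3) B
      by (intro mult_mono) auto
    then show ?thesis by (simp add: mult_ac)
  qed
  have cLH: "(\<lambda>x. k * LH x) \<in> decreasing" if "0 \<le> k" for k
    by (rule decreasingI)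
      (use that iLH LH0 decreasingD(4)[OF LH] in \<open>auto intro!: mult_left_mono\<close>)
  have Lg1: "transfers ms (\<lambda>y. g1 y * H y) x = G u1 x - G u2 x" if "x \<in> {0<..<1}" for x
  proof -
    have "transfers ms (\<lambda>y. g1 y * H y) x = transfers ms (\<lambda>y. u1 y * H y - u2 y * H y) x"
      by (rule transfers_cong[OF pos(2) _ that]) (use u(3) in \<open>auto simp: left_diff_distrib\<close>)
    then show ?thesis by (simp add: transfers_diff G_def)
  qed
  have absLg1: "\<bar>transfers ms (\<lambda>y. g1 y * H y) x\<bar> \<le> B1 * LH x" if x: "x \<in> {0<..<1}" for x
  proof -
    have b: "- B1 * H y \<le> g1 y * H y" "g1 y * H y \<le> B1 * H y" if "y \<in> {0<..<1}" for y
      by (rule mult_right_mono; use u(6)[of y] H0[of y] that in auto)+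
    have "transfers ms (\<lambda>y. g1 y * H y) x \<le> transfers ms (\<lambda>y. B1 * H y) x"
      by (rule transfers_mono[OF pos(2) b(2) x])
    moreover have "transfers ms (\<lambda>y. - B1 * H y) x \<le> transfers ms (\<lambda>y. g1 y * H y) x"
      by (rule transfers_mono[OF pos(2) b(1) x])
    moreover have "transfers ms (\<lambda>y. - B1 * H y) x = - B1 * LH x" "transfers ms (\<lambda>y. B1 * H y) x = B1 * LH x"
      unfolding LH_def by (simp_all only: transfers_cmult)
    ultimately show ?thesis by linarith
  qed
  have iP: "integrable leb01 (\<lambda>x. g2 x * transfers ms (\<lambda>y. g1 y * H y) x)"
    by (intro integrable_bounded_mult[OF v(7,6)] integrable_transfers pos integrable_bounded_mult[OF u(7,6)] iH)
  have cb: "\<bar>c\<bar> \<le> B1 * B2"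
  proof -
    have b: "\<bar>g2 x * transfers ms (\<lambda>y. g1 y * H y) x\<bar> \<le> B1 * B2 * LH x" if x: "0 < x" "x < 1" for x
    proof -
      have "\<bar>g2 x\<bar> * \<bar>transfers ms (\<lambda>y. g1 y * H y) x\<bar> \<le> B2 * (B1 * LH x)"
        using v(6)[of x] absLg1[of x] x B by (intro mult_mono) auto
      then show ?thesis by (simp add: abs_mult mult_ac)
    qed
    have "\<bar>c\<bar> \<le> mass (\<lambda>x. \<bar>g2 x * transfers ms (\<lambda>y. g1 y * H y) x\<bar>)"
      unfolding c_def by (rule integral_abs_bound)
    also have "\<dots> \<le> mass (\<lambda>x. B1 * B2 * LH x)"
      by (rule integral_mono_interior) (use iP iLH b in auto)
    also have "\<dots> = B1 * B2" using mLH by simp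
    finally show ?thesis .
  qed
  define F1 where "F1 = (\<lambda>x. (v1 x * G u1 x + v2 x * G u2 x) + max 0 (- c) * LH x)"
  define F2 where "F2 = (\<lambda>x. (v1 x * G u2 x + v2 x * G u1 x) + max 0 c * LH x)"
  have Fd: "F1 \<in> decreasing" "F2 \<in> decreasing"
    unfolding F1_def F2_def by (intro add_decreasing VG cLH; simp)+
  have eq: "centred_product g1 g2 ms H x = F1 x - F2 x" if x: "x \<in> {0<..<1}" for x
  proof -
    have "c = max 0 c - max 0 (- c)" by (simp add: max_def)
    then have "c * LH x = max 0 c * LH x - max 0 (- c) * LH x"
      by (metis left_diff_distrib)
    moreover have "g2 x * transfers ms (\<lambda>y. g1 y * H y) x = (v1 x - v2 x) * (G u1 x - G u2 x)"
      using v(3)[of x] Lg1[OF x] x by simp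
    moreover have "(v1 x - v2 x) * (G u1 x - G u2 x)
        = v1 x * G u1 x + v2 x * G u2 x - (v1 x * G u2 x + v2 x * G u1 x)"
      by (simp add: algebra_simps)
    ultimately show ?thesis
      by (simp add: centred_product_def c_def[symmetric] LH_def[symmetric] F1_def F2_def)
  qed
  have Fle: "F x \<le> 9 * B1 * B2 * LH x" if F: "F \<in> {F1, F2}" and x: "x \<in> {0<..<1}" for F x
  proof -
    have "max 0 (- c) * LH x \<le> B1 * B2 * LH x" "max 0 c * LH x \<le> B1 * B2 * LH x"
      using cb LH0[of x] x B by (auto intro!: mult_right_mono)
    moreover have "9 * B1 * B2 * LH x = 4 * B1 * B2 * LH x + 4 * B1 * B2 * LH x + B1 * B2 * LH x"
      by simp
    ultimately show ?thesis
      using VG_le[OF _ _ x, of u1 v1] VG_le[OF _ _ x, of u2 v2] VG_le[OF _ _ x, of u2 v1] VG_le[OF _ _ x, of u1 v2] F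
      by (elim insertE emptyE; simp only: F1_def F2_def; simp; linarith)
  qed
  have iF: "integrable leb01 F1" "integrable leb01 F2"
    using Fd by (auto dest: decreasingD)
  have "mass F1 - mass F2 = mass (\<lambda>x. F1 x - F2 x)" using iF by simp
  also have "\<dots> = mass (\<lambda>x. g2 x * transfers ms (\<lambda>y. g1 y * H y) x - c * LH x)"
    by (rule integral_cong_interior)
      (use iF iP iLH eq in \<open>auto simp: centred_product_def c_def[symmetric] LH_def[symmetric]\<close>)
  also have "\<dots> = c - c * mass LH" using iP iLH by (simp add: c_def)
  finally have mF: "mass F2 = mass F1" using mLH by simp
  have "mass F1 \<le> mass (\<lambda>x. 9 * B1 * B2 * LH x)"
    by (rule integral_mono_interior) (use iF iLH Fle in auto)
  then have A: "mass F1 \<le> \<Gamma>" using mLH by (simp add: \<Gamma> B1_def B2_def)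
  have "coupled (as @ ms) \<Gamma> (mass F1) F1 F2"
    using Fd mF Fle by (simp add: coupled_def \<Gamma> B1_def B2_def LH_def H_def)
  then show thesis by (rule that[OF _ A]) (use eq in \<open>auto simp: H_def\<close>)
qed


section \<open>Passage to the invariant densities\<close>

abbreviation L1_dist :: "(real \<Rightarrow> real) \<Rightarrow> (real \<Rightarrow> real) \<Rightarrow> real" where
  "L1_dist u v \<equiv> mass (\<lambda>x. \<bar>u x - v x\<bar>)"

lemma mass_abs_transfers_le:
  assumes "set ms \<subseteq> {0<..}" "integrable leb01 w"
  shows "mass (\<lambda>x. \<bar>transfers ms w x\<bar>) \<le> mass (\<lambda>x. \<bar>w x\<bar>)"
proof -
  have "mass (\<lambda>x. \<bar>transfers ms w x\<bar>) = enn2real (\<integral>\<^sup>+x. ennreal \<bar>transfers ms w x\<bar> \<partial>leb01)"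
    by (rule integral_eq_nn_integral) (use integrable_transfers[OF assms] in auto)
  also have "\<dots> \<le> enn2real (\<integral>\<^sup>+x. ennreal \<bar>w x\<bar> \<partial>leb01)"
  proof (rule enn2real_mono)
    show "(\<integral>\<^sup>+x. ennreal \<bar>transfers ms w x\<bar> \<partial>leb01) \<le> (\<integral>\<^sup>+x. ennreal \<bar>w x\<bar> \<partial>leb01)"
      by (rule nn_integral_transfers_abs_le[OF assms(1)]) (use assms(2) in auto)
    show "(\<integral>\<^sup>+x. ennreal \<bar>w x\<bar> \<partial>leb01) < \<top>"
      using assms(2) by (simp add: integrable_iff_bounded)
  qed
  also have "\<dots> = mass (\<lambda>x. \<bar>w x\<bar>)"
    by (rule integral_eq_nn_integral[symmetric]) (use assms(2) in auto)
  finally show ?thesis .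
qed

lemma mass_abs_mult_le:
  assumes "g \<in> borel_measurable leb01" "\<And>x. x \<in> {0..1} \<Longrightarrow> \<bar>g x\<bar> \<le> B" "integrable leb01 w"
  shows "mass (\<lambda>x. \<bar>g x * w x\<bar>) \<le> B * mass (\<lambda>x. \<bar>w x\<bar>)"
proof -
  have "mass (\<lambda>x. \<bar>g x * w x\<bar>) \<le> mass (\<lambda>x. B * \<bar>w x\<bar>)"
  proof (rule integral_mono_interior)
    show "integrable leb01 (\<lambda>x. \<bar>g x * w x\<bar>)"
      by (intro integrable_abs integrable_bounded_mult[OF assms])
  qed (use assms(2,3) in \<open>auto simp: abs_mult intro!: mult_right_mono\<close>)
  then show ?thesis by simp
qed

lemma centred_product_Lipschitz:
  assumes g1: "g1 \<in> borel_measurable leb01" "\<And>x. x \<in> {0..1} \<Longrightarrow> \<bar>g1 x\<bar> \<le> B1"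
    and g2: "g2 \<in> borel_measurable leb01" "\<And>x. x \<in> {0..1} \<Longrightarrow> \<bar>g2 x\<bar> \<le> B2"
    and ms: "set ms \<subseteq> {0<..}" and int: "integrable leb01 u" "integrable leb01 v"
    and one: "mass (\<lambda>x. \<bar>u x\<bar>) \<le> 1" "mass (\<lambda>x. \<bar>v x\<bar>) \<le> 1"
  shows "integrable leb01 (centred_product g1 g2 ms u)"
    and "L1_dist (centred_product g1 g2 ms u) (centred_product g1 g2 ms v) \<le> 3 * B1 * B2 * L1_dist u v"
proof -
  have B: "0 \<le> B1" "0 \<le> B2" using g1(2)[of 0] g2(2)[of 0] by auto
  define Q where "Q = (\<lambda>w x. g2 x * transfers ms (\<lambda>y. g1 y * w y) x)"
  have iQ: "integrable leb01 (Q w)" if "integrable leb01 w" for w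
    unfolding Q_def
    by (intro integrable_bounded_mult[OF g2] integrable_transfers ms integrable_bounded_mult[OF g1] that)
  have nQ: "mass (\<lambda>x. \<bar>Q w x\<bar>) \<le> B1 * B2 * mass (\<lambda>x. \<bar>w x\<bar>)" if w: "integrable leb01 w" for w
  proof -
    note i1 = integrable_bounded_mult[OF g1 w]
    have "mass (\<lambda>x. \<bar>Q w x\<bar>) \<le> B2 * mass (\<lambda>x. \<bar>transfers ms (\<lambda>y. g1 y * w y) x\<bar>)"
      unfolding Q_def by (rule mass_abs_mult_le[OF g2 integrable_transfers[OF ms i1]])
    also have "\<dots> \<le> B2 * mass (\<lambda>x. \<bar>g1 x * w x\<bar>)"
      by (intro mult_left_mono mass_abs_transfers_le ms i1 B)
    also have "\<dots> \<le> B2 * (B1 * mass (\<lambda>x. \<bar>w x\<bar>))"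
      by (intro mult_left_mono mass_abs_mult_le[OF g1 w] B)
    finally show ?thesis by (simp add: mult_ac)
  qed
  have iL: "integrable leb01 (transfers ms w)" if "integrable leb01 w" for w
    by (rule integrable_transfers[OF ms that])
  have cp: "centred_product g1 g2 ms w = (\<lambda>x. Q w x - mass (Q w) * transfers ms w x)" for w
    by (simp add: centred_product_def Q_def fun_eq_iff)
  show "integrable leb01 (centred_product g1 g2 ms u)"
    unfolding cp using iQ[OF int(1)] iL[OF int(1)] by simp
  define w where "w = (\<lambda>x. u x - v x)"
  have w: "integrable leb01 w" using int by (simp add: w_def)
  have Qw: "Q w x = Q u x - Q v x" for x
  proof -
    have "transfers ms (\<lambda>y. g1 y * w y) = transfers ms (\<lambda>y. g1 y * u y - g1 y * v y)"
      by (simp add: w_def right_diff_distrib)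
    then show ?thesis by (simp add: Q_def transfers_diff right_diff_distrib)
  qed
  have Lw: "transfers ms w x = transfers ms u x - transfers ms v x" for x
    by (simp add: w_def transfers_diff)
  have mQw: "mass (Q w) = mass (Q u) - mass (Q v)"
    unfolding Qw using iQ int by simp
  have pt: "\<bar>centred_product g1 g2 ms u x - centred_product g1 g2 ms v x\<bar>
      \<le> \<bar>Q w x\<bar> + (\<bar>mass (Q u)\<bar> * \<bar>transfers ms w x\<bar> + \<bar>mass (Q w)\<bar> * \<bar>transfers ms v x\<bar>)" for x
  proof -
    have "centred_product g1 g2 ms u x - centred_product g1 g2 ms v x
        = Q w x - (mass (Q u) * transfers ms w x + mass (Q w) * transfers ms v x)"
      unfolding cp mQw unfolding Qw Lw by (simp add: algebra_simps)
    then show ?thesis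
      using abs_triangle_ineq4[of "Q w x" "mass (Q u) * transfers ms w x + mass (Q w) * transfers ms v x"]
        abs_triangle_ineq[of "mass (Q u) * transfers ms w x" "mass (Q w) * transfers ms v x"]
      unfolding abs_mult by linarith
  qed
  define D where "D = mass (\<lambda>x. \<bar>w x\<bar>)"
  have D0: "0 \<le> D" unfolding D_def by (rule integral_nonneg_AE) simp
  have n1: "\<bar>mass (Q u)\<bar> \<le> B1 * B2"
  proof -
    have "\<bar>mass (Q u)\<bar> \<le> mass (\<lambda>x. \<bar>Q u x\<bar>)" by (rule integral_abs_bound)
    also have "\<dots> \<le> B1 * B2 * mass (\<lambda>x. \<bar>u x\<bar>)" by (rule nQ[OF int(1)])
    also have "\<dots> \<le> B1 * B2 * 1" using B one(1) by (intro mult_left_mono) auto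
    finally show ?thesis by simp
  qed
  have n2: "\<bar>mass (Q w)\<bar> \<le> B1 * B2 * D"
    using order_trans[OF integral_abs_bound nQ[OF w]] by (simp add: D_def)
  have n3: "mass (\<lambda>x. \<bar>transfers ms w x\<bar>) \<le> D" "mass (\<lambda>x. \<bar>transfers ms v x\<bar>) \<le> 1"
    using mass_abs_transfers_le[OF ms w] order_trans[OF mass_abs_transfers_le[OF ms int(2)] one(2)]
    by (auto simp: D_def)
  have "L1_dist (centred_product g1 g2 ms u) (centred_product g1 g2 ms v)
      \<le> mass (\<lambda>x. \<bar>Q w x\<bar> + (\<bar>mass (Q u)\<bar> * \<bar>transfers ms w x\<bar> + \<bar>mass (Q w)\<bar> * \<bar>transfers ms v x\<bar>))"
    by (rule integral_mono_interior) (use iQ int w iL pt in \<open>auto simp: cp\<close>)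
  also have "\<dots> = mass (\<lambda>x. \<bar>Q w x\<bar>)
      + (\<bar>mass (Q u)\<bar> * mass (\<lambda>x. \<bar>transfers ms w x\<bar>) + \<bar>mass (Q w)\<bar> * mass (\<lambda>x. \<bar>transfers ms v x\<bar>))"
    using iQ int w iL by simp
  also have "\<dots> \<le> B1 * B2 * D + (B1 * B2 * D + B1 * B2 * D * 1)"
    using nQ[OF w] n1 n2 n3 B D0 by (intro add_mono mult_mono) (auto simp: D_def)
  finally show "L1_dist (centred_product g1 g2 ms u) (centred_product g1 g2 ms v) \<le> 3 * B1 * B2 * L1_dist u v"
    by (simp add: D_def w_def)
qed

text \<open>
  The images of Lebesgue measure from the remote past converge to the invariant density in
  \<open>L\<^sup>1\<close>, and \<^const>\<open>centred_product\<close> is Lipschitz for this distance, so bounds uniform in the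
  length of the past carry over.
\<close>

lemma centred_product_limit_bound:
  assumes g1: "g1 \<in> borel_measurable leb01" "\<And>x. x \<in> {0..1} \<Longrightarrow> \<bar>g1 x\<bar> \<le> B1"
    and g2: "g2 \<in> borel_measurable leb01" "\<And>x. x \<in> {0..1} \<Longrightarrow> \<bar>g2 x\<bar> \<le> B2"
    and ms: "set ms \<subseteq> {0<..}" and fs: "set fs \<subseteq> {0<..}"
    and h: "integrable leb01 h" "mass (\<lambda>x. \<bar>h x\<bar>) \<le> 1"
    and H: "\<And>m. integrable leb01 (H m)" "\<And>m. mass (\<lambda>x. \<bar>H m x\<bar>) \<le> 1"
    and lim: "(\<lambda>m. L1_dist (H m) h) \<longlonglongrightarrow> 0"
    and bound: "\<And>m. mass (\<lambda>x. \<bar>transfers fs (centred_product g1 g2 ms (H m)) x\<bar>) \<le> C"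
  shows "mass (\<lambda>x. \<bar>transfers fs (centred_product g1 g2 ms h) x\<bar>) \<le> C"
proof -
  let ?f = "centred_product g1 g2 ms"
  have Lip: "integrable leb01 (?f u)" "L1_dist (?f u) (?f v) \<le> 3 * B1 * B2 * L1_dist u v"
    if "integrable leb01 u" "mass (\<lambda>x. \<bar>u x\<bar>) \<le> 1" "integrable leb01 v" "mass (\<lambda>x. \<bar>v x\<bar>) \<le> 1" for u v
    by (rule centred_product_Lipschitz[OF g1 g2 ms that(1,3,2,4)]; assumption)+
  have "mass (\<lambda>x. \<bar>transfers fs (?f h) x\<bar>) \<le> C + 3 * B1 * B2 * L1_dist (H m) h" for m
  proof -
    note i = Lip(1)[OF H(1) H(2) h, of m] Lip(1)[OF h h]
    have d: "L1_dist (?f (H m)) (?f h) \<le> 3 * B1 * B2 * L1_dist (H m) h"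
      by (rule Lip(2)[OF H(1) H(2) h])
    have id: "integrable leb01 (\<lambda>x. ?f (H m) x - ?f h x)" using i by simp
    have "mass (\<lambda>x. \<bar>transfers fs (?f h) x\<bar>)
        \<le> mass (\<lambda>x. \<bar>transfers fs (?f (H m)) x\<bar> + \<bar>transfers fs (\<lambda>x. ?f (H m) x - ?f h x) x\<bar>)"
      by (rule integral_mono_interior)
        (use integrable_transfers[OF fs i(1)] integrable_transfers[OF fs i(2)] integrable_transfers[OF fs id]
          in \<open>auto simp: transfers_diff\<close>)
    also have "\<dots> = mass (\<lambda>x. \<bar>transfers fs (?f (H m)) x\<bar>) + mass (\<lambda>x. \<bar>transfers fs (\<lambda>x. ?f (H m) x - ?f h x) x\<bar>)"
      using integrable_transfers[OF fs i(1)] integrable_transfers[OF fs id] by simp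
    also have "\<dots> \<le> C + L1_dist (?f (H m)) (?f h)"
      by (intro add_mono bound mass_abs_transfers_le fs id)
    finally show ?thesis using d by linarith
  qed
  moreover have "(\<lambda>m. C + 3 * B1 * B2 * L1_dist (H m) h) \<longlonglongrightarrow> C + 3 * B1 * B2 * 0"
    by (intro tendsto_intros lim)
  ultimately show ?thesis
    by (intro LIMSEQ_le_const[of "\<lambda>m. C + 3 * B1 * B2 * L1_dist (H m) h" C]) auto
qed

lemma coupled_difference_bound:
  assumes "coupled as \<Gamma> A F1 F2" "f \<in> borel_measurable leb01" "\<And>x. x \<in> {0<..<1} \<Longrightarrow> f x = F1 x - F2 x"
  shows "mass (\<lambda>x. \<bar>f x\<bar>) \<le> 2 * A"
proof -
  have d: "F1 \<in> decreasing" "F2 \<in> decreasing" "mass F1 = A" "mass F2 = A"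
    using assms(1) by (auto simp: coupled_def)
  note i = decreasingD(1)[OF d(1)] decreasingD(1)[OF d(2)]
  have "mass (\<lambda>x. \<bar>f x\<bar>) = mass (\<lambda>x. \<bar>F1 x - F2 x\<bar>)"
    by (rule integral_cong_interior) (use assms(2,3) i in auto)
  also have "\<dots> \<le> mass (\<lambda>x. F1 x + F2 x)"
  proof (rule integral_mono_interior)
    fix x :: real assume "0 < x" "x < 1"
    then have "0 \<le> F1 x" "0 \<le> F2 x" using d(1,2) by (auto dest: decreasingD)
    then show "\<bar>F1 x - F2 x\<bar> \<le> F1 x + F2 x" by simp
  qed (use i in auto)
  also have "\<dots> = 2 * A" using i d by simp
  finally show ?thesis .
qed


section \<open>Visit frequencies of an ergodic transformation\<close>

definition ergodic_sum :: "('a \<Rightarrow> 'a) \<Rightarrow> ('a \<Rightarrow> real) \<Rightarrow> nat \<Rightarrow> 'a \<Rightarrow> real" where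
  "ergodic_sum T g n x = (\<Sum>i<n. g ((T ^^ i) x))"

lemma ergodic_sum_Suc: "ergodic_sum T g (Suc n) x = g x + ergodic_sum T g n (T x)"
  unfolding ergodic_sum_def by (subst sum.lessThan_Suc_shift) (simp add: funpow_swap1)

lemma ergodic_sum_0 [simp]: "ergodic_sum T g 0 x = 0"
  by (simp add: ergodic_sum_def)

text \<open>
  Let \<open>M n\<close> be the largest ergodic sum up to time \<open>n\<close>, including the empty one.  If the sums were
  unbounded almost everywhere, then \<open>M (Suc n) - M n \<circ> T = max (- M n \<circ> T) g\<close> would converge to
  \<open>g\<close>; but its integrals are nonnegative by invariance and monotonicity, whereas the one of \<open>g\<close>
  is negative.  The set where the sums are unbounded is invariant, so by ergodicity it is null.
\<close>

lemma AE_ergodic_sum_bounded_above: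
  fixes g :: "'a \<Rightarrow> real"
  assumes "prob_space P" and T: "T \<in> P \<rightarrow>\<^sub>M P" "distr P P T = P" and "ergodic P T"
    and g: "g \<in> borel_measurable P" "\<And>x. x \<in> space P \<Longrightarrow> \<bar>g x\<bar> \<le> B" and neg: "(\<integral>x. g x \<partial>P) < 0"
  shows "AE x in P. \<exists>C. \<forall>n. ergodic_sum T g n x \<le> C"
proof -
  interpret prob_space P by fact
  let ?S = "ergodic_sum T g"
  have Tn [measurable]: "(T ^^ n) \<in> P \<rightarrow>\<^sub>M P" for n
    by (induction n) (auto simp: comp_def intro: measurable_compose[OF _ T(1)])
  have S [measurable]: "?S n \<in> borel_measurable P" for n
    unfolding ergodic_sum_def
    by (intro borel_measurable_sum measurable_compose[OF Tn g(1)])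
  define A where "A = {x\<in>space P. \<forall>C::nat. \<exists>n. real C < ?S n x}"
  have A [measurable]: "A \<in> sets P" unfolding A_def by measurable
  have "T -` A \<inter> space P = A"
  proof (rule set_eqI)
    fix x
    have "(\<forall>C::nat. \<exists>n. real C < ?S n (T x)) \<longleftrightarrow> (\<forall>C::nat. \<exists>n. real C < ?S n x)" if x: "x \<in> space P"
    proof (intro iffI allI)
      fix C :: nat assume *: "\<forall>C::nat. \<exists>n. real C < ?S n (T x)"
      obtain D :: nat where D: "real C + B \<le> D" using real_arch_simple by blast
      from * obtain n where "real D < ?S n (T x)" by blast
      then have "real C < ?S (Suc n) x"
        using g(2)[OF x] D by (simp add: ergodic_sum_Suc)
      then show "\<exists>n. real C < ?S n x" by blast
    next
      fix C :: nat assume *: "\<forall>C::nat. \<exists>n. real C < ?S n x"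
      obtain D :: nat where D: "real C + B \<le> D" using real_arch_simple by blast
      from * obtain n where n: "real D < ?S n x" by blast
      then obtain m where m: "n = Suc m" by (cases n) auto
      then have "real C < ?S m (T x)"
        using n g(2)[OF x] D by (simp add: ergodic_sum_Suc)
      then show "\<exists>n. real C < ?S n (T x)" by blast
    qed
    then show "x \<in> T -` A \<inter> space P \<longleftrightarrow> x \<in> A"
      using measurable_space[OF T(1)] by (auto simp: A_def)
  qed
  then have "prob A = 0 \<or> prob A = 1"
    using \<open>ergodic P T\<close> A by (auto simp: ergodic_def)
  moreover have "prob A \<noteq> 1"
  proof
    assume "prob A = 1"
    then have aeA: "AE x in P. x \<in> A" using A prob_eq_1 by simp
    define M where "M = (\<lambda>n x. Max ((\<lambda>k. ?S k x) ` {..n}))"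
    have M0: "0 \<le> M n x" for n x
      unfolding M_def by (intro Max_ge_iff[THEN iffD2]) (auto intro!: bexI[of _ 0])
    have Mge: "k \<le> n \<Longrightarrow> ?S k x \<le> M n x" for k n x
      unfolding M_def by (intro Max_ge) auto
    have Mm [measurable]: "M n \<in> borel_measurable P" for n
      unfolding M_def by (intro borel_measurable_Max) auto
    have Mrec: "M (Suc n) x = max 0 (g x + M n (T x))" for n x
    proof -
      have "(\<lambda>k. ?S k x) ` {..Suc n} = insert 0 ((\<lambda>y. g x + y) ` ((\<lambda>k. ?S k (T x)) ` {..n}))"
        by (simp add: atMost_Suc_eq_insert_0 image_image ergodic_sum_Suc)
      then have "M (Suc n) x = max 0 (Max ((\<lambda>y. g x + y) ` ((\<lambda>k. ?S k (T x)) ` {..n})))"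
        unfolding M_def by (simp add: Max_insert)
      also have "Max ((\<lambda>y. g x + y) ` ((\<lambda>k. ?S k (T x)) ` {..n})) = g x + M n (T x)"
        unfolding M_def by (intro mono_Max_commute[symmetric]) (auto intro: monoI)
      finally show ?thesis .
    qed
    have B0: "0 \<le> B" using g(2) not_empty by (metis abs_ge_zero ex_in_conv order_trans)
    have Tx: "x \<in> space P \<Longrightarrow> T x \<in> space P" for x using measurable_space[OF T(1)] .
    have Mb: "\<bar>M n x\<bar> \<le> real n * B" if "x \<in> space P" for n x
      using that
    proof (induction n arbitrary: x)
      case 0
      then show ?case by (simp add: M_def)
    next
      case (Suc n)
      have "\<bar>g x\<bar> \<le> B" "\<bar>M n (T x)\<bar> \<le> real n * B"
        using g(2)[OF Suc.prems] Suc.IH[OF Tx[OF Suc.prems]] by auto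
      moreover have "0 \<le> real n * B" using B0 by simp
      moreover have "real (Suc n) * B = B + real n * B" by (simp add: algebra_simps)
      ultimately show ?case unfolding Mrec by linarith
    qed
    have Mint: "integrable P (M n)" for n
      by (rule integrable_const_bound[of _ "real n * B"]) (use Mb in auto)
    have MTint: "integrable P (\<lambda>x. M n (T x))" for n
      by (rule integrable_const_bound[of _ "real n * B"])
        (use Mb Tx measurable_compose[OF T(1) Mm] in auto)
    have MTeq: "(\<integral>x. M n (T x) \<partial>P) = (\<integral>x. M n x \<partial>P)" for n
      using integral_distr[OF T(1) Mm, of n] T(2) by simp
    have diff: "M (Suc n) x - M n (T x) = max (- M n (T x)) (g x)" for n x
      unfolding Mrec by (auto simp: max_def)
    have lim: "(\<lambda>n. \<integral>x. max (- M n (T x)) (g x) \<partial>P) \<longlonglongrightarrow> (\<integral>x. g x \<partial>P)"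
    proof (rule integral_dominated_convergence[where w = "\<lambda>_. B"])
      show "AE x in P. (\<lambda>n. max (- M n (T x)) (g x)) \<longlonglongrightarrow> g x"
        using aeA AE_space
      proof eventually_elim
        case (elim x)
        obtain C :: nat where C: "B \<le> C" using real_arch_simple by blast
        obtain D :: nat where D: "real C + B \<le> D" using real_arch_simple by blast
        obtain n where n: "real D < ?S n x" using elim(1) by (auto simp: A_def)
        then obtain m where m: "n = Suc m" by (cases n) auto
        have "real C < ?S m (T x)"
          using n m D g(2)[OF elim(2)] by (simp add: ergodic_sum_Suc)
        then have "max (- M k (T x)) (g x) = g x" if "k \<ge> m" for k
          using Mge[OF that, of "T x"] C g(2)[OF elim(2)] by (simp add: max_def)
        then show ?case
          by (intro tendsto_eventually eventually_sequentiallyI[of m]) auto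
      qed
      show "AE x in P. norm (max (- M n (T x)) (g x)) \<le> B" for n
        using AE_space
      proof eventually_elim
        case (elim x)
        then show ?case using g(2)[OF elim] M0[of n "T x"] by (auto simp: max_def)
      qed
    qed (use g(1) measurable_compose[OF T(1) Mm] in \<open>auto intro!: borel_measurable_max\<close>)
    moreover have "0 \<le> (\<integral>x. max (- M n (T x)) (g x) \<partial>P)" for n
    proof -
      have "M n x \<le> M (Suc n) x" for x
        unfolding M_def by (intro Max_mono) auto
      then have "(\<integral>x. M n x \<partial>P) \<le> (\<integral>x. M (Suc n) x \<partial>P)"
        by (intro integral_mono Mint) auto
      moreover have "(\<integral>x. max (- M n (T x)) (g x) \<partial>P) = (\<integral>x. M (Suc n) x \<partial>P) - (\<integral>x. M n x \<partial>P)"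
        unfolding diff[symmetric] by (simp add: Mint MTint MTeq)
      ultimately show ?thesis by simp
    qed
    ultimately have "0 \<le> (\<integral>x. g x \<partial>P)"
      by (meson LIMSEQ_le_const)
    with neg show False by simp
  qed
  ultimately have "prob A = 0" by simp
  then have "AE x in P. x \<notin> A"
    using A prob_eq_0 by simp
  then show ?thesis
    using AE_space
  proof eventually_elim
    case (elim x)
    then obtain C :: nat where "\<And>n. ?S n x \<le> real C"
      by (auto simp: A_def not_less)
    then show ?case by blast
  qed
qed

lemma AE_ergodic_average_upper:
  fixes f :: "'a \<Rightarrow> real"
  assumes "prob_space P" and T: "T \<in> P \<rightarrow>\<^sub>M P" "distr P P T = P" and "ergodic P T"
    and f: "f \<in> borel_measurable P" "\<And>x. x \<in> space P \<Longrightarrow> \<bar>f x\<bar> \<le> B" and "(\<integral>x. f x \<partial>P) < c"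
  shows "AE x in P. \<forall>\<^sub>F n in sequentially. ergodic_sum T f n x / n < c"
proof -
  interpret prob_space P by fact
  define c' where "c' = ((\<integral>x. f x \<partial>P) + c) / 2"
  have c': "(\<integral>x. f x \<partial>P) < c'" "c' < c" using assms by (auto simp: c'_def)
  have int: "integrable P f" by (rule integrable_const_bound[of _ B]) (use f in auto)
  have "AE x in P. \<exists>C. \<forall>n. ergodic_sum T (\<lambda>x. f x - c') n x \<le> C"
  proof (rule AE_ergodic_sum_bounded_above[OF assms(1-4)])
    show "\<bar>f x - c'\<bar> \<le> B + \<bar>c'\<bar>" if "x \<in> space P" for x using f(2)[OF that] by linarith
    have "(\<integral>x. f x - c' \<partial>P) = (\<integral>x. f x \<partial>P) - c'"
      using int by (simp add: prob_space)
    then show "(\<integral>x. f x - c' \<partial>P) < 0" using c' by simp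
  qed (use f(1) in auto)
  then show ?thesis
  proof eventually_elim
    case (elim x)
    then obtain C where C: "\<And>n. ergodic_sum T (\<lambda>x. f x - c') n x \<le> C" by blast
    have S: "ergodic_sum T f n x \<le> C + n * c'" for n
      using C[of n] by (simp add: ergodic_sum_def sum_subtractf)
    have "(\<lambda>n. C / real n) \<longlonglongrightarrow> 0" by (rule lim_const_over_n)
    then have "\<forall>\<^sub>F n in sequentially. C / real n < c - c'"
      by (rule order_tendstoD) (use c' in simp)
    then show ?case using eventually_gt_at_top[of 0]
    proof eventually_elim
      case (elim n)
      then have "ergodic_sum T f n x / n \<le> (C + n * c') / n"
        by (intro divide_right_mono S) auto
      also have "\<dots> = C / n + c'" using elim by (simp add: field_simps)
      finally show ?case using elim by simp
    qed
  qed
qed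

text \<open>
  The set whose maximum defines \<^const>\<open>last_deviation\<close> is almost surely finite; beyond its maximum
  the visit frequency is therefore within the prescribed bounds.
\<close>

lemma AE_good_visits_after_last_deviation:
  fixes \<beta> :: "'a \<Rightarrow> real"
  assumes "prob_space P" and T: "T \<in> P \<rightarrow>\<^sub>M P" "distr P P T = P" and "ergodic P T"
    and \<beta>: "\<beta> \<in> borel_measurable P" "\<And>\<omega>. \<omega> \<in> space P \<Longrightarrow> 0 < \<beta> \<omega>"
    and pos: "good_prob P \<beta> \<gamma> > 0" and "0 < \<epsilon>"
  shows "AE \<omega> in P. \<forall>n>last_deviation P \<beta> \<gamma> \<epsilon> T \<omega>.
    good_visits \<beta> \<gamma> T n \<omega> \<in> {good_prob P \<beta> \<gamma> * (1 - \<epsilon>) * n..good_prob P \<beta> \<gamma> * (1 + \<epsilon>) * n}"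
proof -
  interpret prob_space P by fact
  let ?b = "good_prob P \<beta> \<gamma>"
  define \<psi> :: "'a \<Rightarrow> real" where "\<psi> = (\<lambda>\<omega>. indicator {0<..\<gamma>} (\<beta> \<omega>))"
  have \<psi>m: "\<psi> \<in> borel_measurable P" unfolding \<psi>_def using \<beta>(1) by measurable
  have gv: "good_visits \<beta> \<gamma> T n \<omega> = ergodic_sum T \<psi> n \<omega>" for n \<omega>
    by (simp add: good_visits_def ergodic_sum_def \<psi>_def)
  have ev: "(\<integral>\<omega>. \<psi> \<omega> \<partial>P) = ?b"
  proof -
    have "(\<integral>\<omega>. \<psi> \<omega> \<partial>P) = (\<integral>\<omega>. indicator {\<omega>\<in>space P. \<beta> \<omega> \<le> \<gamma>} \<omega> \<partial>P)"
      using \<beta>(2) by (intro Bochner_Integration.integral_cong) (auto simp: \<psi>_def indicator_def)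
    also have "\<dots> = ?b" using \<beta>(1) by (simp add: good_prob_def)
    finally show ?thesis .
  qed
  have lt: "?b * (1 - \<epsilon>) < ?b" "?b < ?b * (1 + \<epsilon>)"
    using pos \<open>0 < \<epsilon>\<close> by (simp_all add: algebra_simps)
  have u: "AE \<omega> in P. \<forall>\<^sub>F n in sequentially. ergodic_sum T \<psi> n \<omega> / n < ?b * (1 + \<epsilon>)"
    by (rule AE_ergodic_average_upper[OF assms(1-4) \<psi>m, of 1]) (use ev lt in \<open>auto simp: \<psi>_def indicator_def\<close>)
  have l: "AE \<omega> in P. \<forall>\<^sub>F n in sequentially. ergodic_sum T (\<lambda>\<omega>. - \<psi> \<omega>) n \<omega> / n < - (?b * (1 - \<epsilon>))"
    by (rule AE_ergodic_average_upper[OF assms(1-4) , of _ 1]) (use ev lt \<psi>m in \<open>auto simp: \<psi>_def indicator_def\<close>)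
  show ?thesis using u l
  proof eventually_elim
    case (elim \<omega>)
    let ?D = "{n. n \<ge> 1 \<and> good_visits \<beta> \<gamma> T n \<omega> / real n \<notin> {?b * (1 - \<epsilon>)..?b * (1 + \<epsilon>)}}"
    have "\<forall>\<^sub>F n in sequentially. n \<notin> ?D"
      using elim
    proof eventually_elim
      case (elim n)
      then show ?case by (simp add: gv ergodic_sum_def sum_negf less_imp_le)
    qed
    then obtain m where "\<And>n. n \<ge> m \<Longrightarrow> n \<notin> ?D" unfolding eventually_sequentially by blast
    then have "?D \<subseteq> {..<m}" by (meson lessThan_iff not_le subsetI)
    then have fin: "finite (?D \<union> {0})" using finite_subset by blast
    show ?case
    proof (intro allI impI)
      fix n assume n: "last_deviation P \<beta> \<gamma> \<epsilon> T \<omega> < n"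
      then have "n \<notin> ?D \<union> {0}"
        using Max_ge[OF fin, of n] unfolding last_deviation_def by auto
      then have "n \<ge> 1" "good_visits \<beta> \<gamma> T n \<omega> / real n \<in> {?b * (1 - \<epsilon>)..?b * (1 + \<epsilon>)}" by auto
      then show "good_visits \<beta> \<gamma> T n \<omega> \<in> {?b * (1 - \<epsilon>) * n..?b * (1 + \<epsilon>) * n}"
        by (simp add: le_divide_eq divide_le_eq)
    qed
  qed
qed


section \<open>Counting good parameters\<close>

lemma num_good_interval:
  "real (num_good \<gamma> (map d [a..<b])) = (\<Sum>k\<in>{a..<b}. indicator {..\<gamma>} (d k))"
  by (induction b) (auto simp: indicator_def)

text \<open>
  The count over a final stretch of length \<open>l \<le> n\<close> is a difference of two forward counts, whose
  errors are of order \<open>\<epsilon> n\<close> and thus small compared with \<open>\<delta> n / 2 \<le> l\<close>.  A longer stretch contains a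
  forward and a backward count.
\<close>

lemma num_good_final_stretch:
  fixes d :: "nat \<Rightarrow> real" and b \<epsilon> \<delta> :: real
  assumes fut: "\<And>n. N < n \<Longrightarrow> real (num_good \<gamma> (map d [M..<M + n])) \<in> {b * (1 - \<epsilon>) * n..b * (1 + \<epsilon>) * n}"
    and past: "\<And>n. N < n \<Longrightarrow> n \<le> M + 1 \<Longrightarrow> b * (1 - \<epsilon>) * n \<le> real (num_good \<gamma> (map d [M + 1 - n..<M + 1]))"
    and b: "0 < b" and \<delta>: "0 < \<delta>" "\<delta> < 1" and \<epsilon>: "0 < \<epsilon>" "\<epsilon> \<le> \<delta> / 8"
    and n: "4 / \<delta> * (1 + real N) \<le> n" and l: "\<delta> * n / 2 \<le> real l" "l \<le> M + n"
  shows "b / 4 * l \<le> num_good \<gamma> (map d [M + n - l..<M + n])"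
proof -
  define c where "c = (\<lambda>u v. real (num_good \<gamma> (map d [u..<v])))"
  have c: "c u v = (\<Sum>k\<in>{u..<v}. indicator {..\<gamma>} (d k))" for u v
    unfolding c_def by (rule num_good_interval)
  have split: "c u w = c u v + c v w" if "u \<le> v" "v \<le> w" for u v w
    unfolding c using sum.atLeastLessThan_concat[OF that, of "\<lambda>k. indicator {..\<gamma>} (d k) :: real"] by simp
  have c0: "0 \<le> c u v" for u v by (simp add: c_def)
  have fut': "b * (1 - \<epsilon>) * k \<le> c M (M + k)" "c M (M + k) \<le> b * (1 + \<epsilon>) * k" if "N < k" for k
    using fut[OF that] by (auto simp: c_def)
  have N1: "1 + real N \<le> \<delta> * n / 4" using n \<delta> by (simp add: field_simps)
  moreover have dn: "\<delta> * n \<le> 1 * real n" using \<delta> by (intro mult_right_mono) auto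
  ultimately have N2: "1 + real N \<le> n / 4" by linarith
  then have Nn: "N < n" by linarith
  have e8: "\<epsilon> \<le> 1/8" using \<epsilon> \<delta> by simp
  have en: "\<epsilon> * n \<le> \<delta> * n / 8" "\<epsilon> * n \<le> n / 8"
    using mult_right_mono[OF \<epsilon>(2), of "real n"] mult_right_mono[OF e8, of "real n"] by auto
  have bmono: "b * x \<le> b * y" if "x \<le> y" for x y using b that by simp
  have "b / 4 * l \<le> c (M + n - l) (M + n)"
  proof (cases "l \<le> n")
    case True
    define q where "q = n - l"
    have q: "M + n - l = M + q" "q \<le> n" "real l = real n - real q" using True by (auto simp: q_def of_nat_diff)
    have cq: "c (M + q) (M + n) = c M (M + n) - c M (M + q)"
      using split[of M "M + q" "M + n"] q by simp
    have "\<exists>k. q \<le> k \<and> N < k \<and> l / 4 \<le> (1 - \<epsilon>) * n - (1 + \<epsilon>) * real k"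
    proof (cases "N < q")
      case True
      have "\<epsilon> * q \<le> \<epsilon> * n" using q \<epsilon> by (intro mult_left_mono) auto
      then have "l / 4 \<le> (1 - \<epsilon>) * n - (1 + \<epsilon>) * real q"
        using en l(1) q(3) unfolding left_diff_distrib distrib_right mult_1_left by linarith
      then show ?thesis using True by blast
    next
      case False
      define y where "y = 1 + real N"
      have "\<epsilon> * y \<le> 1/8 * y" using e8 by (intro mult_right_mono) (auto simp: y_def)
      moreover have "(1 - \<epsilon>) * n - (1 + \<epsilon>) * y = n - \<epsilon> * n - (y + \<epsilon> * y)"
        by (simp add: algebra_simps)
      moreover have "y \<le> n / 4" "real l \<le> real n" using N2 q(3) by (simp_all add: y_def)
      ultimately have "l / 4 \<le> (1 - \<epsilon>) * n - (1 + \<epsilon>) * y"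
        using en(2) by linarith
      then have "l / 4 \<le> (1 - \<epsilon>) * n - (1 + \<epsilon>) * (1 + real N)" by (simp only: y_def)
      then show ?thesis using False by (intro exI[of _ "Suc N"]) auto
    qed
    then obtain k where k: "q \<le> k" "N < k" "l / 4 \<le> (1 - \<epsilon>) * n - (1 + \<epsilon>) * real k" by blast
    have "c M (M + q) \<le> c M (M + k)" using split[of M "M + q" "M + k"] c0[of "M + q" "M + k"] k(1) by simp
    also have "\<dots> \<le> b * (1 + \<epsilon>) * k" by (rule fut'(2)[OF k(2)])
    finally have "b * (1 - \<epsilon>) * n - b * (1 + \<epsilon>) * k \<le> c (M + q) (M + n)"
      using fut'(1)[OF Nn] cq by linarith
    moreover have "b * (l / 4) \<le> b * (1 - \<epsilon>) * n - b * (1 + \<epsilon>) * k"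
    proof -
      have "b * ((1 - \<epsilon>) * n - (1 + \<epsilon>) * real k) = b * (1 - \<epsilon>) * n - b * (1 + \<epsilon>) * k"
        by (simp add: algebra_simps)
      with bmono[OF k(3)] show ?thesis by (simp only:)
    qed
    ultimately show ?thesis using q by simp
  next
    case False
    define q where "q = l - n"
    have q: "M + n - l = M - q" "q \<le> M" "real l = real n + real q" "0 < q"
      using False l(2) by (auto simp: q_def)
    have 1: "b * (1 - \<epsilon>) * n \<le> c (M - q) (M + n)"
      using fut'(1)[OF Nn] split[of "M - q" M "M + n"] c0[of "M - q" M] by simp
    have n7: "7/8 * real n \<le> (1 - \<epsilon>) * n" using en unfolding left_diff_distrib by simp
    show ?thesis
    proof (cases "N < q + 1")
      case True
      have "b * (1 - \<epsilon>) * real (q + 1) \<le> c (M + 1 - (q + 1)) (M + 1)"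
        unfolding c_def using True q(2) by (intro past) auto
      also have "\<dots> \<le> c (M - q) (M + n)"
        using split[of "M - q" "M + 1" "M + n"] c0[of "M + 1" "M + n"] Nn by simp
      finally have 2: "b * (1 - \<epsilon>) * real (q + 1) \<le> c (M - q) (M + n)" .
      have "x / 2 + y / 2 \<le> z" if "x \<le> z" "y \<le> z" for x y z :: real using that by linarith
      from this[OF 1 2] have "b * (((1 - \<epsilon>) * n + (1 - \<epsilon>) * real (q + 1)) / 2) \<le> c (M - q) (M + n)"
        by (simp only: distrib_left mult.assoc add_divide_distrib times_divide_eq_right)
      moreover have "l / 4 \<le> ((1 - \<epsilon>) * n + (1 - \<epsilon>) * real (q + 1)) / 2"
      proof -
        have "7/8 * real (q + 1) \<le> (1 - \<epsilon>) * real (q + 1)" using e8 by (intro mult_right_mono) auto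
        then show ?thesis using n7 q(3) by simp
      qed
      ultimately have "b * (l / 4) \<le> c (M - q) (M + n)" using bmono order_trans by blast
      then show ?thesis using q(1) by simp
    next
      case False
      then have "real q \<le> real n" using Nn by simp
      then have "l / 4 \<le> (1 - \<epsilon>) * n"
        using n7 q(3) of_nat_0_le_iff[of n, where 'a = real] by linarith
      then show ?thesis using 1 bmono[of "l / 4" "(1 - \<epsilon>) * n"] q(1) by (simp add: mult.assoc)
    qed
  qed
  then show ?thesis by (simp add: c_def)
qed


section \<open>Invariant densities and normalised operators along an orbit\<close>

lemma transfer_cocycle_eq_transfers:
  "transfer_cocycle \<sigma> \<beta> n \<omega> \<phi> = transfers (map (\<lambda>k. \<beta> ((\<sigma> ^^ k) \<omega>)) [0..<n]) \<phi>"
  by (induction n) auto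

text \<open>
  Both sides are densities of the image measure.
\<close>

lemma transfer_eq_next_density:
  assumes b: "0 < b" and h: "h \<in> borel_measurable leb01" "AE x in leb01. 0 \<le> h x"
    and h': "h' \<in> borel_measurable leb01" "AE x in leb01. 0 \<le> h' x"
    and inv: "distr (density leb01 (\<lambda>x. ennreal (h x))) leb01 (lsv b) = density leb01 (\<lambda>x. ennreal (h' x))"
  shows "AE x in leb01. transfer b h x = h' x"
proof -
  define p where "p = (\<lambda>x. max 0 (h x))"
  have p: "p \<in> borel_measurable leb01" "\<And>x. 0 \<le> p x" using h by (auto simp: p_def)
  note tp = transfer_measurable[OF b p(1)]
  have "distr (density leb01 (\<lambda>x. ennreal (h x))) leb01 (lsv b) = density leb01 (\<lambda>x. ennreal (transfer b p x))"
  proof (rule measure_eqI)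
    fix A assume "A \<in> sets (distr (density leb01 (\<lambda>x. ennreal (h x))) leb01 (lsv b))"
    then have A: "A \<in> sets leb01" by simp
    note lm = lsv_measurable[OF b]
    have pre: "lsv b -` A \<inter> space leb01 \<in> sets leb01" by (rule measurable_sets[OF lm A])
    have "emeasure (distr (density leb01 (\<lambda>x. ennreal (h x))) leb01 (lsv b)) A
        = emeasure (density leb01 (\<lambda>x. ennreal (h x))) (lsv b -` A \<inter> space leb01)"
      using lm A by (subst emeasure_distr) auto
    also have "\<dots> = (\<integral>\<^sup>+x. ennreal (h x) * indicator (lsv b -` A \<inter> space leb01) x \<partial>leb01)"
      using h(1) pre by (intro emeasure_density) auto
    also have "\<dots> = (\<integral>\<^sup>+x. indicator A (lsv b x) * ennreal (p x) \<partial>leb01)"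
      by (intro nn_integral_cong) (auto simp: p_def indicator_def max_def ennreal_neg)
    also have "\<dots> = (\<integral>\<^sup>+x. indicator A x * ennreal (transfer b p x) \<partial>leb01)"
      by (rule nn_integral_transfer[symmetric]) (use b p A in auto)
    also have "\<dots> = (\<integral>\<^sup>+x. ennreal (transfer b p x) * indicator A x \<partial>leb01)"
      by (simp add: mult.commute)
    also have "\<dots> = emeasure (density leb01 (\<lambda>x. ennreal (transfer b p x))) A"
      using tp A by (intro emeasure_density[symmetric]) auto
    finally show "emeasure (distr (density leb01 (\<lambda>x. ennreal (h x))) leb01 (lsv b)) A
        = emeasure (density leb01 (\<lambda>x. ennreal (transfer b p x))) A" .
  qed simp
  with inv have "density leb01 (\<lambda>x. ennreal (transfer b p x)) = density leb01 (\<lambda>x. ennreal (h' x))" by simp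
  then have 1: "AE x in leb01. ennreal (transfer b p x) = ennreal (h' x)"
    by (rule sigma_finite_measure.density_unique[OF
          prob_space_imp_sigma_finite[OF prob_space_leb01], rotated 2]) (use tp h' in measurable)
  have "AE x in leb01. h x = p x" using h(2) by eventually_elim (simp add: p_def)
  then have "AE x in leb01. transfer b h x = transfer b p x"
    by (rule transfer_AE_cong[OF b h(1) p(1)])
  then show ?thesis using 1 h'(2) AE_leb01_interior
  proof eventually_elim
    case (elim x)
    have "0 \<le> transfer b p x" by (rule transfer_nonneg[OF b _ elim(4)]) (use p(2) in auto)
    then show ?case using elim by simp
  qed
qed

lemma prob_density_integral:
  assumes "h \<in> borel_measurable leb01" "AE x in leb01. 0 \<le> h x"
    and "prob_space (density leb01 (\<lambda>x. ennreal (h x)))"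
  shows "integrable leb01 h" "mass (\<lambda>x. \<bar>h x\<bar>) = 1"
proof -
  interpret D: prob_space "density leb01 (\<lambda>x. ennreal (h x))" by fact
  have "(\<integral>\<^sup>+x. ennreal (h x) \<partial>leb01) = (\<integral>\<^sup>+x. ennreal (h x) * indicator (space leb01) x \<partial>leb01)"
    by (intro nn_integral_cong) auto
  also have "\<dots> = emeasure (density leb01 (\<lambda>x. ennreal (h x))) (space leb01)"
    using assms(1) by (intro emeasure_density[symmetric] sets.top) auto
  finally have *: "(\<integral>\<^sup>+x. ennreal (h x) \<partial>leb01) = 1" using D.emeasure_space_1 by simp
  have **: "(\<integral>\<^sup>+x. ennreal \<bar>h x\<bar> \<partial>leb01) = 1"
    unfolding *[symmetric] by (rule nn_integral_cong_AE) (use assms(2) in eventually_elim, simp)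
  show "integrable leb01 h"
    by (rule integrableI_bounded[OF assms(1)]) (simp add: **)
  show "mass (\<lambda>x. \<bar>h x\<bar>) = 1"
    using assms(1) ** by (subst integral_eq_nn_integral) auto
qed

text \<open>
  This makes the invariant densities positive, so that dividing by them loses nothing.
\<close>

lemma lower_bound_L1_limit:
  assumes H: "\<And>m. integrable leb01 (H m)" "\<And>m x. 0 < x \<Longrightarrow> x < 1 \<Longrightarrow> c \<le> H m x"
    and h: "integrable leb01 h" and lim: "(\<lambda>m. L1_dist (H m) h) \<longlonglongrightarrow> 0"
  shows "AE x in leb01. c \<le> h x"
proof -
  define w where "w = (\<lambda>x. max 0 (c - h x))"
  have wi: "integrable leb01 w" unfolding w_def using integrable_leb01_const h by auto
  have "mass w \<le> L1_dist (H m) h" for m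
  proof (rule integral_mono_interior[OF wi])
    fix x :: real assume "0 < x" "x < 1"
    then show "w x \<le> \<bar>H m x - h x\<bar>" using H(2)[of x m] by (auto simp: w_def)
  qed (use H(1) h in auto)
  then have "mass w \<le> 0" by (intro LIMSEQ_le_const[OF lim]) auto
  moreover have "0 \<le> mass w" by (rule integral_nonneg_AE) (simp add: w_def)
  ultimately have "mass w = 0" by simp
  then have "AE x in leb01. w x = 0"
    using integral_nonneg_eq_0_iff_AE[OF wi] by (simp add: w_def)
  then show ?thesis by eventually_elim (simp add: w_def max_def split: if_splits)
qed

context
  fixes \<sigma> :: "'a \<Rightarrow> 'a" and \<beta> :: "'a \<Rightarrow> real" and h :: "'a \<Rightarrow> real \<Rightarrow> real" and \<omega> :: 'a
  assumes \<beta>_pos: "\<And>k. 0 < \<beta> ((\<sigma> ^^ k) \<omega>)"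
    and h_meas: "\<And>k. h ((\<sigma> ^^ k) \<omega>) \<in> borel_measurable leb01"
begin

lemma transfers_eq_later_density:
  assumes "\<And>k. AE x in leb01. transfer (\<beta> ((\<sigma> ^^ k) \<omega>)) (h ((\<sigma> ^^ k) \<omega>)) x = h ((\<sigma> ^^ Suc k) \<omega>) x"
  shows "AE x in leb01. transfers (map (\<lambda>k. \<beta> ((\<sigma> ^^ k) \<omega>)) [0..<n]) (h \<omega>) x = h ((\<sigma> ^^ n) \<omega>) x"
proof (induction n)
  case (Suc n)
  let ?T = "transfers (map (\<lambda>k. \<beta> ((\<sigma> ^^ k) \<omega>)) [0..<n]) (h \<omega>)"
  have "?T \<in> borel_measurable leb01"
    by (rule transfers_measurable) (use \<beta>_pos h_meas[of 0] in auto)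
  then have "AE x in leb01. transfer (\<beta> ((\<sigma> ^^ n) \<omega>)) ?T x = transfer (\<beta> ((\<sigma> ^^ n) \<omega>)) (h ((\<sigma> ^^ n) \<omega>)) x"
    by (rule transfer_AE_cong[OF \<beta>_pos _ h_meas Suc.IH])
  then show ?case using assms[of n] by eventually_elim simp
qed simp

lemma norm_transfer_cocycle_measurable:
  assumes "\<phi> \<in> borel_measurable leb01"
  shows "norm_transfer_cocycle \<sigma> \<beta> h n \<omega> \<phi> \<in> borel_measurable leb01"
proof (induction n)
  case (Suc n)
  have "transfer (\<beta> ((\<sigma> ^^ n) \<omega>)) (\<lambda>y. norm_transfer_cocycle \<sigma> \<beta> h n \<omega> \<phi> y * h ((\<sigma> ^^ n) \<omega>) y)
      \<in> borel_measurable leb01"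
    by (intro transfer_measurable \<beta>_pos borel_measurable_times Suc.IH h_meas)
  then show ?case
    using h_meas[of "Suc n"] unfolding norm_transfer_cocycle.simps norm_transfer_def[abs_def]
    by (auto intro!: borel_measurable_divide)
qed (use assms in simp)

lemma norm_transfer_cocycle_times_density:
  assumes "\<phi> \<in> borel_measurable leb01" and pos: "\<And>k. AE x in leb01. 0 < h ((\<sigma> ^^ k) \<omega>) x"
  shows "AE x in leb01. norm_transfer_cocycle \<sigma> \<beta> h n \<omega> \<phi> x * h ((\<sigma> ^^ n) \<omega>) x
    = transfers (map (\<lambda>k. \<beta> ((\<sigma> ^^ k) \<omega>)) [0..<n]) (\<lambda>y. \<phi> y * h \<omega> y) x"
proof (induction n)
  case (Suc n)
  let ?\<Phi> = "\<lambda>y. norm_transfer_cocycle \<sigma> \<beta> h n \<omega> \<phi> y * h ((\<sigma> ^^ n) \<omega>) y"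
  let ?T = "transfers (map (\<lambda>k. \<beta> ((\<sigma> ^^ k) \<omega>)) [0..<n]) (\<lambda>y. \<phi> y * h \<omega> y)"
  have 1: "?T \<in> borel_measurable leb01"
    by (rule transfers_measurable) (use \<beta>_pos h_meas[of 0] assms in auto)
  have 2: "?\<Phi> \<in> borel_measurable leb01"
    by (intro borel_measurable_times norm_transfer_cocycle_measurable assms h_meas)
  have "AE x in leb01. transfer (\<beta> ((\<sigma> ^^ n) \<omega>)) ?\<Phi> x = transfer (\<beta> ((\<sigma> ^^ n) \<omega>)) ?T x"
    by (rule transfer_AE_cong[OF \<beta>_pos 2 1 Suc.IH])
  then show ?case using pos[of "Suc n"]
    by eventually_elim (simp add: norm_transfer_def)
qed simp

end

text \<open>
  Multiplying by the density at the final time turns the normalised operators into the transfer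
  operators; the expectation in the centring is the coefficient in \<^const>\<open>centred_product\<close>.
\<close>

lemma L1_norm_centred_eq:
  fixes \<sigma> :: "'a \<Rightarrow> 'a" and \<beta> :: "'a \<Rightarrow> real" and h :: "'a \<Rightarrow> real \<Rightarrow> real" and \<omega> :: 'a
    and r n :: nat
  assumes \<beta>_pos: "\<And>k. 0 < \<beta> ((\<sigma> ^^ k) \<omega>)"
    and h_meas: "\<And>k. h ((\<sigma> ^^ k) \<omega>) \<in> borel_measurable leb01"
    and pos: "\<And>k. AE x in leb01. 0 < h ((\<sigma> ^^ k) \<omega>) x"
    and inv: "\<And>k. AE x in leb01. transfer (\<beta> ((\<sigma> ^^ k) \<omega>)) (h ((\<sigma> ^^ k) \<omega>)) x = h ((\<sigma> ^^ Suc k) \<omega>) x"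
    and int: "integrable leb01 (h \<omega>)"
    and g1: "g1 \<in> borel_measurable leb01" "\<And>x. x \<in> {0..1} \<Longrightarrow> \<bar>g1 x\<bar> \<le> B1"
    and g2: "g2 \<in> borel_measurable leb01" "\<And>x. x \<in> {0..1} \<Longrightarrow> \<bar>g2 x\<bar> \<le> B2"
  defines "\<omega>' \<equiv> (\<sigma> ^^ r) \<omega>"
  defines "\<nu> \<equiv> fibre_measure h ((\<sigma> ^^ n) \<omega>')"
  shows "L1_norm \<nu> (centred \<nu> (norm_transfer_cocycle \<sigma> \<beta> h n \<omega>' (\<lambda>x. g2 x * norm_transfer_cocycle \<sigma> \<beta> h r \<omega> g1 x)))
    = ennreal (mass (\<lambda>x. \<bar>transfers (map (\<lambda>k. \<beta> ((\<sigma> ^^ k) \<omega>')) [0..<n])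
        (centred_product g1 g2 (map (\<lambda>k. \<beta> ((\<sigma> ^^ k) \<omega>)) [0..<r]) (h \<omega>)) x\<bar>))"
proof -
  have shift: "(\<sigma> ^^ k) \<omega>' = (\<sigma> ^^ (k + r)) \<omega>" for k by (simp add: \<omega>'_def funpow_add)
  have \<beta>': "0 < \<beta> ((\<sigma> ^^ k) \<omega>')" and h': "h ((\<sigma> ^^ k) \<omega>') \<in> borel_measurable leb01"
    and pos': "AE x in leb01. 0 < h ((\<sigma> ^^ k) \<omega>') x"
    and inv': "AE x in leb01. transfer (\<beta> ((\<sigma> ^^ k) \<omega>')) (h ((\<sigma> ^^ k) \<omega>')) x = h ((\<sigma> ^^ Suc k) \<omega>') x" for k
    using \<beta>_pos[of "k + r"] h_meas[of "k + r"] pos[of "k + r"] inv[of "k + r"]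
    unfolding shift by auto
  define ms where "ms = map (\<lambda>k. \<beta> ((\<sigma> ^^ k) \<omega>)) [0..<r]"
  define fs where "fs = map (\<lambda>k. \<beta> ((\<sigma> ^^ k) \<omega>')) [0..<n]"
  have ms: "set ms \<subseteq> {0<..}" and fs: "set fs \<subseteq> {0<..}" using \<beta>_pos \<beta>' by (auto simp: ms_def fs_def)
  define hn where "hn = h ((\<sigma> ^^ n) \<omega>')"
  have hn: "hn \<in> borel_measurable leb01" "AE x in leb01. 0 < hn x" using h' pos' by (auto simp: hn_def)
  define \<Psi> where "\<Psi> = norm_transfer_cocycle \<sigma> \<beta> h r \<omega> g1"
  define \<Phi> where "\<Phi> = norm_transfer_cocycle \<sigma> \<beta> h n \<omega>' (\<lambda>x. g2 x * \<Psi> x)"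
  have \<Psi>: "\<Psi> \<in> borel_measurable leb01" unfolding \<Psi>_def
    by (rule norm_transfer_cocycle_measurable[where \<sigma> = \<sigma> and \<beta> = \<beta> and h = h and \<omega> = \<omega>, OF \<beta>_pos h_meas g1(1)])
  have \<Phi>: "\<Phi> \<in> borel_measurable leb01" unfolding \<Phi>_def
    by (rule norm_transfer_cocycle_measurable[where \<sigma> = \<sigma> and \<beta> = \<beta> and h = h and \<omega> = \<omega>', OF \<beta>' h']) (use g2(1) \<Psi> in measurable)
  define Lg where "Lg = transfers ms (\<lambda>y. g1 y * h \<omega> y)"
  define c where "c = mass (\<lambda>x. g2 x * Lg x)"
  have iLg: "integrable leb01 Lg" unfolding Lg_def
    by (intro integrable_transfers ms integrable_bounded_mult[OF g1] int)
  have ig: "integrable leb01 (\<lambda>x. g2 x * Lg x)" by (rule integrable_bounded_mult[OF g2 iLg])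
  have 1: "AE x in leb01. \<Psi> x * h \<omega>' x = Lg x"
    unfolding \<Psi>_def Lg_def ms_def \<omega>'_def
    by (rule norm_transfer_cocycle_times_density[where \<sigma> = \<sigma> and \<beta> = \<beta> and h = h and \<omega> = \<omega>, OF \<beta>_pos h_meas g1(1) pos])
  have 2: "AE x in leb01. \<Phi> x * hn x = transfers fs (\<lambda>y. (g2 y * \<Psi> y) * h \<omega>' y) x"
    unfolding \<Phi>_def hn_def fs_def
    by (rule norm_transfer_cocycle_times_density[where \<sigma> = \<sigma> and \<beta> = \<beta> and h = h and \<omega> = \<omega>', OF \<beta>' h' _ pos']) (use g2(1) \<Psi> in measurable)
  have 3: "AE x in leb01. transfers fs (\<lambda>y. (g2 y * \<Psi> y) * h \<omega>' y) x = transfers fs (\<lambda>y. g2 y * Lg y) x"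
  proof (rule transfers_AE_cong[OF fs])
    show "(\<lambda>y. (g2 y * \<Psi> y) * h \<omega>' y) \<in> borel_measurable leb01"
      by (intro borel_measurable_times g2(1) \<Psi>) (use h'[of 0] in simp)
    show "AE x in leb01. g2 x * \<Psi> x * h \<omega>' x = g2 x * Lg x"
      using 1 by eventually_elim (simp add: mult.assoc)
  qed (use ig in auto)
  have \<Phi>hn: "AE x in leb01. \<Phi> x * hn x = transfers fs (\<lambda>y. g2 y * Lg y) x"
    using 2 3 by eventually_elim simp
  have hr: "AE x in leb01. transfers ms (h \<omega>) x = h \<omega>' x"
    unfolding ms_def \<omega>'_def by (rule transfers_eq_later_density[where \<sigma> = \<sigma> and \<beta> = \<beta> and h = h and \<omega> = \<omega>, OF \<beta>_pos h_meas inv])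
  have "AE x in leb01. transfers fs (transfers ms (h \<omega>)) x = transfers fs (h \<omega>') x"
    by (rule transfers_AE_cong[OF fs _ _ hr]) (use transfers_measurable[OF ms] h_meas[of 0] h'[of 0] in auto)
  moreover have "AE x in leb01. transfers fs (h \<omega>') x = hn x"
    unfolding fs_def hn_def by (rule transfers_eq_later_density[where \<sigma> = \<sigma> and \<beta> = \<beta> and h = h and \<omega> = \<omega>', OF \<beta>' h' inv'])
  ultimately have hn_eq: "AE x in leb01. transfers fs (transfers ms (h \<omega>)) x = hn x"
    by eventually_elim simp
  have \<nu>: "\<nu> = density leb01 (\<lambda>x. ennreal (hn x))" by (simp add: \<nu>_def fibre_measure_def hn_def)
  have mean: "integral\<^sup>L \<nu> \<Phi> = c"
  proof -
    have "integral\<^sup>L \<nu> \<Phi> = (\<integral>x. hn x *\<^sub>R \<Phi> x \<partial>leb01)" unfolding \<nu>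
      by (rule integral_density) (use \<Phi> hn in \<open>auto elim: eventually_mono\<close>)
    also have "\<dots> = mass (transfers fs (\<lambda>y. g2 y * Lg y))"
      by (rule integral_cong_AE)
        (use \<Phi> hn(1) integrable_transfers[OF fs ig] \<Phi>hn in \<open>auto elim!: eventually_mono simp: mult.commute\<close>)
    also have "\<dots> = c" unfolding c_def by (rule mass_transfers[OF fs ig])
    finally show ?thesis .
  qed
  define f where "f = transfers fs (centred_product g1 g2 ms (h \<omega>))"
  have fi: "integrable leb01 (centred_product g1 g2 ms (h \<omega>))"
    unfolding centred_product_def Lg_def[symmetric] using ig integrable_transfers[OF ms int] by auto
  have f_eq: "f = (\<lambda>x. transfers fs (\<lambda>y. g2 y * Lg y) x - c * transfers fs (transfers ms (h \<omega>)) x)"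
  proof -
    have "centred_product g1 g2 ms (h \<omega>) = (\<lambda>x. g2 x * Lg x - c * transfers ms (h \<omega>) x)"
      by (simp add: centred_product_def Lg_def[symmetric] c_def fun_eq_iff)
    then show ?thesis unfolding f_def by (simp only: transfers_diff transfers_cmult)
  qed
  have "L1_norm \<nu> (centred \<nu> \<Phi>) = (\<integral>\<^sup>+x. ennreal (hn x) * ennreal \<bar>\<Phi> x - c\<bar> \<partial>leb01)"
    unfolding L1_norm_def centred_def mean unfolding \<nu>
    by (rule nn_integral_density) (use hn(1) \<Phi> in measurable)
  also have "\<dots> = (\<integral>\<^sup>+x. ennreal \<bar>f x\<bar> \<partial>leb01)"
  proof (rule nn_integral_cong_AE)
    show "AE x in leb01. ennreal (hn x) * ennreal \<bar>\<Phi> x - c\<bar> = ennreal \<bar>f x\<bar>"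
      using hn(2) \<Phi>hn hn_eq
    proof eventually_elim
      case (elim x)
      have "f x = hn x * (\<Phi> x - c)"
        unfolding f_eq elim(2)[symmetric] elim(3) by (simp add: algebra_simps)
      then show ?case using elim(1) by (simp add: abs_mult ennreal_mult)
    qed
  qed
  also have "\<dots> = ennreal (mass (\<lambda>x. \<bar>f x\<bar>))"
    using integrable_transfers[OF fs fi] by (intro nn_integral_eq_integral) (auto simp: f_def)
  finally show ?thesis by (simp add: f_def \<Phi>_def \<Psi>_def ms_def fs_def)
qed


section \<open>Orbits of an invertible transformation\<close>

lemma AE_funpow:
  assumes "T \<in> P \<rightarrow>\<^sub>M P" "distr P P T = P" "AE x in P. Q x"
  shows "AE x in P. \<forall>k. Q ((T ^^ k) x)"
proof -
  have "AE x in P. Q ((T ^^ k) x)" for k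
  proof (induction k)
    case (Suc k)
    have "AE x in distr P P T. Q ((T ^^ k) x)" using Suc by (simp only: assms(2))
    then have "AE x in P. Q ((T ^^ k) (T x))" by (rule AE_distrD[OF assms(1)])
    then show ?case by (simp add: funpow_swap1)
  qed (use assms(3) in simp)
  then show ?thesis by (simp add: AE_all_countable)
qed

lemma funpow_mem: "(\<And>x. x \<in> S \<Longrightarrow> T x \<in> S) \<Longrightarrow> x \<in> S \<Longrightarrow> (T ^^ k) x \<in> S"
  by (induction k) auto

lemma funpow_cancel:
  assumes "\<And>x. x \<in> S \<Longrightarrow> R x \<in> S" "\<And>x. x \<in> S \<Longrightarrow> T (R x) = x" "x \<in> S"
  shows "(T ^^ (q + k)) ((R ^^ k) x) = (T ^^ q) x" "(T ^^ k) ((R ^^ (k + q)) x) = (R ^^ q) x"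
proof -
  have *: "(T ^^ k) ((R ^^ k) y) = y" if "y \<in> S" for y
    using that
  proof (induction k)
    case (Suc k)
    have "(R ^^ k) y \<in> S" by (rule funpow_mem) (use assms Suc.prems in auto)
    have "(T ^^ Suc k) ((R ^^ Suc k) y) = (T ^^ k) (T ((R ^^ Suc k) y))"
      by (simp only: funpow_Suc_right comp_apply)
    also have "(R ^^ Suc k) y = R ((R ^^ k) y)" by simp
    also have "T (R ((R ^^ k) y)) = (R ^^ k) y" by (rule assms(2)) fact
    finally show ?case using Suc by simp
  qed simp
  show "(T ^^ (q + k)) ((R ^^ k) x) = (T ^^ q) x" using * assms(3) by (simp add: funpow_add)
  show "(T ^^ k) ((R ^^ (k + q)) x) = (R ^^ q) x"
    using *[of "(R ^^ q) x"] funpow_mem[of S R x q] assms by (simp add: funpow_add)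
qed

lemma inverse_mpt:
  assumes "prob_space P" "invertible_mpt P \<sigma>" "ergodic P \<sigma>"
  defines "\<tau> \<equiv> inv_into (space P) \<sigma>"
  shows "\<sigma> \<in> P \<rightarrow>\<^sub>M P" "distr P P \<sigma> = P" "\<tau> \<in> P \<rightarrow>\<^sub>M P" "distr P P \<tau> = P" "ergodic P \<tau>"
    "\<And>\<omega>. \<omega> \<in> space P \<Longrightarrow> \<sigma> \<omega> \<in> space P" "\<And>\<omega>. \<omega> \<in> space P \<Longrightarrow> \<tau> \<omega> \<in> space P"
    "\<And>\<omega>. \<omega> \<in> space P \<Longrightarrow> \<tau> (\<sigma> \<omega>) = \<omega>" "\<And>\<omega>. \<omega> \<in> space P \<Longrightarrow> \<sigma> (\<tau> \<omega>) = \<omega>"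
proof -
  have bij: "bij_betw \<sigma> (space P) (space P)" using assms(2) by (simp add: invertible_mpt_def)
  show m: "\<sigma> \<in> P \<rightarrow>\<^sub>M P" "distr P P \<sigma> = P" "\<tau> \<in> P \<rightarrow>\<^sub>M P"
    using assms(2) by (simp_all add: invertible_mpt_def \<tau>_def)
  show s: "\<And>\<omega>. \<omega> \<in> space P \<Longrightarrow> \<sigma> \<omega> \<in> space P" "\<And>\<omega>. \<omega> \<in> space P \<Longrightarrow> \<tau> \<omega> \<in> space P"
    using measurable_space[OF m(1)] measurable_space[OF m(3)] by auto
  show inv: "\<And>\<omega>. \<omega> \<in> space P \<Longrightarrow> \<tau> (\<sigma> \<omega>) = \<omega>" "\<And>\<omega>. \<omega> \<in> space P \<Longrightarrow> \<sigma> (\<tau> \<omega>) = \<omega>"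
    unfolding \<tau>_def using bij_betw_inv_into_left[OF bij] bij_betw_inv_into_right[OF bij] by auto
  have "distr P P \<tau> = distr (distr P P \<sigma>) P \<tau>" using m by simp
  also have "\<dots> = distr P P (\<tau> \<circ> \<sigma>)" by (rule distr_distr[OF m(3,1)])
  also have "\<dots> = distr P P (\<lambda>x. x)" using inv(1) by (intro distr_cong) auto
  finally show "distr P P \<tau> = P" by (simp add: distr_id)
  show "ergodic P \<tau>" unfolding ergodic_def
  proof (intro ballI impI)
    fix A assume A: "A \<in> sets P" "\<tau> -` A \<inter> space P = A"
    have "\<sigma> -` A \<inter> space P = A"
    proof (rule set_eqI)
      fix \<omega>
      have "\<sigma> \<omega> \<in> A \<longleftrightarrow> \<omega> \<in> A" if "\<omega> \<in> space P"
        using A(2) s(1)[OF that] inv(1)[OF that] by (metis Int_iff vimage_eq)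
      moreover have "\<omega> \<in> A \<Longrightarrow> \<omega> \<in> space P" using A(1) sets.sets_into_space by blast
      ultimately show "\<omega> \<in> \<sigma> -` A \<inter> space P \<longleftrightarrow> \<omega> \<in> A" by auto
    qed
    then show "measure P A = 0 \<or> measure P A = 1" using assms(3) A(1) by (auto simp: ergodic_def)
  qed
qed


section \<open>Loss of memory along almost every orbit\<close>

text \<open>
  The frequency bounds apply from the time \<open>4 / \<delta> * (1 + N)\<close> on.  Before that time only the trivial
  bound is available, which costs the factor \<open>(1 + N) powr q\<close>.
\<close>

lemma (in contraction_constants) centred_product_decay:
  fixes d :: "nat \<Rightarrow> real" and b \<epsilon> :: real
  assumes d: "\<And>k. d k \<in> {0<..\<alpha>}" and b: "0 < b"
    and \<epsilon>: "0 < \<epsilon>" "\<epsilon> \<le> \<delta> / 8"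
    and g: "Lip01 g1" "Lip01 g2"
    and fut: "\<And>n. N < n \<Longrightarrow> real (num_good \<gamma> (map d [m + r..<m + r + n])) \<in> {b * (1 - \<epsilon>) * n..b * (1 + \<epsilon>) * n}"
    and past: "\<And>n. N < n \<Longrightarrow> n \<le> m + r + 1 \<Longrightarrow>
      b * (1 - \<epsilon>) * n \<le> real (num_good \<gamma> (map d [m + r + 1 - n..<m + r + 1]))"
    and n: "1 \<le> n"
  defines "q \<equiv> 1/\<gamma> - 1"
  defines "D \<equiv> (4 / \<delta>) powr q + 2 * tail_const \<gamma> (b / 4) * (2 / \<delta>) powr q"
  shows "mass (\<lambda>x. \<bar>transfers (map d [m + r..<m + r + n])
      (centred_product g1 g2 (map d [m..<m + r]) (transfers (map d [0..<m]) (\<lambda>_. 1))) x\<bar>)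
    \<le> 18 * D * (1 + Lip_norm g1) * (1 + Lip_norm g2) * (1 + real N) powr max 1 q * real n powr (- q)"
proof -
  define \<Gamma> where "\<Gamma> = 9 * (1 + Lip_norm g1) * (1 + Lip_norm g2)"
  define n0 where "n0 = 4 / \<delta> * (1 + real N)"
  define B where "B = D * (1 + real N) powr q"
  have q: "0 < q" "1 - 1/\<gamma> = - q" "1/\<gamma> - 1 = q" using \<gamma> by (auto simp: q_def)
  have sd: "set (map d xs) \<subseteq> {0<..}" for xs using d by auto
  obtain F1 F2 A where F: "coupled (map d [0..<m] @ map d [m..<m + r]) \<Gamma> A F1 F2" "A \<le> \<Gamma>"
    "\<And>x. x \<in> {0<..<1} \<Longrightarrow>
      centred_product g1 g2 (map d [m..<m + r]) (transfers (map d [0..<m]) (\<lambda>_. 1)) x = F1 x - F2 x"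
    by (rule centred_product_coupled[OF g sd sd \<Gamma>_def]) (rule that; assumption)
  have app: "map d [0..<m] @ map d [m..<m + r] = map d [0..<m + r]"
    using upt_add_eq_append[of 0 m r] by (simp flip: map_append)
  have L0: "0 \<le> Lip_norm g1" "0 \<le> Lip_norm g2"
    using Lip01_decomposition[OF g(1)] Lip01_decomposition[OF g(2)] by metis+
  then have \<Gamma>0: "0 \<le> \<Gamma>" by (simp add: \<Gamma>_def)
  have tc: "0 \<le> 2 * tail_const \<gamma> (b / 4) * (2 / \<delta>) powr q"
    using tail_const_nonneg[OF \<gamma>] by (intro mult_nonneg_nonneg) auto
  have N1: "1 \<le> (1 + real N) powr q" using q by (intro ge_one_powr_ge_zero) auto
  have "n0 powr q = (4 / \<delta>) powr q * (1 + real N) powr q" unfolding n0_def by (rule powr_mult)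
  also have "\<dots> \<le> B" unfolding B_def D_def by (intro mult_right_mono, use tc in linarith) simp
  finally have B1: "n0 powr (1/\<gamma> - 1) \<le> B" unfolding q(3) .
  have "2 * tail_const \<gamma> (b / 4) * (2 / \<delta>) powr q * 1 \<le> B"
    unfolding B_def D_def using tc N1 by (intro mult_mono add_nonneg_nonneg) auto
  then have B2: "2 * tail_const \<gamma> (b / 4) * (2 / \<delta>) powr (1/\<gamma> - 1) \<le> B" unfolding q(3) by simp
  have "\<exists>F1' F2' A'. coupled (map d [0..<m + r + n]) \<Gamma> A' F1' F2' \<and> A' \<le> \<Gamma> * B * real n powr (1 - 1/\<gamma>) \<and>
    (\<forall>x\<in>{0<..<1}. transfers (map d [m + r..<m + r + n]) F1 x - transfers (map d [m + r..<m + r + n]) F2 x = F1' x - F2' x)"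
  proof (rule coupled_decay[OF d _ F(2) \<Gamma>0 _ _ _ B1 B2 n])
    show "coupled (map d [0..<m + r]) \<Gamma> A F1 F2" using F(1) unfolding app .
    show "1 \<le> \<delta> * n0" using \<delta> by (simp add: n0_def)
    fix n l :: nat assume "n0 \<le> real n" "\<delta> * n / 2 \<le> real l" "l \<le> m + r + n"
    then show "b / 4 * real l \<le> num_good \<gamma> (map d [m + r + n - l..<m + r + n])"
      unfolding n0_def by (intro num_good_final_stretch[OF fut past b \<delta>(1,2) \<epsilon>]) auto
  qed (use b in auto)
  then obtain F1' F2' A' where F': "coupled (map d [0..<m + r + n]) \<Gamma> A' F1' F2'"
    "A' \<le> \<Gamma> * B * real n powr (- q)"
    "\<And>x. x \<in> {0<..<1} \<Longrightarrow>
      transfers (map d [m + r..<m + r + n]) F1 x - transfers (map d [m + r..<m + r + n]) F2 x = F1' x - F2' x"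
    unfolding q(2) by blast
  define f where "f = centred_product g1 g2 (map d [m..<m + r]) (transfers (map d [0..<m]) (\<lambda>_. 1))"
  let ?fs = "map d [m + r..<m + r + n]"
  have "mass (\<lambda>x. \<bar>transfers ?fs f x\<bar>) \<le> 2 * A'"
  proof (rule coupled_difference_bound[OF F'(1)])
    have i1: "integrable leb01 (transfers (map d [0..<m]) (\<lambda>_. 1))"
      by (intro integrable_transfers sd integrable_leb01_const)
    have "f \<in> borel_measurable leb01"
    proof -
      have "g1 \<in> borel_measurable leb01" "g2 \<in> borel_measurable leb01"
        using Lip01_decomposition[OF g(1)] Lip01_decomposition[OF g(2)] by metis+
      moreover note borel_measurable_integrable[OF i1]
      ultimately have "(\<lambda>y. g1 y * transfers (map d [0..<m]) (\<lambda>_. 1) y) \<in> borel_measurable leb01" "g2 \<in> borel_measurable leb01"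
        "transfers (map d [m..<m + r]) (transfers (map d [0..<m]) (\<lambda>_. 1)) \<in> borel_measurable leb01"
        by (auto intro!: transfers_measurable[OF sd])
      note this(2,3) transfers_measurable[OF sd this(1), of "[m..<m + r]"]
      then show ?thesis unfolding f_def centred_product_def[abs_def] by measurable
    qed
    then show "transfers ?fs f \<in> borel_measurable leb01" by (rule transfers_measurable[OF sd])
    fix x :: real assume x: "x \<in> {0<..<1}"
    have "transfers ?fs f x = transfers ?fs (\<lambda>x. F1 x - F2 x) x"
      by (rule transfers_cong[OF sd _ x]) (use F(3) in \<open>simp add: f_def\<close>)
    then show "transfers ?fs f x = F1' x - F2' x" using F'(3)[OF x] by (simp add: transfers_diff)
  qed
  also have "\<dots> \<le> 2 * (\<Gamma> * B * real n powr (- q))" using F'(2) by simp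
  also have "\<dots> \<le> 2 * (\<Gamma> * (D * (1 + real N) powr max 1 q) * real n powr (- q))"
  proof -
    have "B \<le> D * (1 + real N) powr max 1 q" unfolding B_def
      using tc by (intro mult_left_mono powr_mono) (auto simp: D_def)
    then show ?thesis using \<Gamma>0 by (intro mult_left_mono mult_right_mono) auto
  qed
  also have "\<dots> = 18 * D * (1 + Lip_norm g1) * (1 + Lip_norm g2) * (1 + real N) powr max 1 q * real n powr (- q)"
    unfolding \<Gamma>_def by (simp only: mult_ac)
  finally show ?thesis unfolding f_def .
qed

text \<open>
  Parameters along the past and the future of \<open>\<omega>\<close>, read off an orbit that starts \<open>M\<close> steps earlier.
\<close>

lemma num_good_eq_good_visits:
  assumes pos: "\<And>k. 0 < \<beta> ((\<sigma> ^^ k) \<omega>)" "\<And>k. 0 < \<beta> ((\<tau> ^^ k) \<omega>)"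
    and fut: "\<And>k. d (M + k) = \<beta> ((\<sigma> ^^ k) \<omega>)" and past: "\<And>k. k \<le> M \<Longrightarrow> d (M - k) = \<beta> ((\<tau> ^^ k) \<omega>)"
  shows "real (num_good \<gamma> (map d [M..<M + n])) = good_visits \<beta> \<gamma> \<sigma> n \<omega>"
    and "n \<le> M + 1 \<Longrightarrow> real (num_good \<gamma> (map d [M + 1 - n..<M + 1])) = good_visits \<beta> \<gamma> \<tau> n \<omega>"
proof -
  have "(\<Sum>k\<in>{M..<M + n}. indicator {..\<gamma>} (d k)) = good_visits \<beta> \<gamma> \<sigma> n \<omega>"
    unfolding good_visits_def
  proof (rule sum.reindex_bij_witness[of _ "\<lambda>k. M + k" "\<lambda>k. k - M"])
    fix k assume "k \<in> {M..<M + n}"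
    then show "indicator {0<..\<gamma>} (\<beta> ((\<sigma> ^^ (k - M)) \<omega>)) = (indicator {..\<gamma>} (d k) :: real)"
      using fut[of "k - M"] pos(1)[of "k - M"] by (auto simp: indicator_def)
  qed auto
  then show "real (num_good \<gamma> (map d [M..<M + n])) = good_visits \<beta> \<gamma> \<sigma> n \<omega>"
    unfolding num_good_interval .
  assume n: "n \<le> M + 1"
  have "(\<Sum>k\<in>{M + 1 - n..<M + 1}. indicator {..\<gamma>} (d k)) = good_visits \<beta> \<gamma> \<tau> n \<omega>"
    unfolding good_visits_def
  proof (rule sum.reindex_bij_witness[of _ "\<lambda>k. M - k" "\<lambda>k. M - k"])
    fix k assume "k \<in> {M + 1 - n..<M + 1}"
    then show "indicator {0<..\<gamma>} (\<beta> ((\<tau> ^^ (M - k)) \<omega>)) = (indicator {..\<gamma>} (d k) :: real)"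
      using past[of "M - k"] pos(2)[of "M - k"] by (auto simp: indicator_def)
  qed (use n in auto)
  then show "real (num_good \<gamma> (map d [M + 1 - n..<M + 1])) = good_visits \<beta> \<gamma> \<tau> n \<omega>"
    unfolding num_good_interval .
qed


text \<open>
  For every \<open>m\<close> the orbit is started \<open>m\<close> steps before \<open>\<omega>\<close> from Lebesgue measure, which leads to
  a finite list of parameters with \<open>\<omega>'\<close> at position \<open>m + r\<close>.  The bound obtained from it is
  independent of \<open>m\<close>.
\<close>

lemma (in contraction_constants) quenched_decay:
  fixes \<sigma> \<tau> :: "'a \<Rightarrow> 'a" and \<beta> :: "'a \<Rightarrow> real" and h :: "'a \<Rightarrow> real \<Rightarrow> real" and \<omega> :: 'a
    and b \<epsilon> :: real and r n N :: nat
  assumes b: "0 < b" and \<epsilon>: "0 < \<epsilon>" "\<epsilon> \<le> \<delta> / 8"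
    and g: "Lip01 g1" "Lip01 g2"
    and maps: "\<And>x. x \<in> S \<Longrightarrow> \<sigma> x \<in> S" "\<And>x. x \<in> S \<Longrightarrow> \<tau> x \<in> S"
      "\<And>x. x \<in> S \<Longrightarrow> \<tau> (\<sigma> x) = x" "\<And>x. x \<in> S \<Longrightarrow> \<sigma> (\<tau> x) = x" and \<omega>: "\<omega> \<in> S"
    and \<beta>: "\<And>k l. \<beta> ((\<tau> ^^ l) ((\<sigma> ^^ k) \<omega>)) \<in> {0<..\<alpha>}"
    and h: "\<And>k. h ((\<sigma> ^^ k) \<omega>) \<in> borel_measurable leb01" "\<And>k. AE x in leb01. 0 \<le> h ((\<sigma> ^^ k) \<omega>) x"
      "\<And>k. prob_space (fibre_measure h ((\<sigma> ^^ k) \<omega>))"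
      "\<And>k. distr (fibre_measure h ((\<sigma> ^^ k) \<omega>)) leb01 (lsv (\<beta> ((\<sigma> ^^ k) \<omega>))) = fibre_measure h (\<sigma> ((\<sigma> ^^ k) \<omega>))"
      "\<And>k. (\<lambda>m. L1_norm leb01 (\<lambda>x. transfer_cocycle \<sigma> \<beta> m ((\<tau> ^^ m) ((\<sigma> ^^ k) \<omega>)) (\<lambda>_. 1) x - h ((\<sigma> ^^ k) \<omega>) x)) \<longlonglongrightarrow> 0"
    and n: "1 \<le> n"
  defines "\<omega>' \<equiv> (\<sigma> ^^ r) \<omega>"
  defines "\<nu> \<equiv> fibre_measure h ((\<sigma> ^^ n) \<omega>')"
  defines "q \<equiv> 1/\<gamma> - 1"
  defines "D \<equiv> (4 / \<delta>) powr q + 2 * tail_const \<gamma> (b / 4) * (2 / \<delta>) powr q"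
  assumes fut: "\<And>k. N < k \<Longrightarrow> good_visits \<beta> \<gamma> \<sigma> k \<omega>' \<in> {b * (1 - \<epsilon>) * k..b * (1 + \<epsilon>) * k}"
    and past: "\<And>k. N < k \<Longrightarrow> good_visits \<beta> \<gamma> \<tau> k \<omega>' \<in> {b * (1 - \<epsilon>) * k..b * (1 + \<epsilon>) * k}"
  shows "L1_norm \<nu> (centred \<nu> (norm_transfer_cocycle \<sigma> \<beta> h n \<omega>' (\<lambda>x. g2 x * norm_transfer_cocycle \<sigma> \<beta> h r \<omega> g1 x)))
    \<le> ennreal (18 * D * (1 + Lip_norm g1) * (1 + Lip_norm g2) * (1 + real N) powr max 1 q * real n powr (- q))"
proof -
  have cancel_\<sigma>\<tau>: "(\<sigma> ^^ (l + k)) ((\<tau> ^^ k) x) = (\<sigma> ^^ l) x" "(\<sigma> ^^ k) ((\<tau> ^^ (k + l)) x) = (\<tau> ^^ l) x"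
    if "x \<in> S" for x k l
    by (rule funpow_cancel[of S \<tau> \<sigma>, OF maps(2,4) that]; assumption)+
  have inS: "(\<sigma> ^^ k) \<omega> \<in> S" for k by (rule funpow_mem[OF maps(1) \<omega>])
  have \<beta>0: "\<beta> ((\<sigma> ^^ k) \<omega>) \<in> {0<..\<alpha>}" for k using \<beta>[of 0 k] by simp
  have \<beta>pos: "0 < \<beta> ((\<sigma> ^^ k) \<omega>)" for k using \<beta>0[of k] by simp
  define H where "H = (\<lambda>k m. transfers (map (\<lambda>l. \<beta> ((\<sigma> ^^ l) ((\<tau> ^^ m) ((\<sigma> ^^ k) \<omega>)))) [0..<m]) (\<lambda>_. 1))"
  have Hpar: "set (map (\<lambda>l. \<beta> ((\<sigma> ^^ l) ((\<tau> ^^ m) ((\<sigma> ^^ k) \<omega>)))) [0..<m]) \<subseteq> {0<..\<alpha>}" for k m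
  proof -
    have "(\<sigma> ^^ l) ((\<tau> ^^ m) ((\<sigma> ^^ k) \<omega>)) = (\<tau> ^^ (m - l)) ((\<sigma> ^^ k) \<omega>)" if "l < m" for l
      using cancel_\<sigma>\<tau>(2)[OF inS[of k], of l "m - l"] that by simp
    then show ?thesis using \<beta> by (auto simp del: greaterThanAtMost_iff)
  qed
  have Hpos: "set (map (\<lambda>l. \<beta> ((\<sigma> ^^ l) ((\<tau> ^^ m) ((\<sigma> ^^ k) \<omega>)))) [0..<m]) \<subseteq> {0<..}" for k m
    by (rule order_trans[OF Hpar]) auto
  have Hint: "integrable leb01 (H k m)" for k m
    unfolding H_def by (rule integrable_transfers[OF Hpos integrable_leb01_const])
  have Habs: "mass (\<lambda>x. \<bar>H k m x\<bar>) \<le> 1" for k m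
  proof -
    have "mass (\<lambda>x. \<bar>H k m x\<bar>) \<le> mass (\<lambda>x. \<bar>1\<bar>)"
      unfolding H_def by (rule mass_abs_transfers_le[OF Hpos integrable_leb01_const])
    then show ?thesis unfolding mass_const by simp
  qed
  have hint: "integrable leb01 (h ((\<sigma> ^^ k) \<omega>))" "mass (\<lambda>x. \<bar>h ((\<sigma> ^^ k) \<omega>) x\<bar>) = 1" for k
    using prob_density_integral[OF h(1,2), of k] h(3)[of k] by (auto simp: fibre_measure_def)
  have lim: "(\<lambda>m. L1_dist (H k m) (h ((\<sigma> ^^ k) \<omega>))) \<longlonglongrightarrow> 0" for k
  proof -
    have "L1_norm leb01 (\<lambda>x. transfer_cocycle \<sigma> \<beta> m ((\<tau> ^^ m) ((\<sigma> ^^ k) \<omega>)) (\<lambda>_. 1) x - h ((\<sigma> ^^ k) \<omega>) x)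
        = ennreal (L1_dist (H k m) (h ((\<sigma> ^^ k) \<omega>)))" for m
    proof -
      have "transfer_cocycle \<sigma> \<beta> m ((\<tau> ^^ m) ((\<sigma> ^^ k) \<omega>)) (\<lambda>_. 1) = H k m"
        by (simp add: H_def transfer_cocycle_eq_transfers)
      then show ?thesis
        unfolding L1_norm_def using Hint[of k m] hint(1)[of k] by (simp add: nn_integral_eq_integral)
    qed
    then have "(\<lambda>m. ennreal (L1_dist (H k m) (h ((\<sigma> ^^ k) \<omega>)))) \<longlonglongrightarrow> 0" using h(5)[of k] by simp
    then show ?thesis by (subst (asm) ennreal_tendsto_0_iff) auto
  qed
  have hpos: "AE x in leb01. 0 < h ((\<sigma> ^^ k) \<omega>) x" for k
  proof -
    have "AE x in leb01. c \<le> h ((\<sigma> ^^ k) \<omega>) x"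
      by (rule lower_bound_L1_limit[OF Hint _ hint(1) lim]) (use c(3)[OF Hpar] in \<open>auto simp: H_def\<close>)
    then show ?thesis by eventually_elim (use c(1) in simp)
  qed
  have inv: "AE x in leb01. transfer (\<beta> ((\<sigma> ^^ k) \<omega>)) (h ((\<sigma> ^^ k) \<omega>)) x = h ((\<sigma> ^^ Suc k) \<omega>) x" for k
    by (rule transfer_eq_next_density[OF \<beta>pos h(1,2) h(1,2)])
      (use h(4)[of k] in \<open>simp add: fibre_measure_def\<close>)
  obtain B1 where g1: "g1 \<in> borel_measurable leb01" "\<And>x. x \<in> {0..1} \<Longrightarrow> \<bar>g1 x\<bar> \<le> B1"
    using Lip01_decomposition[OF g(1)] by metis
  obtain B2 where g2: "g2 \<in> borel_measurable leb01" "\<And>x. x \<in> {0..1} \<Longrightarrow> \<bar>g2 x\<bar> \<le> B2"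
    using Lip01_decomposition[OF g(2)] by metis
  define ms where "ms = map (\<lambda>k. \<beta> ((\<sigma> ^^ k) \<omega>)) [0..<r]"
  define fs where "fs = map (\<lambda>k. \<beta> ((\<sigma> ^^ k) \<omega>')) [0..<n]"
  have shift: "(\<sigma> ^^ k) \<omega>' = (\<sigma> ^^ (k + r)) \<omega>" for k by (simp add: \<omega>'_def funpow_add)
  have ms: "set ms \<subseteq> {0<..}" and fs: "set fs \<subseteq> {0<..}"
    using \<beta>pos by (auto simp: ms_def fs_def shift)
  let ?R = "18 * D * (1 + Lip_norm g1) * (1 + Lip_norm g2) * (1 + real N) powr max 1 q * real n powr (- q)"
  have bound: "mass (\<lambda>x. \<bar>transfers fs (centred_product g1 g2 ms (H 0 m)) x\<bar>) \<le> ?R" for m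
  proof -
    define d where "d = (\<lambda>k. \<beta> ((\<sigma> ^^ k) ((\<tau> ^^ m) \<omega>)))"
    have start: "(\<tau> ^^ m) \<omega> = (\<tau> ^^ (m + r)) \<omega>'"
      unfolding \<omega>'_def by (rule funpow_cancel(1)[of S \<sigma> \<tau>, OF maps(1,3) \<omega>, symmetric]; assumption)
    have \<omega>'S: "\<omega>' \<in> S" unfolding \<omega>'_def by (rule inS)
    have dfut: "d (m + r + k) = \<beta> ((\<sigma> ^^ k) \<omega>')" for k
      unfolding d_def start using cancel_\<sigma>\<tau>(1)[OF \<omega>'S, of k "m + r"] by (simp add: add.commute)
    have dpast: "d (m + r - k) = \<beta> ((\<tau> ^^ k) \<omega>')" if "k \<le> m + r" for k
      unfolding d_def start using cancel_\<sigma>\<tau>(2)[OF \<omega>'S, of "m + r - k" k] that by simp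
    have dmid: "d (m + k) = \<beta> ((\<sigma> ^^ k) \<omega>)" for k
      unfolding d_def using cancel_\<sigma>\<tau>(1)[OF \<omega>, of k m] by (simp add: add.commute)
    have d: "d k \<in> {0<..\<alpha>}" for k
    proof (cases "k \<le> m + r")
      case True
      then show ?thesis using dpast[of "m + r - k"] \<beta>[of "m + r - k" r] by (simp add: \<omega>'_def)
    next
      case False
      then show ?thesis using dfut[of "k - (m + r)"] \<beta>0 by (simp add: shift)
    qed
    have pos': "0 < \<beta> ((\<sigma> ^^ k) \<omega>')" "0 < \<beta> ((\<tau> ^^ k) \<omega>')" for k
      using \<beta>pos[of "k + r"] \<beta>[of k r] by (simp_all add: shift) (simp add: \<omega>'_def)
    have visits: "real (num_good \<gamma> (map d [m + r..<m + r + k])) = good_visits \<beta> \<gamma> \<sigma> k \<omega>'"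
      "k \<le> m + r + 1 \<Longrightarrow> real (num_good \<gamma> (map d [m + r + 1 - k..<m + r + 1])) = good_visits \<beta> \<gamma> \<tau> k \<omega>'" for k
      by (rule num_good_eq_good_visits[where \<beta> = \<beta> and \<sigma> = \<sigma> and \<tau> = \<tau>]; (rule pos' dfut dpast | assumption)+)+
    have lists: "H 0 m = transfers (map d [0..<m]) (\<lambda>_. 1)" "ms = map d [m..<m + r]"
      "fs = map d [m + r..<m + r + n]"
      by (simp add: H_def d_def)
         (auto intro!: nth_equalityI simp: ms_def fs_def dmid dfut)
    show ?thesis unfolding lists D_def q_def
    proof (rule centred_product_decay[OF d b \<epsilon> g _ _ n])
      show "real (num_good \<gamma> (map d [m + r..<m + r + k])) \<in> {b * (1 - \<epsilon>) * k..b * (1 + \<epsilon>) * k}" if "N < k" for k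
        using fut[OF that] visits(1) by simp
      show "b * (1 - \<epsilon>) * k \<le> real (num_good \<gamma> (map d [m + r + 1 - k..<m + r + 1]))"
        if "N < k" "k \<le> m + r + 1" for k
        using past[OF that(1)] visits(2)[OF that(2)] by simp
    qed
  qed
  have "mass (\<lambda>x. \<bar>transfers fs (centred_product g1 g2 ms (h \<omega>)) x\<bar>) \<le> ?R"
    by (rule centred_product_limit_bound[OF g1 g2 ms fs _ _ Hint Habs _ bound])
      (use hint[of 0] lim[of 0] in auto)
  moreover have "L1_norm \<nu> (centred \<nu> (norm_transfer_cocycle \<sigma> \<beta> h n \<omega>' (\<lambda>x. g2 x * norm_transfer_cocycle \<sigma> \<beta> h r \<omega> g1 x)))
    = ennreal (mass (\<lambda>x. \<bar>transfers fs (centred_product g1 g2 ms (h \<omega>)) x\<bar>))"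
    unfolding \<nu>_def \<omega>'_def fs_def ms_def
    by (rule L1_norm_centred_eq[OF \<beta>pos h(1) hpos inv _ g1 g2]) (use hint[of 0] in auto)
  ultimately show ?thesis by (simp add: ennreal_leI)
qed


theorem theorem24:
  fixes P :: "'a measure" and \<sigma> :: "'a \<Rightarrow> 'a" and \<beta> :: "'a \<Rightarrow> real" and \<gamma> :: real
  assumes "prob_space P"
    and "invertible_mpt P \<sigma>" and "ergodic P \<sigma>"
    and "\<beta> \<in> borel_measurable P"
    and "\<And>\<omega>. \<omega> \<in> space P \<Longrightarrow> \<beta> \<omega> \<in> {0<..<1}"
    and "esssup P (\<lambda>\<omega>. ereal (\<beta> \<omega>)) < 1"
    and "\<gamma> \<in> {0<..<1}"
    and "good_prob P \<beta> \<gamma> > 0"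
  shows "\<exists>\<epsilon>0 \<in> {0<..<1/2}. \<exists>C > 0. \<forall>h. random_acim_density P \<sigma> \<beta> h \<longrightarrow>
    (\<forall>g1 g2 :: real \<Rightarrow> real. Lip01 g1 \<longrightarrow> Lip01 g2 \<longrightarrow>
      (\<forall>\<epsilon> \<in> {0<..\<epsilon>0}. \<forall>s i j :: nat. s \<le> i \<longrightarrow> i < j \<longrightarrow>
        (AE \<omega> in P.
          L1_norm (fibre_measure h ((\<sigma> ^^ j) \<omega>))
            (centred (fibre_measure h ((\<sigma> ^^ j) \<omega>))
              (norm_transfer_cocycle \<sigma> \<beta> h (j - i) ((\<sigma> ^^ i) \<omega>)
                (\<lambda>x. g2 x * norm_transfer_cocycle \<sigma> \<beta> h (i - s) ((\<sigma> ^^ s) \<omega>) g1 x)))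
          \<le> ennreal (C * (1 + Lip_norm g1) * (1 + Lip_norm g2)
               * (1 + real (N_dev P \<sigma> \<beta> \<gamma> \<epsilon> ((\<sigma> ^^ i) \<omega>))) powr (max 1 (1/\<gamma> - 1))
               * real (j - i) powr (- 1/\<gamma> + 1)))))"
proof -
  interpret prob_space P by fact
  define \<tau> where "\<tau> = inv_into (space P) \<sigma>"
  define b where "b = good_prob P \<beta> \<gamma>"
  define q where "q = 1/\<gamma> - 1"
  note mpt = inverse_mpt[OF assms(1-3), folded \<tau>_def]
  have \<gamma>: "0 < \<gamma>" "\<gamma> < 1" and b: "0 < b" and q: "0 < q" "1 - 1/\<gamma> = - q"
    using assms(7,8) by (auto simp: b_def q_def)
  have \<beta>01: "0 < \<beta> \<omega>" "\<beta> \<omega> < 1" if "\<omega> \<in> space P" for \<omega> using assms(5)[OF that] by auto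
  obtain a :: real where a: "esssup P (\<lambda>\<omega>. ereal (\<beta> \<omega>)) < ereal a" "ereal a < 1"
    using ereal_dense2[OF assms(6)] by blast
  define \<alpha> where "\<alpha> = max a (1/2)"
  have \<alpha>: "0 < \<alpha>" "\<alpha> < 1" using a(2) by (auto simp: \<alpha>_def one_ereal_def)
  have AE\<alpha>: "AE \<omega> in P. \<beta> \<omega> \<le> \<alpha>"
    using esssup_AE[where M = P and f = "\<lambda>\<omega>. ereal (\<beta> \<omega>)"]
  proof eventually_elim
    case (elim \<omega>)
    then have "ereal (\<beta> \<omega>) < ereal a" using a(1) by (rule le_less_trans)
    then show ?case by (simp add: \<alpha>_def)
  qed
  obtain c where c: "0 < c" "c \<le> 1"
    "\<And>as x. set as \<subseteq> {0<..\<alpha>} \<Longrightarrow> 0 < x \<Longrightarrow> x < 1 \<Longrightarrow> c \<le> transfers as (\<lambda>_. 1) x"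
    using transfers_one_lower_bound[OF \<alpha>] by blast
  \<comment> \<open>\<open>\<delta>\<close> solves \<open>(1 - \<delta>) powr q = (1 - 2/5 * c) / (1 - 1/5 * c)\<close>, so that one block of length
    \<open>\<delta> n\<close> contracts by more than the target rate \<open>n powr (- q)\<close> varies over it.\<close>
  define \<rho> where "\<rho> = (1 - 2/5 * c) / (1 - 1/5 * c)"
  define \<delta> where "\<delta> = 1 - \<rho> powr (1/q)"
  have \<rho>: "0 < \<rho>" "\<rho> < 1" using c(1,2) by (auto simp: \<rho>_def field_simps)
  have "0 < \<rho> powr (1/q)" "\<rho> powr (1/q) < 1"
    using \<rho> q(1) powr_less_mono2[of "1/q" \<rho> 1] by auto
  then have \<delta>: "0 < \<delta>" "\<delta> < 1" by (auto simp: \<delta>_def)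
  have "(1 - \<delta>) powr (- q) = inverse \<rho>"
    using \<rho> q(1) by (simp add: \<delta>_def powr_powr powr_minus)
  then have "(1 - 2/5 * c) * (1 - \<delta>) powr (1 - 1/\<gamma>) = 1 - 1/5 * c"
    using c(1,2) by (simp add: q(2) \<rho>_def field_simps)
  then have \<delta>c: "(1 - 2/5 * c) * (1 - \<delta>) powr (1 - 1/\<gamma>) \<le> 1 - 1/5 * c" by simp
  interpret constants: contraction_constants c \<alpha> \<gamma> \<delta>
    by (intro contraction_constants.intro c \<alpha> \<gamma> \<delta> \<delta>c)
  define D where "D = (4 / \<delta>) powr q + 2 * tail_const \<gamma> (b / 4) * (2 / \<delta>) powr q"
  have D: "0 < D"
    unfolding D_def using \<delta> tail_const_nonneg[OF \<gamma>]
    by (intro add_pos_nonneg mult_nonneg_nonneg) auto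
  show ?thesis
  proof (rule bexI[of _ "\<delta> / 8"], rule exI[of _ "18 * D"], intro conjI allI impI ballI)
    \<comment> \<open>Deviations of relative size \<open>\<epsilon> \<le> \<delta> / 8\<close> leave a positive frequency on the last
      \<open>\<delta> n / 2\<close> of \<open>n\<close> steps.\<close>
    show "\<delta> / 8 \<in> {0<..<1/2}" using \<delta> by simp
    show "18 * D > 0" using D by simp
  next
    fix h and g1 g2 :: "real \<Rightarrow> real" and \<epsilon> :: real and s i j :: nat
    assume h: "random_acim_density P \<sigma> \<beta> h" and g: "Lip01 g1" "Lip01 g2"
      and \<epsilon>: "\<epsilon> \<in> {0<..\<delta> / 8}" and ij: "s \<le> i" "i < j"
    define r where "r = i - s"
    define n where "n = j - i"
    have n: "1 \<le> n" using ij by (simp add: n_def)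
    have h1: "AE \<omega> in P. h \<omega> \<in> borel_measurable leb01 \<and> (AE x in leb01. 0 \<le> h \<omega> x) \<and> prob_space (fibre_measure h \<omega>)"
      and h2: "AE \<omega> in P. distr (fibre_measure h \<omega>) leb01 (lsv (\<beta> \<omega>)) = fibre_measure h (\<sigma> \<omega>)"
      and h3: "AE \<omega> in P. (\<lambda>n. L1_norm leb01 (\<lambda>x. transfer_cocycle \<sigma> \<beta> n ((\<tau> ^^ n) \<omega>) (\<lambda>_. 1) x - h \<omega> x)) \<longlonglongrightarrow> 0"
      using h unfolding random_acim_density_def \<tau>_def by blast+
    have visits: "AE \<omega> in P. \<forall>k>last_deviation P \<beta> \<gamma> \<epsilon> T \<omega>.
        good_visits \<beta> \<gamma> T k \<omega> \<in> {b * (1 - \<epsilon>) * k..b * (1 + \<epsilon>) * k}"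
      if "T \<in> P \<rightarrow>\<^sub>M P" "distr P P T = P" "ergodic P T" for T
      unfolding b_def
      by (rule AE_good_visits_after_last_deviation[OF assms(1) that assms(4) \<beta>01(1) assms(8)]) (use \<epsilon> in auto)
    have visits2: "AE \<omega> in P. \<forall>k>N_dev P \<sigma> \<beta> \<gamma> \<epsilon> \<omega>.
        good_visits \<beta> \<gamma> \<sigma> k \<omega> \<in> {b * (1 - \<epsilon>) * k..b * (1 + \<epsilon>) * k} \<and>
        good_visits \<beta> \<gamma> \<tau> k \<omega> \<in> {b * (1 - \<epsilon>) * k..b * (1 + \<epsilon>) * k}"
      using visits[OF mpt(1,2) assms(3)] visits[OF mpt(3,4,5)]
    proof eventually_elim
      case (elim \<omega>)
      have "last_deviation P \<beta> \<gamma> \<epsilon> \<sigma> \<omega> \<le> N_dev P \<sigma> \<beta> \<gamma> \<epsilon> \<omega>" "last_deviation P \<beta> \<gamma> \<epsilon> \<tau> \<omega> \<le> N_dev P \<sigma> \<beta> \<gamma> \<epsilon> \<omega>"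
        unfolding N_dev_def \<tau>_def by (intro Max_ge; simp)+
      then show ?case using elim by (meson le_less_trans)
    qed
    note orbit = AE_funpow[OF mpt(1,2)]
    show "AE \<omega> in P.
          L1_norm (fibre_measure h ((\<sigma> ^^ j) \<omega>))
            (centred (fibre_measure h ((\<sigma> ^^ j) \<omega>))
              (norm_transfer_cocycle \<sigma> \<beta> h (j - i) ((\<sigma> ^^ i) \<omega>)
                (\<lambda>x. g2 x * norm_transfer_cocycle \<sigma> \<beta> h (i - s) ((\<sigma> ^^ s) \<omega>) g1 x)))
          \<le> ennreal (18 * D * (1 + Lip_norm g1) * (1 + Lip_norm g2)
               * (1 + real (N_dev P \<sigma> \<beta> \<gamma> \<epsilon> ((\<sigma> ^^ i) \<omega>))) powr (max 1 (1/\<gamma> - 1))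
               * real (j - i) powr (- 1/\<gamma> + 1))"
      using orbit[OF AE_funpow[OF mpt(3,4) AE\<alpha>]] orbit[OF h1] orbit[OF h2] orbit[OF h3] orbit[OF visits2] AE_space
    proof eventually_elim
      case (elim \<omega>)
      define \<omega>s where "\<omega>s = (\<sigma> ^^ s) \<omega>"
      have from_s: "(\<sigma> ^^ k) \<omega>s = (\<sigma> ^^ (k + s)) \<omega>" for k by (simp add: \<omega>s_def funpow_add)
      have \<omega>s: "\<omega>s \<in> space P" unfolding \<omega>s_def by (rule funpow_mem[OF mpt(6) elim(6)])
      have i: "(\<sigma> ^^ i) \<omega> = (\<sigma> ^^ r) \<omega>s" using ij by (simp add: from_s r_def)
      have j: "(\<sigma> ^^ j) \<omega> = (\<sigma> ^^ n) ((\<sigma> ^^ r) \<omega>s)"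
      proof -
        have "(\<sigma> ^^ n) ((\<sigma> ^^ r) \<omega>s) = (\<sigma> ^^ (n + r + s)) \<omega>" by (simp add: \<omega>s_def funpow_add)
        then show ?thesis using ij by (simp add: n_def r_def)
      qed
      have \<beta>\<alpha>: "\<beta> ((\<tau> ^^ l) ((\<sigma> ^^ k) \<omega>s)) \<in> {0<..\<alpha>}" for k l
      proof -
        have "(\<tau> ^^ l) ((\<sigma> ^^ k) \<omega>s) \<in> space P"
          by (intro funpow_mem[OF mpt(7)] funpow_mem[OF mpt(6)] \<omega>s)
        then show ?thesis using \<beta>01(1) elim(1) by (simp add: from_s)
      qed
      let ?N = "N_dev P \<sigma> \<beta> \<gamma> \<epsilon> ((\<sigma> ^^ i) \<omega>)"
      have "L1_norm (fibre_measure h ((\<sigma> ^^ n) ((\<sigma> ^^ r) \<omega>s)))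
          (centred (fibre_measure h ((\<sigma> ^^ n) ((\<sigma> ^^ r) \<omega>s)))
            (norm_transfer_cocycle \<sigma> \<beta> h n ((\<sigma> ^^ r) \<omega>s) (\<lambda>x. g2 x * norm_transfer_cocycle \<sigma> \<beta> h r \<omega>s g1 x)))
        \<le> ennreal (18 * D * (1 + Lip_norm g1) * (1 + Lip_norm g2) * (1 + real ?N) powr max 1 q * real n powr (- q))"
        unfolding D_def q_def
      proof (rule constants.quenched_decay[where S = "space P" and \<tau> = \<tau> and \<epsilon> = \<epsilon>])
        show "good_visits \<beta> \<gamma> \<sigma> k ((\<sigma> ^^ r) \<omega>s) \<in> {b * (1 - \<epsilon>) * k..b * (1 + \<epsilon>) * k}"
          "good_visits \<beta> \<gamma> \<tau> k ((\<sigma> ^^ r) \<omega>s) \<in> {b * (1 - \<epsilon>) * k..b * (1 + \<epsilon>) * k}" if "?N < k" for k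
          using elim(5) that unfolding i[symmetric] by blast+
        show "distr (fibre_measure h ((\<sigma> ^^ k) \<omega>s)) leb01 (lsv (\<beta> ((\<sigma> ^^ k) \<omega>s))) = fibre_measure h (\<sigma> ((\<sigma> ^^ k) \<omega>s))" for k
          using elim(3) by (simp only: from_s)
        show "h ((\<sigma> ^^ k) \<omega>s) \<in> borel_measurable leb01" "AE x in leb01. 0 \<le> h ((\<sigma> ^^ k) \<omega>s) x"
          "prob_space (fibre_measure h ((\<sigma> ^^ k) \<omega>s))" for k
          using elim(2) unfolding from_s by blast+
        show "(\<lambda>m. L1_norm leb01 (\<lambda>x. transfer_cocycle \<sigma> \<beta> m ((\<tau> ^^ m) ((\<sigma> ^^ k) \<omega>s)) (\<lambda>_. 1) x - h ((\<sigma> ^^ k) \<omega>s) x)) \<longlonglongrightarrow> 0" for k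
          using elim(4) unfolding from_s by blast
        show "0 < \<epsilon>" "\<epsilon> \<le> \<delta> / 8" using \<epsilon> by auto
      qed (rule b g mpt(6-9) \<omega>s \<beta>\<alpha> n; assumption)+
      moreover have rate: "- q = - 1/\<gamma> + 1" by (simp add: q_def)
      ultimately show ?case
        unfolding rate unfolding j i n_def r_def \<omega>s_def q_def by blast
    qed
  qed
qed


end
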